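(* Let $A,B$ be positive bounded operators on a Hilbert space $\mathcal{H}$. Let $f(A,B)$ denote Pusz--Woronowicz's functional calculus (defined in the context). Then the following hold. (1) For any homogeneous $f\in\mathscr{B}_{\mathrm{locb}}([0,\infty)^2)$, \[ f(A,B)=\begin{cases} A^{1/2}f(1,A^{-1/2}BA^{-1/2})A^{1/2} & \text{if } A \text{ is invertible},\\ B^{1/2}f(B^{-1/2}AB^{-1/2},1)B^{1/2} & \text{if } B\text{ is invertible}.\end{cases} \] When both $A$ and $B$ are invertible, \[ f(A,B)=A^{1/2}f(1,A^{-1/2}BA^{-1/2})A^{1/2}=B^{1/2}f(B^{-1/2}AB^{-1/2},1)B^{1/2} \] holds for any homogeneous $f\in\mathscr{B}_{\mathrm{locb}}((0,\infty)^2)$. (2) If $0$ is an isolated point of $\sigma(A+B)$, then for any homogeneous $f\in C([0,\infty)^2)$, \[ f(A,B)=\lim_{(\varepsilon_1,\varepsilon_2)\searrow(0,0)} f(A_{\varepsilon_1},B_{\varepsilon_2}) \] in the operator norm topology, where $A_{\varepsilon_1}:=A+\varepsilon_1 I_{\mathcal{H}}$ and $B_{\varepsilon_2}:=B+\varepsilon_2 I_{\mathcal{H}}$. In particular, if $\mathcal{H}$ is finite dimensional, this convergence holds for every pair $A,B$ of positive operators on $\mathcal{H}$ and every homogeneous $f\in C([0,\infty)^2)$.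
   Context: Conventions. An operator is called invertible if it has a bounded inverse; $\sigma(T)$ is the spectrum. $\mathscr{B}_{\mathrm{locb}}(\Omega)$ is the set of (complex-valued) Borel functions on $\Omega$ that are bounded on every compact subset of $\Omega$; $C(\Omega)$ is the set of continuous functions. A function $f$ on $[0,\infty)^2$ (resp. $(0,\infty)^2$) is homogeneous if $f(\lambda r,\lambda s)=\lambda f(r,s)$ for all $\lambda,r,s\ge 0$ (resp. $\lambda,r,s>0$). The limit $(\varepsilon_1,\varepsilon_2)\searrow(0,0)$ is over $\varepsilon_1,\varepsilon_2\ge 0$ and means $\varepsilon_1+\varepsilon_2\searrow 0$. $f(1,T)$ and $f(T,1)$ denote the Borel functional calculus of the selfadjoint operator $T$ with the functions $t\mapsto f(1,t)$ and $t\mapsto f(t,1)$, respectively. Functional calculus of commuting selfadjoint operators. For commuting bounded selfadjoint operators $S,T$ and a bounded Borel function $g$ on $\sigma(S)\times\sigma(T)$, $g(S,T):=\hat g(N)$, where $N=S+iT$ (normal), $\hat g(z)=g(\mathrm{Re}\,z,\mathrm{Im}\,z)$, and $\hat g(N)$ is the Borel functional calculus of $N$. Pusz--Woronowicz's functional calculus. Let $A,B$ be positive bounded operators on $\mathcal{H}$. Put $\mathcal{H}_0:=\mathrm{Ker}(A+B)$, $\mathcal{H}_1:=\mathcal{H}_0^\perp$. Then $A=0\oplus A_1$, $B=0\oplus B_1$ along $\mathcal{H}=\mathcal{H}_0\oplus\mathcal{H}_1$, with $\mathrm{Ker}(A_1+B_1)=\{0\}$. Let $X,Y$ be the unique contractions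 on $\mathcal{H}_1$ with $X(A_1+B_1)^{1/2}=A_1^{1/2}$ and $Y(A_1+B_1)^{1/2}=B_1^{1/2}$, and set $R:=X^*X$, $S:=Y^*Y$. One has $R+S=I_{\mathcal{H}_1}$, so $R,S$ are commuting positive contractions. For a homogeneous $f\in\mathscr{B}_{\mathrm{locb}}([0,\infty)^2)$ define \[ f(A,B):=0\oplus (A_1+B_1)^{1/2}f(R,S)(A_1+B_1)^{1/2}\quad\text{along } \mathcal{H}=\mathcal{H}_0\oplus\mathcal{H}_1 . \] When $A+B$ is invertible, $\mathcal{H}_1=\mathcal{H}$, $R=(A+B)^{-1/2}A(A+B)^{-1/2}$ and $S=(A+B)^{-1/2}B(A+B)^{-1/2}$. When both $A$ and $B$ are invertible, $R,S$ are invertible too, and the same formula $f(A,B):=(A+B)^{1/2}f(R,S)(A+B)^{1/2}$ defines $f(A,B)$ for any homogeneous $f\in\mathscr{B}_{\mathrm{locb}}((0,\infty)^2)$. *)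

theory Defs
  imports "HOL-Analysis.Analysis"
begin

section \<open>Complex Hilbert spaces\<close>

text \<open>
  The inner product is linear in its first argument.  Norm, distance, completeness and definiteness
  are those of the underlying real inner product space, whose inner product is the real part of
  \<open>cinner\<close>.
\<close>

class complex_inner = real_inner +
  fixes scaleC :: "complex \<Rightarrow> 'a \<Rightarrow> 'a"  (infixr \<open>*\<^sub>C\<close> 75)
    and cinner :: "'a \<Rightarrow> 'a \<Rightarrow> complex"
  assumes scaleC_add_right: "c *\<^sub>C (x + y) = c *\<^sub>C x + c *\<^sub>C y"
    and scaleC_add_left: "(c + d) *\<^sub>C x = c *\<^sub>C x + d *\<^sub>C x"
    and scaleC_scaleC: "c *\<^sub>C (d *\<^sub>C x) = (c * d) *\<^sub>C x"
    and scaleC_of_real: "complex_of_real r *\<^sub>C x = r *\<^sub>R x"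
    and cinner_add_left: "cinner (x + y) z = cinner x z + cinner y z"
    and cinner_scaleC_left: "cinner (c *\<^sub>C x) y = c * cinner x y"
    and cinner_commute: "cinner y x = cnj (cinner x y)"
    and Re_cinner: "Re (cinner x y) = inner x y"

class chilbert_space = complex_inner + complete_space
begin
subclass banach ..
end

lemma vector_space_scaleC:
  "vector_space (scaleC :: complex \<Rightarrow> 'a::complex_inner \<Rightarrow> 'a)"
proof
  fix x :: 'a
  show "1 *\<^sub>C x = x"
    using scaleC_of_real[of 1 x] by simp
qed (simp_all add: scaleC_add_right scaleC_add_left scaleC_scaleC)

lemma cinner_scaleC_right:
  "cinner x (c *\<^sub>C y) = cnj c * cinner (x :: 'a::complex_inner) y"
  by (metis cinner_commute cinner_scaleC_left complex_cnj_mult)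

lemma norm_scaleC: "norm (c *\<^sub>C (x :: 'a::complex_inner)) = cmod c * norm x"
proof -
  have "(norm (c *\<^sub>C x))\<^sup>2 = Re ((c * cnj c) * cinner x x)"
    by (simp add: power2_norm_eq_inner cinner_scaleC_left cinner_scaleC_right
        flip: Re_cinner mult.assoc)
  also have "\<dots> = (cmod c * norm x)\<^sup>2"
    by (simp add: complex_norm_square[symmetric] power2_norm_eq_inner[of x] power_mult_distrib
        Re_cinner)
  finally show ?thesis
    by (simp add: power2_eq_iff_nonneg)
qed

definition cfinite_dim :: "'h::chilbert_space itself \<Rightarrow> bool" where
  "cfinite_dim _ \<longleftrightarrow> (\<exists>F. finite F \<and> module.span scaleC F = (UNIV :: 'h set))"


section \<open>Bounded operators on closed subspaces\<close>

text \<open>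
  Bounded complex-linear operators are members of the type of bounded real-linear maps that are
  complex homogeneous; the real and the complex operator norm coincide.

  A bounded operator \<open>T\<close> on a closed subspace \<open>M\<close> is represented by \<open>0 \<oplus> T\<close> along
  \<open>M\<^sup>\<bottom> \<oplus> M\<close>, that is, by the operator on the whole space which maps into \<open>M\<close> and vanishes on
  \<open>M\<^sup>\<bottom>\<close>.  Under this identification sums, products, adjoints, norms, positivity and
  positive square roots agree with those in the algebra of operators on \<open>M\<close>, whose unit is the
  orthogonal projection onto \<open>M\<close>.  Notions that depend on the unit (invertibility, spectrum,
  functional calculus) take \<open>M\<close> as an argument; \<open>M = UNIV\<close> gives the usual notions.
\<close>

type_synonym 'h op = "'h \<Rightarrow>\<^sub>L 'h"

lift_definition scaleC_op :: "complex \<Rightarrow> 'h::chilbert_space op \<Rightarrow> 'h op" is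
  "\<lambda>c T x. c *\<^sub>C T x"
proof -
  fix c :: complex and T :: "'h \<Rightarrow> 'h"
  assume "bounded_linear T"
  moreover have "bounded_linear (\<lambda>x :: 'h. c *\<^sub>C x)"
  proof (rule bounded_linear_intro)
    show "c *\<^sub>C (r *\<^sub>R x) = r *\<^sub>R (c *\<^sub>C x)" for r and x :: 'h
      by (simp add: scaleC_scaleC mult.commute flip: scaleC_of_real)
    show "norm (c *\<^sub>C x) \<le> norm x * cmod c" for x :: 'h
      by (simp add: norm_scaleC)
  qed (simp add: scaleC_add_right)
  ultimately show "bounded_linear (\<lambda>x. c *\<^sub>C T x)"
    by (rule bounded_linear_compose[rotated])
qed

definition ocompl :: "'h::chilbert_space set \<Rightarrow> 'h set" where
  "ocompl M = {x. \<forall>y\<in>M. cinner x y = 0}"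

definition ker_op :: "'h::chilbert_space op \<Rightarrow> 'h set" where
  "ker_op T = {x. T x = 0}"

definition proj :: "'h::chilbert_space set \<Rightarrow> 'h op" where
  "proj M = (THE P :: 'h op. \<forall>x. P x \<in> M \<and> x - P x \<in> ocompl M)"

definition op_on :: "'h::chilbert_space set \<Rightarrow> 'h op \<Rightarrow> bool" where
  "op_on M T \<longleftrightarrow> (\<forall>c x. T (c *\<^sub>C x) = c *\<^sub>C T x) \<and> (\<forall>x. T x \<in> M) \<and> (\<forall>x\<in>ocompl M. T x = 0)"

definition compress :: "'h::chilbert_space set \<Rightarrow> 'h op \<Rightarrow> 'h op" where
  "compress M T = proj M o\<^sub>L T o\<^sub>L proj M"

definition adj :: "'h::chilbert_space op \<Rightarrow> 'h op" where
  "adj T = (THE T' :: 'h op. \<forall>x y. cinner (T x) y = cinner x (T' y))"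

definition positive_op :: "'h::chilbert_space op \<Rightarrow> bool" where
  "positive_op T \<longleftrightarrow> op_on UNIV T \<and> (\<forall>x. cinner (T x) x \<in> \<real>\<^sub>\<ge>\<^sub>0)"

definition sqrt_op :: "'h::chilbert_space op \<Rightarrow> 'h op" where
  "sqrt_op T = (THE C. positive_op C \<and> C o\<^sub>L C = T)"

definition is_inverse_on :: "'h::chilbert_space set \<Rightarrow> 'h op \<Rightarrow> 'h op \<Rightarrow> bool" where
  "is_inverse_on M T T' \<longleftrightarrow> op_on M T' \<and> T o\<^sub>L T' = proj M \<and> T' o\<^sub>L T = proj M"

definition spectrum_on :: "'h::chilbert_space set \<Rightarrow> 'h op \<Rightarrow> complex set" where
  "spectrum_on M T = {z. \<not> (\<exists>T'. is_inverse_on M (scaleC_op z (proj M) - T) T')}"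

definition invertible_op :: "'h::chilbert_space op \<Rightarrow> bool" where
  "invertible_op T \<longleftrightarrow> (\<exists>T'. is_inverse_on UNIV T T')"

definition inv_op :: "'h::chilbert_space op \<Rightarrow> 'h op" where
  "inv_op T = (THE T'. is_inverse_on UNIV T T')"


section \<open>Borel functional calculus\<close>

text \<open>The last clause only makes \<open>E\<close> unique as a total function on sets.\<close>

definition projection_valued_measure ::
    "'h::chilbert_space set \<Rightarrow> (complex set \<Rightarrow> 'h op) \<Rightarrow> bool" where
  "projection_valued_measure M E \<longleftrightarrow>
     (\<forall>D\<in>sets borel. op_on M (E D) \<and> adj (E D) = E D) \<and>
     (\<forall>D\<in>sets borel. \<forall>D'\<in>sets borel. E (D \<inter> D') = E D o\<^sub>L E D') \<and>
     E UNIV = proj M \<and>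
     (\<forall>F :: nat \<Rightarrow> complex set. range F \<subseteq> sets borel \<longrightarrow> disjoint_family F \<longrightarrow>
        (\<forall>x. (\<lambda>n. E (F n) x) sums E (\<Union>n. F n) x)) \<and>
     (\<forall>D. D \<notin> sets borel \<longrightarrow> E D = 0)"

definition scalar_measure ::
    "(complex set \<Rightarrow> 'h::chilbert_space op) \<Rightarrow> 'h \<Rightarrow> complex measure" where
  "scalar_measure E x = measure_of UNIV (sets borel) (\<lambda>D. ennreal (Re (cinner (E D x) x)))"

definition is_spectral_measure ::
    "'h::chilbert_space set \<Rightarrow> 'h op \<Rightarrow> (complex set \<Rightarrow> 'h op) \<Rightarrow> bool" where
  "is_spectral_measure M N E \<longleftrightarrow>
     projection_valued_measure M E \<and> E (spectrum_on M N) = proj M \<and>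
     (\<forall>x. cinner (N x) x = (LINT z:spectrum_on M N|scalar_measure E x. z))"

definition spectral_measure ::
    "'h::chilbert_space set \<Rightarrow> 'h op \<Rightarrow> (complex set \<Rightarrow> 'h op)" where
  "spectral_measure M N = (THE E. is_spectral_measure M N E)"

text \<open>
  \<open>borel_calc M N g\<close> is \<open>g(N)\<close> for a normal operator \<open>N\<close> on \<open>M\<close> and a bounded Borel function
  \<open>g\<close> on its spectrum, i.e. the integral of \<open>g\<close> against the spectral measure of \<open>N\<close>; an operator
  on a complex Hilbert space is determined by its quadratic form.
\<close>

definition borel_calc ::
    "'h::chilbert_space set \<Rightarrow> 'h op \<Rightarrow> (complex \<Rightarrow> complex) \<Rightarrow> 'h op" where
  "borel_calc M N g = (THE T. op_on M T \<and>
     (\<forall>x. cinner (T x) x =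
        (LINT z:spectrum_on M N|scalar_measure (spectral_measure M N) x. g z)))"

text \<open>The spectrum of a selfadjoint operator is real, so \<open>Re\<close> is only a change of type here.\<close>

definition selfadjoint_calc ::
    "(real \<Rightarrow> complex) \<Rightarrow> 'h::chilbert_space op \<Rightarrow> 'h op" where
  "selfadjoint_calc g T = borel_calc UNIV T (\<lambda>z. g (Re z))"

definition joint_calc ::
    "'h::chilbert_space set \<Rightarrow> (real \<times> real \<Rightarrow> complex) \<Rightarrow> 'h op \<Rightarrow> 'h op \<Rightarrow> 'h op" where
  "joint_calc M g S T = borel_calc M (S + scaleC_op \<i> T) (\<lambda>z. g (Re z, Im z))"


section \<open>The functional calculus of Pusz and Woronowicz\<close>

definition borel_locally_bounded :: "(real \<times> real) set \<Rightarrow> (real \<times> real \<Rightarrow> complex) set" where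
  "borel_locally_bounded \<Omega> =
     {f. f \<in> borel_measurable (restrict_space borel \<Omega>) \<and>
         (\<forall>K. compact K \<longrightarrow> K \<subseteq> \<Omega> \<longrightarrow> bounded (f ` K))}"

definition homogeneous_on :: "real set \<Rightarrow> (real \<times> real \<Rightarrow> complex) \<Rightarrow> bool" where
  "homogeneous_on I f \<longleftrightarrow>
     (\<forall>l\<in>I. \<forall>r\<in>I. \<forall>s\<in>I. f (l * r, l * s) = complex_of_real l * f (r, s))"

text \<open>
  For invertible \<open>A\<close> and \<open>B\<close> the joint spectrum of the operators \<open>R\<close> and \<open>S\<close> below lies in the
  open quadrant, so the same definition then also covers functions given on the open quadrant only.
  The operators \<open>X\<close>, \<open>Y\<close>, \<open>R\<close>, \<open>S\<close> live on the subspace \<open>M\<close>, and the result is already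
  extended by zero to the whole space.
\<close>

definition pw_calc ::
    "(real \<times> real \<Rightarrow> complex) \<Rightarrow> 'h::chilbert_space op \<Rightarrow> 'h op \<Rightarrow> 'h op" where
  "pw_calc f A B =
    (let M = ocompl (ker_op (A + B));
         A1 = compress M A;
         B1 = compress M B;
         C = sqrt_op (A1 + B1);
         X = (THE X. op_on M X \<and> norm X \<le> 1 \<and> X o\<^sub>L C = sqrt_op A1);
         Y = (THE Y. op_on M Y \<and> norm Y \<le> 1 \<and> Y o\<^sub>L C = sqrt_op B1);
         R = adj X o\<^sub>L X;
         S = adj Y o\<^sub>L Y
     in C o\<^sub>L joint_calc M f R S o\<^sub>L C)"

end

theory Submission
  imports Defs "HOL-Probability.Probability"
begin

text \<open>
  For a positive contraction \<open>T\<close> and a vector \<open>x\<close> the numbers \<open>\<langle>T\<^sup>k (1 - T)\<^sup>j x, x\<rangle>\<close> are nonnegative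
  and satisfy Pascal's recurrence, so Hausdorff's theorem makes \<open>\<langle>T\<^sup>n x, x\<rangle>\<close> the moments of a measure
  on \<open>[0, 1]\<close>.  These measures assemble to the spectral measure of \<open>T\<close>, and hence of every
  operator \<open>c + d T\<close>.

  Since measures on \<open>[0, 1]\<close> are determined by their moments, (1) is a comparison of moments.
  Put \<open>C = (A + B)\<^sup>1\<^sup>/\<^sup>2\<close>, \<open>y = A\<^sup>1\<^sup>/\<^sup>2 x\<close> and \<open>T = A\<^sup>-\<^sup>1\<^sup>/\<^sup>2 B A\<^sup>-\<^sup>1\<^sup>/\<^sup>2\<close>.  Then
  \<open>\<langle>R\<^sup>n C x, C x\<rangle> = \<langle>(1 + T)\<^sup>1\<^sup>-\<^sup>n y, y\<rangle>\<close>, so the map \<open>r = 1 / (1 + t)\<close> carries \<open>1 + t\<close> times the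
  spectral measure of \<open>T\<close> at \<open>y\<close> to the spectral measure of \<open>R\<close> at \<open>C x\<close>.

  For (2), \<open>f (r, 1 - r)\<close> is approximated uniformly on \<open>[0, 1]\<close> by polynomials.  The monomials give
  \<open>C R\<^sup>n\<^sup>+\<^sup>1 C = (A G)\<^sup>n A\<close>, where \<open>G\<close> inverts \<open>A + B\<close> on the orthogonal complement of its kernel, and
  the gap in the spectrum makes \<open>G\<close> bounded and continuous in the perturbation.
\<close>

section \<open>Operators on complex Hilbert spaces\<close>

text \<open>Every object in the statement (\<open>proj\<close>, \<open>adj\<close>,
  \<open>sqrt_op\<close>, the spectral measure, \<open>borel_calc\<close>, \<open>X\<close>,
  \<open>Y\<close>) is a definite description, so existence and uniqueness must be proved before any
  formula can be used; this is why a spectral theorem is built here. Moments serve both halves: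
  Hausdorff's theorem gives existence, determinacy on a compact interval gives uniqueness. The
  measures arise one vector at a time, with no visible dependence on the vector. Operators are
  recovered from them by polarization and bounded limits, and products are inherited from the powers
  of \<open>T\<close>. In (1), \<open>R\<close> is \<open>X* X\<close> while the inverse of
  \<open>1 + T\<close> is \<open>X X*\<close>, so the two are only unitarily equivalent; comparing
  moments avoids constructing the unitary. In (2), the isolated point and the finite-dimensional
  case share one hypothesis: the spectral projection of \<open>A + B\<close> for some interval (0,
  \<delta>) vanishes. This form also covers an invertible \<open>A + B\<close> in finite
  dimension.\<close>

lemma cinner_add_right: "cinner x (y + z) = cinner x y + cinner x (z :: 'a::complex_inner)"
  by (metis cinner_add_left cinner_commute complex_cnj_add)

lemma scaleR_scaleC: "r *\<^sub>R x = complex_of_real r *\<^sub>C (x :: 'a::complex_inner)"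
  by (simp add: scaleC_of_real)

lemma cinner_eq_norm: "cinner x x = complex_of_real ((norm (x :: 'a::complex_inner))\<^sup>2)"
proof (rule complex_eqI)
  show "Re (cinner x x) = Re (complex_of_real ((norm x)\<^sup>2))"
    by (simp add: Re_cinner power2_norm_eq_inner)
  have "Im (cinner x x) = - Im (cinner x x)"
    using arg_cong[OF cinner_commute[of x x], of Im] by simp
  then show "Im (cinner x x) = Im (complex_of_real ((norm x)\<^sup>2))"
    by simp
qed

lemma cmod_cinner_le: "cmod (cinner x y) \<le> norm x * norm (y :: 'a::complex_inner)"
proof (cases "cinner x y = 0")
  case False
  \<comment> \<open>Multiplying \<open>x\<close> by this phase turns \<open>cinner x y\<close> into
    its modulus, so the real Cauchy-Schwarz inequality applies.\<close>
  define u where "u = cnj (cinner x y) / cmod (cinner x y)"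
  have u: "cmod u = 1"
    using False by (simp add: u_def norm_divide)
  have "complex_of_real (cmod (cinner x y)) = u * cinner x y"
    using False complex_norm_square[of "cinner x y"]
    by (simp add: u_def field_simps power2_eq_square)
  then have "cmod (cinner x y) = Re (cinner (u *\<^sub>C x) y)"
    by (metis Re_complex_of_real cinner_scaleC_left)
  also have "\<dots> \<le> norm (u *\<^sub>C x) * norm y"
    by (simp add: Re_cinner norm_cauchy_schwarz)
  finally show ?thesis
    by (simp add: norm_scaleC u)
qed simp

interpretation cinner: bounded_bilinear "cinner :: 'a::complex_inner \<Rightarrow> 'a \<Rightarrow> complex"
proof
  fix a a' b b' :: 'a and r :: real
  show "cinner (a + a') b = cinner a b + cinner a' b" by (rule cinner_add_left)
  show "cinner a (b + b') = cinner a b + cinner a b'" by (rule cinner_add_right)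
  show "cinner (r *\<^sub>R a) b = r *\<^sub>R cinner a b"
    by (simp add: scaleR_scaleC cinner_scaleC_left scaleR_conv_of_real)
  show "cinner a (r *\<^sub>R b) = r *\<^sub>R cinner a b"
    by (simp add: scaleR_scaleC cinner_scaleC_right scaleR_conv_of_real)
  show "\<exists>K. \<forall>a b :: 'a. norm (cinner a b) \<le> norm a * norm b * K"
    by (rule exI[of _ 1]) (simp add: cmod_cinner_le)
qed

declare cinner.zero_left [simp] cinner.zero_right [simp]

lemma scaleC_one [simp]: "1 *\<^sub>C (x :: 'a::complex_inner) = x"
  using scaleC_of_real[of 1 x] by simp

lemma scaleC_zero_left [simp]: "0 *\<^sub>C (x :: 'a::complex_inner) = 0"
  using scaleC_of_real[of 0 x] by simp

lemma scaleC_zero_right [simp]: "c *\<^sub>C (0 :: 'a::complex_inner) = 0"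
  using norm_scaleC[of c 0] by simp

lemma scaleC_minus_left: "(- c) *\<^sub>C (x :: 'a::complex_inner) = - (c *\<^sub>C x)"
  using scaleC_add_left[of c "- c" x] by (simp add: eq_neg_iff_add_eq_0 add.commute)

lemma scaleC_minus_right: "c *\<^sub>C (- x :: 'a::complex_inner) = - (c *\<^sub>C x)"
  using scaleC_add_right[of c x "- x"] by (simp add: eq_neg_iff_add_eq_0 add.commute)

lemma scaleC_diff_right: "c *\<^sub>C (x - y :: 'a::complex_inner) = c *\<^sub>C x - c *\<^sub>C y"
  using scaleC_add_right[of c x "- y"] by (simp add: scaleC_minus_right)

lemma scaleC_diff_left: "(c - d) *\<^sub>C (x :: 'a::complex_inner) = c *\<^sub>C x - d *\<^sub>C x"
  using scaleC_add_left[of c "- d" x] by (simp add: scaleC_minus_left)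

lemma cinner_eqI:
  assumes "\<And>z. cinner x z = cinner (y :: 'a::complex_inner) z"
  shows "x = y"
proof -
  have "cinner (x - y) (x - y) = 0"
    by (simp add: cinner.diff_left assms)
  then show ?thesis
    by (simp add: cinner_eq_norm)
qed

definition clinear_op :: "'h::chilbert_space op \<Rightarrow> bool" where
  "clinear_op T \<longleftrightarrow> (\<forall>c x. T (c *\<^sub>C x) = c *\<^sub>C T x)"

lemma clinear_opD: "clinear_op T \<Longrightarrow> T (c *\<^sub>C x) = c *\<^sub>C T x"
  by (simp add: clinear_op_def)

lemma scaleC_op_apply [simp]: "scaleC_op c T x = c *\<^sub>C T x"
  by transfer simp

lemma clinear_op_simps [simp]:
  "clinear_op 0" "clinear_op id_blinfun"
  "clinear_op S \<Longrightarrow> clinear_op T \<Longrightarrow> clinear_op (S + T)"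
  "clinear_op S \<Longrightarrow> clinear_op T \<Longrightarrow> clinear_op (S - T)"
  "clinear_op S \<Longrightarrow> clinear_op T \<Longrightarrow> clinear_op (S o\<^sub>L T)"
  "clinear_op S \<Longrightarrow> clinear_op (scaleC_op c S)"
  "clinear_op S \<Longrightarrow> clinear_op (r *\<^sub>R S)"
  by (simp_all add: clinear_op_def blinfun.add_left blinfun.diff_left blinfun.scaleR_left
      scaleC_add_right scaleC_diff_right scaleC_scaleC mult.commute scaleR_scaleC)

lemma clinear_op_uminus [simp]: "clinear_op S \<Longrightarrow> clinear_op (- S)"
  by (simp add: clinear_op_def blinfun.minus_left scaleC_minus_right)

lemma clinear_op_polarization:
  assumes G: "clinear_op G"
  shows "cinner (G x) y = (1/4) * (cinner (G (x + y)) (x + y) - cinner (G (x - y)) (x - y)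
     + \<i> * cinner (G (x + \<i> *\<^sub>C y)) (x + \<i> *\<^sub>C y) - \<i> * cinner (G (x - \<i> *\<^sub>C y)) (x - \<i> *\<^sub>C y))"
  by (simp add: blinfun.add_right blinfun.diff_right cinner.add_left cinner.add_right
      cinner.diff_left cinner.diff_right clinear_opD[OF G] cinner_scaleC_left cinner_scaleC_right
      algebra_simps)

text \<open>Over the complex scalars polarization recovers an operator from its quadratic form; many
  operator identities below are checked on the diagonal only.\<close>

lemma op_eqI:
  assumes "clinear_op G" "clinear_op G'" "\<And>x. cinner (G x) x = cinner (G' x) x"
  shows "G = G'"
  by (intro blinfun_eqI cinner_eqI)
    (metis clinear_op_polarization[OF assms(1)] clinear_op_polarization[OF assms(2)] assms(3))

text \<open>Polarizing \<open>cinner (T y) x\<close> exchanges the roles of \<open>x\<close> and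
  \<open>y\<close>. These identities bring its imaginary terms back to those of
  \<open>cinner (T x) y\<close>, up to a unimodular factor that the form does not see.\<close>

lemma scaleC_imag_swap: "x + \<i> *\<^sub>C y = \<i> *\<^sub>C (y - \<i> *\<^sub>C (x :: 'a::complex_inner))"
  "x - \<i> *\<^sub>C y = (- \<i>) *\<^sub>C (y + \<i> *\<^sub>C (x :: 'a::complex_inner))"
  by (simp_all add: scaleC_diff_right scaleC_add_right scaleC_scaleC scaleC_minus_left)

lemma selfadjoint_if_real_form:
  assumes T: "clinear_op T" and real: "\<And>x. cinner (T x) x \<in> \<real>"
  shows "cinner (T x) y = cinner x (T y)"
proof -
  define q where "q z = cinner (T z) z" for z
  have q_scale: "q (c *\<^sub>C z) = (cmod c)\<^sup>2 * q z" for c z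
    by (simp add: q_def clinear_opD[OF T] cinner_scaleC_left cinner_scaleC_right
        complex_norm_square mult.commute del: of_real_power)
  have cnj: "cnj (q z) = q z" for z
    using real[of z] by (auto simp: q_def elim: Reals_cases)
  have "cinner x (T y) = cnj (cinner (T y) x)"
    by (rule cinner_commute)
  also have "\<dots> = 1/4 * (q (y + x) - q (y - x) - \<i> * q (y + \<i> *\<^sub>C x) + \<i> * q (y - \<i> *\<^sub>C x))"
    by (subst clinear_op_polarization[OF T]) (simp add: q_def[symmetric] cnj)
  also have "q (y + x) = q (x + y)"
    by (simp add: add.commute)
  also have "q (y - x) = q (x - y)"
    using q_scale[of "-1" "x - y"] by (simp add: scaleC_minus_left)
  also have "q (y + \<i> *\<^sub>C x) = q (x - \<i> *\<^sub>C y)"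
    by (simp add: scaleC_imag_swap(2) q_scale)
  also have "q (y - \<i> *\<^sub>C x) = q (x + \<i> *\<^sub>C y)"
    by (simp add: scaleC_imag_swap(1) q_scale)
  finally show ?thesis
    by (subst clinear_op_polarization[OF T]) (simp add: q_def[symmetric])
qed

lemma ocompl_UNIV [simp]: "ocompl UNIV = {0 :: 'h::chilbert_space}"
proof -
  have "x = 0" if "\<forall>y. cinner x y = 0" for x :: 'h
    using cinner_eqI[of x 0] that by simp
  then show ?thesis
    by (auto simp: ocompl_def)
qed

lemma op_on_UNIV: "op_on UNIV T \<longleftrightarrow> clinear_op T"
  by (auto simp: op_on_def clinear_op_def)

lemma op_onD: "op_on M T \<Longrightarrow> clinear_op T" "op_on M T \<Longrightarrow> T x \<in> M"
  by (auto simp: op_on_def clinear_op_def)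

lemma nonneg_Reals_complex: "z \<in> \<real>\<^sub>\<ge>\<^sub>0 \<longleftrightarrow> Im z = 0 \<and> 0 \<le> Re z"
  by (auto simp: complex_nonneg_Reals_iff)

lemma positive_opD:
  assumes "positive_op T"
  shows "clinear_op T" "cinner (T x) y = cinner x (T y)" "cinner (T x) x = of_real (inner (T x) x)"
    "0 \<le> inner (T x) x"
proof -
  show T: "clinear_op T"
    using assms by (simp add: positive_op_def op_on_UNIV)
  have "cinner (T x) x \<in> \<real>\<^sub>\<ge>\<^sub>0" for x
    using assms by (simp add: positive_op_def)
  then have *: "Im (cinner (T x) x) = 0" "0 \<le> Re (cinner (T x) x)" for x
    by (simp_all add: nonneg_Reals_complex)
  show "cinner (T x) y = cinner x (T y)"
    by (rule selfadjoint_if_real_form[OF T]) (simp add: complex_is_Real_iff *)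
  show "cinner (T x) x = of_real (inner (T x) x)"
    by (rule complex_eqI) (simp_all add: * Re_cinner)
  show "0 \<le> inner (T x) x"
    using * by (simp add: Re_cinner)
qed

lemma positive_opI:
  assumes "clinear_op T" "\<And>x. \<exists>r\<ge>0. cinner (T x) x = of_real r"
  shows "positive_op T"
  unfolding positive_op_def op_on_UNIV using assms
  by (metis Im_complex_of_real Re_complex_of_real nonneg_Reals_complex)

text \<open>For unit vectors the four squared norms in the polarization formula add up to 8 by the
  parallelogram law; the factor 1/4 leaves the constant 2. This 2 reappears in all operator norm
  bounds derived from forms.\<close>

lemma form_bound_polarized:
  assumes G: "clinear_op G" and C: "\<And>x. cmod (cinner (G x) x) \<le> C * (norm x)\<^sup>2"
  shows "cmod (cinner (G x) y) \<le> 2 * C * (norm x * norm y)"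
proof (cases "x = 0 \<or> y = 0")
  case True
  then show ?thesis by (auto simp: blinfun.zero_right)
next
  case False
  define q where "q z = cinner (G z) z" for z
  have bound: "cmod (cinner (G x) y) \<le> 2 * C" if x: "norm x = 1" and y: "norm y = 1" for x y
  proof -
    have "4 * cmod (cinner (G x) y) = cmod (q (x + y) - q (x - y)
        + \<i> * q (x + \<i> *\<^sub>C y) - \<i> * q (x - \<i> *\<^sub>C y))"
      by (subst clinear_op_polarization[OF G]) (simp add: q_def[symmetric] norm_mult norm_divide)
    also have "\<dots> \<le> cmod (q (x + y)) + cmod (q (x - y)) + cmod (q (x + \<i> *\<^sub>C y)) + cmod (q (x - \<i> *\<^sub>C y))"
      by (intro order.trans[OF norm_triangle_ineq4] order.trans[OF norm_triangle_ineq] add_mono)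
        (auto simp: norm_mult norm_triangle_ineq4)
    also have "\<dots> \<le> C * (norm (x + y))\<^sup>2 + C * (norm (x - y))\<^sup>2
        + C * (norm (x + \<i> *\<^sub>C y))\<^sup>2 + C * (norm (x - \<i> *\<^sub>C y))\<^sup>2"
      by (intro add_mono) (auto simp: q_def C)
    also have "\<dots> = 4 * (2 * C)"
    proof -
      have "(norm (u + v))\<^sup>2 + (norm (u - v))\<^sup>2 = 2 * ((norm u)\<^sup>2 + (norm v)\<^sup>2)" for u v :: 'a
        by (simp add: power2_norm_eq_inner inner_simps inner_commute)
      from this[of x y] this[of x "\<i> *\<^sub>C y"] have
        "(norm (x + y))\<^sup>2 + (norm (x - y))\<^sup>2 = 4" "(norm (x + \<i> *\<^sub>C y))\<^sup>2 + (norm (x - \<i> *\<^sub>C y))\<^sup>2 = 4"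
        by (simp_all add: x y norm_scaleC)
      moreover have "C * p + C * q + C * r + C * s = C * (p + q) + C * (r + s)" for p q r s
        by (simp add: distrib_left)
      ultimately show ?thesis
        by simp
    qed
    finally show ?thesis by simp
  qed
  define x' y' where "x' = x /\<^sub>R norm x" and "y' = y /\<^sub>R norm y"
  have "cmod (cinner (G x') y') \<le> 2 * C"
    using False by (intro bound) (simp_all add: x'_def y'_def)
  moreover have "cmod (cinner (G x') y') = cmod (cinner (G x) y) / (norm x * norm y)"
    by (simp add: x'_def y'_def blinfun.scaleR_right cinner.scaleR_left cinner.scaleR_right
        norm_mult divide_inverse)
  ultimately show ?thesis
    using False by (simp add: field_simps)
qed

lemma norm_op_le_form:
  assumes G: "clinear_op G" and C: "\<And>x. cmod (cinner (G x) x) \<le> C * (norm x)\<^sup>2"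
  shows "norm (G x) \<le> 2 * C * norm x" "0 \<le> C \<Longrightarrow> norm G \<le> 2 * C"
proof -
  show *: "norm (G x) \<le> 2 * C * norm x" for x
  proof (cases "G x = 0")
    case True
    show ?thesis
    proof (cases "x = 0")
      case False
      have "0 \<le> C * (norm x)\<^sup>2"
        using C[of x] by (meson norm_ge_zero order.trans)
      then have "0 \<le> C"
        using False by (simp add: zero_le_mult_iff)
      then show ?thesis
        using True by simp
    qed (simp add: blinfun.zero_right)
  next
    case False
    have "(norm (G x))\<^sup>2 = cmod (cinner (G x) (G x))"
      by (simp add: cinner_eq_norm norm_power)
    also have "\<dots> \<le> 2 * C * (norm x * norm (G x))"
      by (rule form_bound_polarized[OF G C])
    finally show ?thesis
      using False by (simp add: power2_eq_square mult.assoc[symmetric])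
  qed
  show "norm G \<le> 2 * C" if "0 \<le> C"
    by (rule norm_blinfun_bound) (use * that in auto)
qed

section \<open>Orthogonal projections and the Riesz representation\<close>

definition csubspace :: "'h::chilbert_space set \<Rightarrow> bool" where
  "csubspace M \<longleftrightarrow> closed M \<and> 0 \<in> M \<and> (\<forall>x\<in>M. \<forall>y\<in>M. x + y \<in> M) \<and> (\<forall>c. \<forall>x\<in>M. c *\<^sub>C x \<in> M)"

lemma csubspaceD:
  assumes "csubspace M"
  shows "closed M" "0 \<in> M" "x \<in> M \<Longrightarrow> y \<in> M \<Longrightarrow> x + y \<in> M" "x \<in> M \<Longrightarrow> c *\<^sub>C x \<in> M"
    "x \<in> M \<Longrightarrow> y \<in> M \<Longrightarrow> x - y \<in> M" "x \<in> M \<Longrightarrow> r *\<^sub>R x \<in> M"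
proof -
  show "closed M" "0 \<in> M" "x \<in> M \<Longrightarrow> y \<in> M \<Longrightarrow> x + y \<in> M" and sc: "\<And>x c. x \<in> M \<Longrightarrow> c *\<^sub>C x \<in> M"
    using assms by (auto simp: csubspace_def)
  show "x \<in> M \<Longrightarrow> y \<in> M \<Longrightarrow> x - y \<in> M"
    using sc[of y "-1"] assms by (auto simp: csubspace_def scaleC_minus_left
        simp del: add_uminus_conv_diff simp flip: add_uminus_conv_diff)
  show "x \<in> M \<Longrightarrow> r *\<^sub>R x \<in> M"
    using sc by (simp add: scaleR_scaleC)
qed

lemma csubspace_UNIV [simp]: "csubspace UNIV"
  by (simp add: csubspace_def)

lemma csubspace_ocompl [simp]: "csubspace (ocompl M)"
proof -
  have "ocompl M = (\<Inter>y\<in>M. {x. cinner x y = 0})"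
    by (auto simp: ocompl_def)
  moreover have "closed {x :: 'a. cinner x y = 0}" for y
    by (intro closed_Collect_eq continuous_intros
        bounded_linear.continuous_on[OF cinner.bounded_linear_left])
  ultimately have "closed (ocompl M)"
    by auto
  then show ?thesis
    by (auto simp: csubspace_def ocompl_def cinner.add_left cinner_scaleC_left)
qed

text \<open>A minimizing sequence is Cauchy: the midpoint of two of its terms stays in
  \<open>M\<close>, so its squared distance from \<open>x\<close> is at least \<open>d\<close>, and
  the parallelogram law then bounds the distance of the two terms.\<close>

lemma closest_point_csubspace:
  assumes M: "csubspace M"
  shows "\<exists>m\<in>M. \<forall>m'\<in>M. norm (x - m) \<le> norm (x - m')"
proof -
  define d where "d = (INF m\<in>M. (norm (x - m))\<^sup>2)"
  have ne: "M \<noteq> {}" and bdd: "bdd_below ((\<lambda>m. (norm (x - m))\<^sup>2) ` M)"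
    using csubspaceD(2)[OF M] by (auto intro: bdd_belowI[of _ 0])
  have d_le: "d \<le> (norm (x - m))\<^sup>2" if "m \<in> M" for m
    unfolding d_def using bdd that by (intro cINF_lower)
  have "\<exists>m\<in>M. (norm (x - m))\<^sup>2 < d + 1 / Suc n" for n
  proof -
    have "d < d + 1 / Suc n" by simp
    then show ?thesis
      unfolding d_def by (subst (asm) cINF_less_iff[OF ne bdd]) auto
  qed
  then obtain m where m: "\<And>n. m n \<in> M" "\<And>n. (norm (x - m n))\<^sup>2 < d + 1 / Suc n"
    by metis
  have parallelogram: "(norm (u - v))\<^sup>2 = 2 * (norm (x - u))\<^sup>2 + 2 * (norm (x - v))\<^sup>2
      - 4 * (norm (x - (1/2) *\<^sub>R (u + v)))\<^sup>2" for u v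
    by (simp add: power2_norm_eq_inner inner_simps inner_commute algebra_simps)
  have close: "(norm (m p - m q))\<^sup>2 \<le> 4 / Suc n" if "n \<le> p" "n \<le> q" for p q n
  proof -
    have "(norm (m p - m q))\<^sup>2 \<le> 2 * (d + 1 / Suc p) + 2 * (d + 1 / Suc q) - 4 * d"
      using m(2)[of p] m(2)[of q] d_le[of "(1/2) *\<^sub>R (m p + m q)"] m(1) csubspaceD[OF M]
      by (subst parallelogram) (smt (verit))
    also have "\<dots> = 2 / Suc p + 2 / Suc q" by simp
    also have "\<dots> \<le> 2 / Suc n + 2 / Suc n"
      using that by (intro add_mono divide_left_mono) auto
    finally show ?thesis by simp
  qed
  have "Cauchy m"
    unfolding Cauchy_def
  proof (intro allI impI)
    fix e :: real assume "e > 0"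
    then obtain n where n: "4 / e\<^sup>2 < Suc n"
      using reals_Archimedean2[of "4 / e\<^sup>2"] by (metis less_Suc_eq of_nat_less_iff order.strict_trans)
    have "dist (m p) (m q) < e" if "n \<le> p" "n \<le> q" for p q
    proof -
      have "(norm (m p - m q))\<^sup>2 \<le> 4 / Suc n" using close that .
      also have "\<dots> < e\<^sup>2"
        using n \<open>e > 0\<close> by (simp add: field_simps)
      finally show ?thesis
        using \<open>e > 0\<close> by (simp add: dist_norm power2_less_imp_less)
    qed
    then show "\<exists>N. \<forall>p\<ge>N. \<forall>q\<ge>N. dist (m p) (m q) < e" by blast
  qed
  then obtain l where l: "m \<longlonglongrightarrow> l"
    using Cauchy_convergent_iff convergent_def by metis
  have "l \<in> M"
    using closed_sequentially[OF csubspaceD(1)[OF M]] l m(1) by blast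
  have "(norm (x - l))\<^sup>2 \<le> d"
  proof (rule LIMSEQ_le)
    show "(\<lambda>n. (norm (x - m n))\<^sup>2) \<longlonglongrightarrow> (norm (x - l))\<^sup>2"
      by (intro tendsto_intros l)
    show "(\<lambda>n. d + 1 / Suc n) \<longlonglongrightarrow> d"
      using tendsto_add[OF tendsto_const LIMSEQ_Suc[OF lim_1_over_n]] by fastforce
    show "\<exists>N. \<forall>n\<ge>N. (norm (x - m n))\<^sup>2 \<le> d + 1 / Suc n"
      using m(2) less_imp_le by blast
  qed
  then have "norm (x - l) \<le> norm (x - m')" if "m' \<in> M" for m'
    using d_le[OF that] by (meson norm_ge_zero order.trans power2_le_imp_le)
  then show ?thesis
    using \<open>l \<in> M\<close> by blast
qed

lemma csubspace_decomposition:
  assumes M: "csubspace M"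
  shows "\<exists>m\<in>M. x - m \<in> ocompl M"
proof -
  obtain m where m: "m \<in> M" "\<And>m'. m' \<in> M \<Longrightarrow> norm (x - m) \<le> norm (x - m')"
    using closest_point_csubspace[OF M] by blast
  have inner0: "inner (x - m) y = 0" if y: "y \<in> M" for y
  proof (cases "y = 0")
    case False
    \<comment> \<open>The minimizer of the quadratic polynomial \<open>t\<close> to
      \<open>(norm (x - (m + t *\<^sub>R y)))\<^sup>2\<close>. Since \<open>m\<close> is already
      closest, moving to it cannot decrease the distance.\<close>
    define t where "t = inner (x - m) y / (norm y)\<^sup>2"
    have "(norm (x - m))\<^sup>2 \<le> (norm (x - (m + t *\<^sub>R y)))\<^sup>2"
      using m(2)[of "m + t *\<^sub>R y"] csubspaceD[OF M] m(1) y by (intro power_mono) auto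
    also have "\<dots> = (norm (x - m))\<^sup>2 - 2 * t * inner (x - m) y + t * (t * (norm y)\<^sup>2)"
      by (simp add: power2_norm_eq_inner inner_simps inner_commute algebra_simps)
    also have "t * (norm y)\<^sup>2 = inner (x - m) y"
      using False by (simp add: t_def)
    finally have "t * inner (x - m) y \<le> 0" by simp
    moreover have "t * inner (x - m) y = (inner (x - m) y)\<^sup>2 / (norm y)\<^sup>2"
      by (simp add: t_def power2_eq_square)
    ultimately show ?thesis
      using False by (simp add: divide_le_0_iff)
  qed simp
  have "cinner (x - m) y = 0" if y: "y \<in> M" for y
  proof (rule complex_eqI)
    show "Re (cinner (x - m) y) = Re 0"
      by (simp add: Re_cinner inner0 y)
    \<comment> \<open>The imaginary part of \<open>cinner (x - m) y\<close> is the real part of the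
      pairing with \<open>\<i> *\<^sub>C y\<close>, which lies in \<open>M\<close> as well.\<close>
    have "Re (cinner (x - m) (\<i> *\<^sub>C y)) = 0"
      by (simp add: Re_cinner inner0 csubspaceD(4)[OF M] y)
    then show "Im (cinner (x - m) y) = Im 0"
      by (simp add: cinner_scaleC_right)
  qed
  with m(1) show ?thesis
    by (auto simp: ocompl_def)
qed

lemma csubspace_decomposition_unique:
  assumes M: "csubspace M" and "m \<in> M" "m' \<in> M" "x - m \<in> ocompl M" "x - m' \<in> ocompl M"
  shows "m = m'"
proof -
  have "m - m' \<in> M"
    using csubspaceD(5)[OF M] assms by blast
  moreover have "(x - m') - (x - m) \<in> ocompl M"
    using csubspaceD(5)[OF csubspace_ocompl] assms by blast
  ultimately have "cinner (m - m') (m - m') = 0"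
    by (auto simp: ocompl_def)
  then show ?thesis
    by (simp add: cinner_eq_norm)
qed

text \<open>The decomposition is first chosen point by point. Its uniqueness makes the choice
  linear, orthogonality makes it a contraction, and only then is there a bounded operator for the
  description \<open>proj\<close> to denote.\<close>

lemma proj_props:
  assumes M: "csubspace M"
  shows "proj M x \<in> M" "x - proj M x \<in> ocompl M" "clinear_op (proj M)"
proof -
  obtain p where p: "\<And>x. p x \<in> M" "\<And>x. x - p x \<in> ocompl M"
    using csubspace_decomposition[OF M] by metis
  note O = csubspaceD[OF csubspace_ocompl[of M]]
  have p_eq: "p x = m" if "m \<in> M" "x - m \<in> ocompl M" for x m
    using csubspace_decomposition_unique[OF M] p that by metis
  have add: "p (x + y) = p x + p y" for x y
    using O(3)[OF p(2)[of x] p(2)[of y]] by (intro p_eq csubspaceD[OF M] p) (simp add: algebra_simps)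
  have scale: "p (c *\<^sub>C x) = c *\<^sub>C p x" for c x
    using O(4)[OF p(2)[of x], of c] by (intro p_eq csubspaceD[OF M] p) (simp add: scaleC_diff_right)
  have "norm (p x) \<le> norm x" for x
  proof -
    have "cinner (x - p x) (p x) = 0"
      using p by (auto simp: ocompl_def)
    then have "inner x (p x) = (norm (p x))\<^sup>2"
      by (metis Re_cinner cinner.diff_left eq_iff_diff_eq_0 power2_norm_eq_inner)
    then have "(norm (p x))\<^sup>2 \<le> norm x * norm (p x)"
      by (metis norm_cauchy_schwarz)
    then show ?thesis
      by (cases "p x = 0") (auto simp: power2_eq_square)
  qed
  then have bl: "bounded_linear p"
    by (intro bounded_linear_intro[of _ 1]) (auto simp: add scale scaleR_scaleC)
  define P where "P = Blinfun p"
  have P: "P x = p x" for x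
    by (simp add: P_def bounded_linear_Blinfun_apply[OF bl])
  have "proj M = P"
    unfolding Defs.proj_def
    by (rule the_equality) (auto simp: P p intro!: blinfun_eqI p_eq[symmetric])
  then show "proj M x \<in> M" "x - proj M x \<in> ocompl M" "clinear_op (proj M)"
    by (auto simp: P p clinear_op_def scale)
qed

lemma proj_eqI:
  assumes M: "csubspace M" and "m \<in> M" "x - m \<in> ocompl M"
  shows "proj M x = m"
  using csubspace_decomposition_unique[OF M] proj_props[OF M] assms by blast

lemma proj_UNIV [simp]: "proj UNIV = (id_blinfun :: 'h::chilbert_space op)"
  by (intro blinfun_eqI) (simp add: proj_eqI)

lemma proj_fix: "csubspace M \<Longrightarrow> x \<in> M \<Longrightarrow> proj M x = x"
  by (rule proj_eqI) (auto intro: csubspaceD(2)[OF csubspace_ocompl])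

lemma proj_ocompl: "csubspace M \<Longrightarrow> x \<in> ocompl M \<Longrightarrow> proj M x = 0"
  by (rule proj_eqI) (auto intro: csubspaceD(2))

lemma proj_idem: "csubspace M \<Longrightarrow> proj M o\<^sub>L proj M = proj M"
  by (intro blinfun_eqI) (simp add: proj_fix proj_props)

lemma cinner_proj:
  assumes M: "csubspace M"
  shows "cinner (proj M x) y = cinner (proj M x) (proj M y)"
    "cinner x (proj M y) = cinner (proj M x) (proj M y)"
proof -
  have *: "cinner (y - proj M y) (proj M x) = 0" for x y
    using proj_props[OF M] by (auto simp: ocompl_def)
  show "cinner x (proj M y) = cinner (proj M x) (proj M y)"
    using *[of x y] by (simp add: cinner.diff_left)
  show "cinner (proj M x) y = cinner (proj M x) (proj M y)"
  proof -
    have "cinner y (proj M x) = cinner (proj M y) (proj M x)"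
      using *[of y x] by (simp add: cinner.diff_left)
    then show ?thesis
      by (subst (1 2) cinner_commute) simp
  qed
qed

lemma cinner_proj_self:
  assumes M: "csubspace M"
  shows "cinner (proj M x) x = of_real ((norm (proj M x))\<^sup>2)" "norm (proj M x) \<le> norm x"
proof -
  show *: "cinner (proj M x) x = of_real ((norm (proj M x))\<^sup>2)"
    by (simp add: cinner_proj(1)[OF M, of x x] cinner_eq_norm)
  have "(norm (proj M x))\<^sup>2 \<le> norm (proj M x) * norm x"
    using cmod_cinner_le[of "proj M x" x] unfolding * by (simp add: norm_power)
  then show "norm (proj M x) \<le> norm x"
    by (cases "proj M x = 0") (auto simp: power2_eq_square)
qed

text \<open>Turns "lives on \<open>M\<close>" into two equations with the unit
  \<open>proj M\<close>, so that membership passes through sums and products by rewriting.\<close>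

lemma op_on_iff:
  assumes M: "csubspace M"
  shows "op_on M T \<longleftrightarrow> clinear_op T \<and> proj M o\<^sub>L T = T \<and> T o\<^sub>L proj M = T"
proof safe
  assume T: "op_on M T"
  show "clinear_op T" "proj M o\<^sub>L T = T"
    using op_onD[OF T] by (auto intro!: blinfun_eqI proj_fix[OF M])
  show "T o\<^sub>L proj M = T"
  proof (rule blinfun_eqI)
    fix x
    have "T (x - proj M x) = 0"
      using T proj_props[OF M] by (auto simp: op_on_def)
    then show "(T o\<^sub>L proj M) x = T x"
      by (simp add: blinfun.diff_right)
  qed
next
  assume T: "clinear_op T" "proj M o\<^sub>L T = T" "T o\<^sub>L proj M = T"
  have "T x \<in> M" for x
    using proj_props(1)[OF M, of "T x"] T(2) by (metis blinfun_apply_blinfun_compose)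
  moreover have "T x = 0" if "x \<in> ocompl M" for x
    using T(3) proj_ocompl[OF M that] by (metis blinfun.zero_right blinfun_apply_blinfun_compose)
  ultimately show "op_on M T"
    using T(1) by (simp add: op_on_def clinear_op_def)
qed

lemma Riesz_representation:
  fixes \<phi> :: "'h::chilbert_space \<Rightarrow> complex"
  assumes \<phi>: "bounded_linear \<phi>" and hom: "\<And>c x. \<phi> (c *\<^sub>C x) = c * \<phi> x"
  shows "\<exists>y. \<forall>x. \<phi> x = cinner x y"
proof (cases "\<forall>x. \<phi> x = 0")
  case True
  then show ?thesis by (auto intro!: exI[of _ 0] simp: cinner.zero_right)
next
  case False
  then obtain x0 where x0: "\<phi> x0 \<noteq> 0" by blast
  interpret bounded_linear \<phi> by fact
  define K where "K = {x. \<phi> x = 0}"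
  have K: "csubspace K"
    unfolding csubspace_def K_def
    by (auto simp: add hom zero intro!: closed_Collect_eq continuous_on continuous_intros)
  define z where "z = x0 - proj K x0"
  have z: "\<phi> z \<noteq> 0" and zK: "z \<in> ocompl K"
    using proj_props(1,2)[OF K, of x0] x0 by (auto simp: z_def K_def diff)
  then have "z \<noteq> 0" by (auto simp: zero)
  \<comment> \<open>Scaled so that \<open>cinner z y = \<phi> z\<close>; every \<open>x\<close>
    differs from a multiple of \<open>z\<close> by an element of \<open>K\<close>, to which
    \<open>z\<close> is orthogonal.\<close>
  define y where "y = (cnj (\<phi> z) / (norm z)\<^sup>2) *\<^sub>C z"
  have "\<phi> x = cinner x y" for x
  proof -
    have "x - (\<phi> x / \<phi> z) *\<^sub>C z \<in> K"
      using z by (simp add: K_def diff hom)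
    then have "cinner z (x - (\<phi> x / \<phi> z) *\<^sub>C z) = 0"
      using zK by (auto simp: ocompl_def)
    then have "cinner (x - (\<phi> x / \<phi> z) *\<^sub>C z) z = 0"
      by (metis cinner_commute complex_cnj_zero)
    then have "cinner x z = (\<phi> x / \<phi> z) * (norm z)\<^sup>2"
      by (simp add: cinner.diff_left cinner_scaleC_left cinner_eq_norm)
    then show ?thesis
      using z \<open>z \<noteq> 0\<close> by (simp add: y_def cinner_scaleC_right)
  qed
  then show ?thesis by blast
qed

text \<open>The form is conjugate linear in its second argument, so the Riesz representation is
  applied to the conjugate of \<open>b x\<close>.\<close>

lemma op_of_form:
  fixes b :: "'h::chilbert_space \<Rightarrow> 'h \<Rightarrow> complex"
  assumes add_left: "\<And>x x' y. b (x + x') y = b x y + b x' y"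
    and scale_left: "\<And>c x y. b (c *\<^sub>C x) y = c * b x y"
    and add_right: "\<And>x y y'. b x (y + y') = b x y + b x y'"
    and scale_right: "\<And>c x y. b x (c *\<^sub>C y) = cnj c * b x y"
    and bound: "\<And>x y. cmod (b x y) \<le> C * (norm x * norm y)"
  shows "\<exists>G. clinear_op G \<and> (\<forall>x y. cinner (G x) y = b x y)"
proof -
  have "\<exists>z. \<forall>y. b x y = cinner z y" for x
  proof -
    have bl: "bounded_linear (\<lambda>y. cnj (b x y))"
    proof (rule bounded_linear_intro)
      show "norm (cnj (b x y)) \<le> norm y * (C * norm x)" for y
        using bound[of x y] by (simp add: ac_simps)
    qed (simp_all add: add_right scale_right scaleR_scaleC scaleR_conv_of_real)
    from Riesz_representation[OF this] obtain z where "\<And>y. cnj (b x y) = cinner y z"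
      by (auto simp: scale_right)
    then have "b x y = cinner z y" for y
      by (metis cinner_commute complex_cnj_cnj)
    then show ?thesis by blast
  qed
  then obtain g where g: "\<And>x y. b x y = cinner (g x) y" by metis
  have g_add: "g (x + x') = g x + g x'" for x x'
    by (intro cinner_eqI) (simp flip: g add: cinner.add_left add_left)
  have g_scale: "g (c *\<^sub>C x) = c *\<^sub>C g x" for c x
    by (intro cinner_eqI) (simp flip: g add: cinner_scaleC_left scale_left)
  have "norm (g x) \<le> norm x * C" for x
  proof (cases "g x = 0")
    case True
    show ?thesis
    proof (cases "x = 0")
      case False
      have "0 \<le> C * (norm x * norm x)"
        using bound[of x x] by (meson norm_ge_zero order.trans)
      moreover have "0 < norm x * norm x"
        using False by simp
      ultimately have "0 \<le> C"
        by (metis mult.commute zero_le_mult_iff less_le_not_le)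
      then show ?thesis using True by simp
    qed (use True in auto)
  next
    case False
    have "(norm (g x))\<^sup>2 = cmod (b x (g x))"
      by (simp add: g cinner_eq_norm norm_power)
    then show ?thesis
      using bound[of x "g x"] False mult_le_cancel_right_pos[of "norm (g x)" "norm (g x)" "norm x * C"]
      by (simp add: power2_eq_square ac_simps)
  qed
  then have bl: "bounded_linear g"
    by (intro bounded_linear_intro[of _ C]) (auto simp: g_add g_scale scaleR_scaleC)
  have "clinear_op (Blinfun g)" "\<forall>x y. cinner (Blinfun g x) y = b x y"
    by (simp_all add: clinear_op_def bounded_linear_Blinfun_apply[OF bl] g_scale g)
  then show ?thesis by blast
qed

text \<open>Convergence is assumed for quadratic forms only. Polarization spreads it to all pairs of
  vectors, and the limit is again a bounded sesquilinear form.\<close>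

lemma weak_limit_op:
  fixes G :: "nat \<Rightarrow> 'h::chilbert_space op"
  assumes G: "\<And>n. clinear_op (G n)"
    and bound: "\<And>n x. cmod (cinner (G n x) x) \<le> C * (norm x)\<^sup>2"
    and lim: "\<And>x. (\<lambda>n. cinner (G n x) x) \<longlonglongrightarrow> q x"
  shows "\<exists>L. clinear_op L \<and> (\<forall>x. cinner (L x) x = q x) \<and>
    (\<forall>x y. (\<lambda>n. cinner (G n x) y) \<longlonglongrightarrow> cinner (L x) y)"
proof -
  define b where "b x y = (1/4) * (q (x + y) - q (x - y) + \<i> * q (x + \<i> *\<^sub>C y) - \<i> * q (x - \<i> *\<^sub>C y))"
    for x y
  have b: "(\<lambda>n. cinner (G n x) y) \<longlonglongrightarrow> b x y" for x y
    unfolding b_def by (subst clinear_op_polarization[OF G]) (intro tendsto_intros lim)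
  have "\<exists>L. clinear_op L \<and> (\<forall>x y. cinner (L x) y = b x y)"
  proof (rule op_of_form)
    show "b (x + x') y = b x y + b x' y" for x x' y
      using tendsto_add[OF b[of x y] b[of x' y]] b[of "x + x'" y]
      by (simp add: blinfun.add_right cinner.add_left LIMSEQ_unique)
    show "b x (y + y') = b x y + b x y'" for x y y'
      using tendsto_add[OF b[of x y] b[of x y']] b[of x "y + y'"]
      by (simp add: cinner.add_right LIMSEQ_unique)
    show "b (c *\<^sub>C x) y = c * b x y" for c x y
      using tendsto_mult[OF tendsto_const[of c] b[of x y]] b[of "c *\<^sub>C x" y]
      by (simp add: clinear_opD[OF G] cinner_scaleC_left LIMSEQ_unique)
    show "b x (c *\<^sub>C y) = cnj c * b x y" for c x y
      using tendsto_mult[OF tendsto_const[of "cnj c"] b[of x y]] b[of x "c *\<^sub>C y"]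
      by (simp add: cinner_scaleC_right LIMSEQ_unique)
    show "cmod (b x y) \<le> 2 * C * (norm x * norm y)" for x y
      by (rule LIMSEQ_le_const2[OF tendsto_norm[OF b]])
        (use form_bound_polarized[OF G bound] in blast)
  qed
  then obtain L where L: "clinear_op L" "\<And>x y. cinner (L x) y = b x y" by blast
  have "cinner (L x) x = q x" for x
    using LIMSEQ_unique[OF b[of x x] lim[of x]] by (simp add: L)
  then show ?thesis
    using L b by auto
qed

section \<open>Adjoints\<close>

lemma adj_eqI:
  fixes T S :: "'h::chilbert_space op"
  assumes "\<And>x y. cinner (T x) y = cinner x (S y)"
  shows "adj T = S"
  unfolding adj_def
proof (rule the_equality)
  fix S' :: "'h op" assume S': "\<forall>x y. cinner (T x) y = cinner x (S' y)"
  show "S' = S"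
    by (intro blinfun_eqI cinner_eqI) (metis S' assms cinner_commute)
qed (use assms in blast)

lemma adj_props:
  assumes T: "clinear_op T"
  shows "cinner (T x) y = cinner x (adj T y)" "clinear_op (adj T)"
proof -
  obtain C where C: "\<And>x. norm (T x) \<le> C * norm x"
    using norm_blinfun[of T] by blast
  have "\<exists>S. clinear_op S \<and> (\<forall>x y. cinner (S x) y = cinner x (T y))"
  proof (rule op_of_form)
    show "cmod (cinner x (T y)) \<le> C * (norm x * norm y)" for x y
      using order.trans[OF cmod_cinner_le mult_left_mono[OF C norm_ge_zero]]
      by (simp add: ac_simps)
  qed (simp_all add: cinner.add_left cinner.add_right blinfun.add_right cinner_scaleC_left
      cinner_scaleC_right clinear_opD[OF T])
  then obtain S where S: "clinear_op S" "\<And>x y. cinner (S x) y = cinner x (T y)" by blast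
  then have *: "cinner (T x) y = cinner x (S y)" for x y
    by (metis cinner_commute)
  with adj_eqI[of T S] S show "cinner (T x) y = cinner x (adj T y)" "clinear_op (adj T)"
    by auto
qed

section \<open>Bounded Borel functions\<close>

definition bounded_borel :: "('a::topological_space \<Rightarrow> complex) \<Rightarrow> bool" where
  "bounded_borel g \<longleftrightarrow> g \<in> borel_measurable borel \<and> (\<exists>C. \<forall>t. cmod (g t) \<le> C)"

lemma bounded_borel_measurable: "bounded_borel g \<Longrightarrow> g \<in> borel_measurable borel"
  by (simp add: bounded_borel_def)

lemma bounded_borelI: "g \<in> borel_measurable borel \<Longrightarrow> (\<And>t. cmod (g t) \<le> C) \<Longrightarrow> bounded_borel g"
  by (auto simp: bounded_borel_def)

lemma bounded_borel_indicator: "D \<in> sets borel \<Longrightarrow> bounded_borel (indicator D)"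
  by (rule bounded_borelI[of _ 1]) (auto simp: indicator_def)

lemma bounded_borel_const [simp]: "bounded_borel (\<lambda>_. c)"
  by (rule bounded_borelI[of _ "cmod c"]) auto

lemma bounded_borel_add:
  assumes "bounded_borel f" "bounded_borel g"
  shows "bounded_borel (\<lambda>t. f t + g t)"
proof -
  obtain C D where "\<And>t. cmod (f t) \<le> C" "\<And>t. cmod (g t) \<le> D"
    using assms by (auto simp: bounded_borel_def)
  then show ?thesis
    using assms by (intro bounded_borelI[of _ "C + D"] norm_triangle_mono)
      (auto simp: bounded_borel_def)
qed

lemma bounded_borel_mult:
  assumes "bounded_borel f" "bounded_borel g"
  shows "bounded_borel (\<lambda>t. f t * g t)"
proof -
  obtain C D where C: "\<And>t. cmod (f t) \<le> C" and D: "\<And>t. cmod (g t) \<le> D"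
    using assms by (auto simp: bounded_borel_def)
  have "cmod (f t * g t) \<le> C * D" for t
    using C[of t] D[of t] by (auto simp: norm_mult intro!: mult_mono order.trans[OF _ C[of t]])
  then show ?thesis
    using assms by (intro bounded_borelI[of _ "C * D"]) (auto simp: bounded_borel_def)
qed

lemma bounded_borel_lin:
  "bounded_borel f \<Longrightarrow> bounded_borel g \<Longrightarrow> bounded_borel (\<lambda>t. a * f t + b * g t)"
  by (intro bounded_borel_add bounded_borel_mult bounded_borel_const)

lemma bounded_borel_compose:
  assumes "bounded_borel g" and [measurable]: "\<tau> \<in> borel_measurable borel"
  shows "bounded_borel (\<lambda>z. g (\<tau> z))"
proof -
  have [measurable]: "g \<in> borel_measurable borel"
    using assms by (simp add: bounded_borel_def)
  show ?thesis
    using assms(1) by (auto simp: bounded_borel_def)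
qed

lemma bounded_borel_lim:
  assumes "\<And>n. bounded_borel (F n)" "\<And>n t. cmod (F n t) \<le> C" "\<And>t. (\<lambda>n. F n t) \<longlonglongrightarrow> g t"
  shows "bounded_borel g" "cmod (g t) \<le> C"
proof -
  show *: "cmod (g t) \<le> C" for t
    using LIMSEQ_le_const2[OF tendsto_norm[OF assms(3)]] assms(2) by blast
  have "g \<in> borel_measurable borel"
    by (rule borel_measurable_LIMSEQ_metric[OF _ assms(3)]) (use assms(1) in \<open>auto simp: bounded_borel_def\<close>)
  then show "bounded_borel g"
    using * by (rule bounded_borelI)
qed

text \<open>The functional version of a monotone class: closed under linear combinations and bounded
  pointwise limits. Facts about all bounded Borel functions are obtained by showing that the
  functions having the property form such a class and that it contains the indicators, or the
  monomials on [0, 1].\<close>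

definition bounded_closed :: "('a::topological_space \<Rightarrow> complex) set \<Rightarrow> bool" where
  "bounded_closed \<G> \<longleftrightarrow> \<G> \<subseteq> Collect bounded_borel \<and> (\<lambda>_. 0) \<in> \<G> \<and>
    (\<forall>f\<in>\<G>. \<forall>g\<in>\<G>. \<forall>a b. (\<lambda>t. a * f t + b * g t) \<in> \<G>) \<and>
    (\<forall>F C g. (\<forall>n. F n \<in> \<G>) \<longrightarrow> (\<forall>n t. cmod (F n t) \<le> C) \<longrightarrow> (\<forall>t. (\<lambda>n::nat. F n t) \<longlonglongrightarrow> g t) \<longrightarrow> g \<in> \<G>)"

lemma bounded_closedD:
  assumes "bounded_closed \<G>"
  shows "f \<in> \<G> \<Longrightarrow> bounded_borel f" "(\<lambda>_. 0) \<in> \<G>"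
    "f \<in> \<G> \<Longrightarrow> g \<in> \<G> \<Longrightarrow> (\<lambda>t. a * f t + b * g t) \<in> \<G>"
    "(\<And>n. F n \<in> \<G>) \<Longrightarrow> (\<And>n t. cmod (F n t) \<le> C) \<Longrightarrow> (\<And>t. (\<lambda>n::nat. F n t) \<longlonglongrightarrow> g t) \<Longrightarrow> g \<in> \<G>"
  using assms unfolding bounded_closed_def by blast+

lemma bounded_closed_add:
  assumes "bounded_closed \<G>" "f \<in> \<G>" "g \<in> \<G>"
  shows "(\<lambda>t. f t + g t) \<in> \<G>" "(\<lambda>t. f t - g t) \<in> \<G>"
  using bounded_closedD(3)[OF assms, of 1 1] bounded_closedD(3)[OF assms, of 1 "-1"] by auto

lemma bounded_closed_sum:
  assumes \<G>: "bounded_closed \<G>" and "finite I" "\<And>i. i \<in> I \<Longrightarrow> f i \<in> \<G>"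
  shows "(\<lambda>t. \<Sum>i\<in>I. c i * f i t) \<in> \<G>"
  using assms(2,3)
proof (induction I rule: finite_induct)
  case empty
  then show ?case using bounded_closedD(2)[OF \<G>] by simp
next
  case (insert i I)
  then have "(\<lambda>t. c i * f i t + 1 * (\<Sum>i\<in>I. c i * f i t)) \<in> \<G>"
    by (intro bounded_closedD(3)[OF \<G>]) auto
  then show ?case using insert by simp
qed

text \<open>Simple functions converge to \<open>g\<close> and stay below \<open>2 * C\<close>, so
  closure under bounded limits applies; each of them is a finite combination of indicators of its
  level sets.\<close>

lemma bounded_closed_from_indicators:
  assumes \<G>: "bounded_closed \<G>" and ind: "\<And>D. D \<in> sets borel \<Longrightarrow> indicator D \<in> \<G>"
    and g: "bounded_borel g"
  shows "g \<in> \<G>"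
proof -
  obtain C where C: "\<And>t. cmod (g t) \<le> C"
    using g by (auto simp: bounded_borel_def)
  obtain F where F: "\<And>i. simple_function borel (F i)" "\<And>t. (\<lambda>i. F i t) \<longlonglongrightarrow> g t"
    "\<And>i t. dist (F i t) 0 \<le> 2 * dist (g t) 0"
    using borel_measurable_implies_sequence_metric[OF bounded_borel_measurable[OF g], of 0] by auto
  show ?thesis
  proof (rule bounded_closedD(4)[OF \<G> _ _ F(2)])
    show "cmod (F n t) \<le> 2 * C" for n t
      using F(3)[of n t] C[of t] by simp
    fix n
    have fin: "finite (range (F n))" and "\<And>y. F n -` {y} \<in> sets borel"
      using F(1)[of n] simple_functionD(2)[OF F(1), of n] by (auto simp: simple_function_def)
    then have "(\<lambda>t. \<Sum>y\<in>range (F n). y * indicator (F n -` {y}) t) \<in> \<G>"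
      by (intro bounded_closed_sum[OF \<G>] ind)
    also have "(\<lambda>t. \<Sum>y\<in>range (F n). y * indicator (F n -` {y}) t) = F n"
    proof
      fix t
      have "(\<Sum>y\<in>range (F n). y * indicator (F n -` {y}) t) = (\<Sum>y\<in>range (F n). if y = F n t then y else 0)"
        by (intro sum.cong) (auto simp: indicator_def)
      then show "(\<Sum>y\<in>range (F n). y * indicator (F n -` {y}) t) = F n t"
        using fin by simp
    qed
    finally show "F n \<in> \<G>" .
  qed
qed

text \<open>Weierstrass leads from monomials to continuous functions, ramps lead to the indicators
  of half-lines, Dynkin's theorem to all Borel sets, and simple functions to \<open>g\<close>. The
  factor \<open>indicator {0..1}\<close> keeps the monomials bounded on the whole line.\<close>

lemma bounded_closed_from_monomials:
  fixes \<G> :: "(real \<Rightarrow> complex) set"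
  assumes \<G>: "bounded_closed \<G>"
    and mono: "\<And>n. (\<lambda>t. complex_of_real (indicator {0..1} t * t ^ n)) \<in> \<G>"
    and g: "bounded_borel g"
  shows "(\<lambda>t. indicator {0..1} t * g t) \<in> \<G>"
proof -
  have cont: "(\<lambda>t. complex_of_real (indicator {0..1} t * h t)) \<in> \<G>"
    if h: "continuous_on {0..1} h" for h :: "real \<Rightarrow> real"
  proof -
    have "\<exists>p. real_polynomial_function p \<and> (\<forall>t\<in>{0..1}. \<bar>h t - p t\<bar> < 1 / Suc n)" for n
      by (rule Stone_Weierstrass_real_polynomial_function[OF compact_Icc h, of "1 / Suc n"])
        (simp, blast)
    then obtain p where p: "\<And>n. real_polynomial_function (p n)"
      "\<And>n t. t \<in> {0..1} \<Longrightarrow> \<bar>h t - p n t\<bar> < 1 / Suc n"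
      by metis
    obtain B where "\<forall>y\<in>h ` {0..1}. norm y \<le> B"
      using compact_imp_bounded[OF compact_continuous_image[OF h compact_Icc]]
      unfolding bounded_iff by blast
    then have B: "\<bar>h t\<bar> \<le> B" if "t \<in> {0..1}" for t
      using that by auto
    have B0: "0 \<le> B"
      using B[of 0] by simp
    show ?thesis
    proof (rule bounded_closedD(4)[OF \<G>])
      fix n
      obtain a N where "p n = (\<lambda>t. \<Sum>i\<le>N. a i * t ^ i)"
        using p(1)[of n] real_polynomial_function_iff_sum by blast
      then have "complex_of_real (indicator {0..1} t * p n t)
          = (\<Sum>i\<le>N. of_real (a i) * complex_of_real (indicator {0..1} t * t ^ i))" for t
        by (cases "t \<in> {0..1}") simp_all
      then show "(\<lambda>t. complex_of_real (indicator {0..1} t * p n t)) \<in> \<G>"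
        using bounded_closed_sum[OF \<G> finite_atMost mono] by simp
      show "cmod (complex_of_real (indicator {0..1} t * p n t)) \<le> B + 1" for t
      proof (cases "t \<in> {0..1}")
        case True
        have "1 / real (Suc n) \<le> 1" by simp
        then have "\<bar>p n t\<bar> \<le> B + 1"
          using p(2)[OF True, of n] B[OF True] by linarith
        then show ?thesis using True by simp
      qed (use B0 in simp)
    next
      fix t
      have "(\<lambda>n. indicator {0..1} t * p n t) \<longlonglongrightarrow> indicator {0..1} t * h t"
      proof (cases "t \<in> {0..1}")
        case True
        have "(\<lambda>n. p n t) \<longlonglongrightarrow> h t"
          by (rule Lim_transform_bound[OF _ LIMSEQ_inverse_real_of_nat, THEN LIM_zero_cancel])
            (use p(2)[OF True] in \<open>auto simp: abs_minus_commute inverse_eq_divide less_imp_le intro!: always_eventually\<close>)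
        then show ?thesis using True by simp
      qed simp
      then show "(\<lambda>n. complex_of_real (indicator {0..1} t * p n t)) \<longlonglongrightarrow> complex_of_real (indicator {0..1} t * h t)"
        by (rule tendsto_of_real)
    qed
  qed
  have atMost: "(\<lambda>t. indicator ({..a} \<inter> {0..1}) t) \<in> \<G>" for a :: real
  proof (rule bounded_closedD(4)[OF \<G>])
    \<comment> \<open>A ramp that is 1 up to \<open>a\<close> and falls to 0 with slope
      \<open>-n\<close>; it tends pointwise to the indicator of \<open>{..a}\<close>.\<close>
    define h where "h n t = max 0 (min 1 (1 - real n * (t - a)))" for n :: nat and t
    show "(\<lambda>t. complex_of_real (indicator {0..1} t * h n t)) \<in> \<G>" for n
      unfolding h_def by (intro cont continuous_intros)
    show "cmod (complex_of_real (indicator {0..1} t * h n t)) \<le> 1" for n t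
      by (auto simp: h_def indicator_def)
    fix t
    have "(\<lambda>n. h n t) \<longlonglongrightarrow> indicator {..a} t"
    proof (cases "t \<le> a")
      case True
      then have "real n * (t - a) \<le> 0" for n
        by (simp add: mult_nonneg_nonpos)
      then have "h n t = 1" for n
        unfolding h_def by (smt (verit))
      then show ?thesis using True by simp
    next
      case False
      obtain N :: nat where N: "1 / (t - a) < N"
        using reals_Archimedean2 by blast
      have "h n t = 0" if "n \<ge> N" for n
      proof -
        have "1 / (t - a) < n" using N that by (meson of_nat_le_iff order_less_le_trans)
        then have "1 < n * (t - a)" using False by (simp add: field_simps)
        then show ?thesis by (simp add: h_def)
      qed
      then show ?thesis
        using False by (intro tendsto_eventually) (auto simp: eventually_sequentially)
    qed
    then have "(\<lambda>n. indicator {0..1} t * h n t) \<longlonglongrightarrow> indicator {0..1} t * indicator {..a} t"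
      by (rule tendsto_mult_left)
    then have "(\<lambda>n. complex_of_real (indicator {0..1} t * h n t)) \<longlonglongrightarrow> of_real (indicator {0..1} t * indicator {..a} t)"
      by (rule tendsto_of_real)
    also have "complex_of_real (indicator {0..1} t * indicator {..a} t) = indicator ({..a} \<inter> {0..1}) t"
      by (auto simp: indicator_def)
    finally show "(\<lambda>n. complex_of_real (indicator {0..1} t * h n t)) \<longlonglongrightarrow> indicator ({..a} \<inter> {0..1}) t" .
  qed
  have unit: "indicator {0..1} \<in> \<G>"
  proof -
    have "(\<lambda>t. complex_of_real (indicator {0..1} t * t ^ 0)) = indicator {0..1}"
      by (auto simp: indicator_def)
    then show ?thesis
      using mono[of 0] by simp
  qed
  have sets: "indicator (D \<inter> {0..1}) \<in> \<G>" if "D \<in> sets borel" for D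
  proof -
    \<comment> \<open>Half-lines form a generator stable under intersection, so it is enough to
      treat complements and disjoint unions.\<close>
    have "Int_stable (range (atMost :: real \<Rightarrow> _))"
      by (auto simp: Int_stable_def)
    moreover have "range (atMost :: real \<Rightarrow> _) \<subseteq> Pow UNIV"
      by simp
    moreover have "D \<in> sigma_sets UNIV (range (atMost :: real \<Rightarrow> _))"
      using that by (simp add: borel_eq_atMost)
    ultimately show ?thesis
    proof (induction rule: sigma_sets_induct_disjoint)
      case (basic A)
      then show ?case using atMost by auto
    next
      case empty
      then show ?case using bounded_closedD(2)[OF \<G>] by (simp add: indicator_def[abs_def])
    next
      case (compl A)
      have "(indicator ((UNIV - A) \<inter> {0..1}) :: real \<Rightarrow> complex)
          = (\<lambda>t. indicator {0..1} t - indicator (A \<inter> {0..1}) t)"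
        by (auto simp: indicator_def)
      then show ?case
        using bounded_closed_add(2)[OF \<G> unit compl(2)] by simp
    next
      case (union A)
      have fin: "indicator ((\<Union>i<n. A i) \<inter> {0..1}) \<in> \<G>" for n
      proof (induction n)
        case 0
        then show ?case using bounded_closedD(2)[OF \<G>] by (simp add: indicator_def[abs_def])
      next
        case (Suc n)
        have "A n \<inter> (\<Union>i<n. A i) = {}"
          using disjoint_family_onD[OF union(1), of n] by fastforce
        then have "(indicator ((\<Union>i<Suc n. A i) \<inter> {0..1}) :: real \<Rightarrow> complex)
            = (\<lambda>t. indicator ((\<Union>i<n. A i) \<inter> {0..1}) t + indicator (A n \<inter> {0..1}) t)"
          by (intro ext) (auto simp: indicator_def lessThan_Suc)
        then show ?case
          using bounded_closed_add(1)[OF \<G> Suc union(3)[of n]] by simp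
      qed
      show ?case
      proof (rule bounded_closedD(4)[OF \<G> fin])
        show "cmod (indicator ((\<Union>i<n. A i) \<inter> {0..1}) t) \<le> 1" for n t
          by (auto simp: indicator_def)
        show "(\<lambda>n. indicator ((\<Union>i<n. A i) \<inter> {0..1}) t :: complex) \<longlonglongrightarrow> indicator ((\<Union>i. A i) \<inter> {0..1}) t" for t
          using tendsto_mult_right[OF LIMSEQ_indicator_UN[of A t], of "indicator {0..1} t :: complex"]
          by (simp add: indicator_inter_arith)
      qed
    qed
  qed
  \<comment> \<open>The functions whose cut-off lies in \<open>\<G>\<close> again form a bounded
    closed class, now one that contains all indicators.\<close>
  have "g \<in> {g. bounded_borel g \<and> (\<lambda>t. indicator {0..1} t * g t) \<in> \<G>}"
  proof (rule bounded_closed_from_indicators[OF _ _ g])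
    show "indicator D \<in> {g. bounded_borel g \<and> (\<lambda>t. indicator {0..1} t * g t) \<in> \<G>}"
      if "D \<in> sets borel" for D
      using sets[OF that] by (auto simp: bounded_borel_indicator that indicator_inter_arith[abs_def] mult.commute)
    show "bounded_closed {g. bounded_borel g \<and> (\<lambda>t. indicator {0..1} t * g t) \<in> \<G>}"
      unfolding bounded_closed_def
    proof (intro conjI subsetI ballI allI impI; clarsimp)
      show "(\<lambda>t. 0) \<in> \<G>" by (rule bounded_closedD(2)[OF \<G>])
    next
      fix f g :: "real \<Rightarrow> complex" and a b
      assume "bounded_borel f" "(\<lambda>t. indicator {0..1} t * f t) \<in> \<G>"
        "bounded_borel g" "(\<lambda>t. indicator {0..1} t * g t) \<in> \<G>"
      then show "bounded_borel (\<lambda>t. a * f t + b * g t) \<and> (\<lambda>t. indicator {0..1} t * (a * f t + b * g t)) \<in> \<G>"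
        using bounded_closedD(3)[OF \<G>, of "\<lambda>t. indicator {0..1} t * f t" "\<lambda>t. indicator {0..1} t * g t" a b]
        by (auto intro: bounded_borel_lin simp: algebra_simps)
    next
      fix F C g
      assume *: "\<forall>n. bounded_borel (F n) \<and> (\<lambda>t. indicator {0..1} t * F n t) \<in> \<G>"
        "\<forall>n t. cmod (F n t) \<le> C" "\<forall>t. (\<lambda>n::nat. F n t) \<longlonglongrightarrow> g t"
      have C: "0 \<le> C" using *(2) norm_ge_zero order.trans by blast
      show "bounded_borel g \<and> (\<lambda>t. indicator {0..1} t * g t) \<in> \<G>"
      proof
        show "bounded_borel g"
          by (rule bounded_borel_lim(1)[of F C]) (use * in auto)
        show "(\<lambda>t. indicator {0..1} t * g t) \<in> \<G>"
        proof (rule bounded_closedD(4)[OF \<G>])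
          show "(\<lambda>t. indicator {0..1} t * F n t) \<in> \<G>" for n
            using * by blast
          show "cmod (indicator {0..1} t * F n t) \<le> C" for n t
            using *(2) C by (auto simp: indicator_def)
          show "(\<lambda>n. indicator {0..1} t * F n t) \<longlonglongrightarrow> indicator {0..1} t * g t" for t
            using *(3) by (intro tendsto_mult_left) blast
        qed
      qed
    qed
  qed
  then show ?thesis by simp
qed

section \<open>Integrals of bounded Borel functions and their determination by moments\<close>

lemma integrable_bounded_borel:
  assumes "finite_measure m" and sets: "sets m = sets borel" and "bounded_borel g"
  shows "integrable m g"
proof -
  interpret finite_measure m by fact
  obtain C where "\<And>t. cmod (g t) \<le> C"
    using assms(3) by (auto simp: bounded_borel_def)
  then show ?thesis
    using bounded_borel_measurable[OF assms(3)]
    by (intro integrable_const_bound[of _ C]) (auto simp: measurable_cong_sets[OF sets refl])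
qed

lemma LINT_bounded_lim:
  assumes m: "finite_measure m" and sets: "sets m = sets borel"
    and F: "\<And>n. bounded_borel (F n)" "\<And>n t. cmod (F n t) \<le> C" "\<And>t. (\<lambda>n. F n t) \<longlonglongrightarrow> g t"
  shows "(\<lambda>n. LINT t|m. F n t) \<longlonglongrightarrow> (LINT t|m. g t)"
proof -
  interpret finite_measure m by fact
  show ?thesis
  proof (rule integral_dominated_convergence[where w = "\<lambda>_. C"])
    show "g \<in> borel_measurable m" "F n \<in> borel_measurable m" for n
      using bounded_borel_measurable[OF bounded_borel_lim(1)[OF F]] bounded_borel_measurable[OF F(1)]
      by (auto simp: measurable_cong_sets[OF sets refl])
  qed (use F in auto)
qed

lemma LINT_bounded_lin:
  assumes "finite_measure m" "sets m = sets borel" "bounded_borel f" "bounded_borel g"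
  shows "(LINT t|m. a * f t + b * g t) = a * (LINT t|m. f t) + b * (LINT t|m. g t)"
  using integrable_bounded_borel[OF assms(1,2,3)] integrable_bounded_borel[OF assms(1,2,4)] by simp

text \<open>These are the test functions that do not separate the image of \<open>w1 m1\<close>
  under \<open>\<tau>1\<close> from the image of \<open>w2 m2\<close> under \<open>\<tau>2\<close>;
  dominated convergence closes the class. Allowing weights and maps lets one lemma serve for
  uniqueness, for transfer to an image measure and for substitutions.\<close>

lemma bounded_closed_LINT_eq:
  fixes m1 :: "'a::topological_space measure" and m2 :: "'b::topological_space measure"
    and \<tau>1 :: "'a \<Rightarrow> 'c::topological_space"
  assumes m1: "finite_measure m1" "sets m1 = sets borel" and m2: "finite_measure m2" "sets m2 = sets borel"
    and w: "bounded_borel w1" "bounded_borel w2"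
    and \<tau>: "\<tau>1 \<in> borel_measurable borel" "\<tau>2 \<in> borel_measurable borel"
  shows "bounded_closed {g. bounded_borel g \<and> (LINT z|m1. w1 z * g (\<tau>1 z)) = (LINT z|m2. w2 z * g (\<tau>2 z))}"
    (is "bounded_closed ?G")
proof -
  have bb: "bounded_borel (\<lambda>z. w1 z * f (\<tau>1 z))" "bounded_borel (\<lambda>z. w2 z * f (\<tau>2 z))"
    if "bounded_borel f" for f
    using w \<tau> that by (auto intro!: bounded_borel_mult bounded_borel_compose[of f])
  show ?thesis
    unfolding bounded_closed_def
  proof (intro conjI subsetI ballI allI impI)
    fix f g a b assume "f \<in> ?G" "g \<in> ?G"
    then have f: "bounded_borel f" "(LINT z|m1. w1 z * f (\<tau>1 z)) = (LINT z|m2. w2 z * f (\<tau>2 z))"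
      and g: "bounded_borel g" "(LINT z|m1. w1 z * g (\<tau>1 z)) = (LINT z|m2. w2 z * g (\<tau>2 z))"
      by auto
    have "w * (a * x + b * y) = a * (w * x) + b * (w * y)" for w x y :: complex
      by (simp add: algebra_simps)
    then show "(\<lambda>t. a * f t + b * g t) \<in> ?G"
      unfolding mem_Collect_eq
      by (simp only: LINT_bounded_lin[OF m1 bb(1)[OF f(1)] bb(1)[OF g(1)]]
          LINT_bounded_lin[OF m2 bb(2)[OF f(1)] bb(2)[OF g(1)]] f g bounded_borel_lin)
  next
    fix F C g assume "\<forall>n. F n \<in> ?G" and C: "\<forall>n t. cmod (F n t) \<le> C" and lim: "\<forall>t. (\<lambda>n::nat. F n t) \<longlonglongrightarrow> g t"
    then have F: "bounded_borel (F n)" "(LINT z|m1. w1 z * F n (\<tau>1 z)) = (LINT z|m2. w2 z * F n (\<tau>2 z))" for n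
      by auto
    obtain D E where D: "\<And>z. cmod (w1 z) \<le> D" and E: "\<And>z. cmod (w2 z) \<le> E"
      using w by (auto simp: bounded_borel_def)
    have [simp]: "0 \<le> D" "0 \<le> E" using D E norm_ge_zero order.trans by blast+
    have "(\<lambda>n. LINT z|m1. w1 z * F n (\<tau>1 z)) \<longlonglongrightarrow> (LINT z|m1. w1 z * g (\<tau>1 z))"
      using C lim D by (intro LINT_bounded_lim[OF m1 bb(1)[OF F(1)], where C = "D * C"])
        (auto simp: norm_mult intro!: mult_mono tendsto_mult_left)
    moreover have "(\<lambda>n. LINT z|m2. w2 z * F n (\<tau>2 z)) \<longlonglongrightarrow> (LINT z|m2. w2 z * g (\<tau>2 z))"
      using C lim E by (intro LINT_bounded_lim[OF m2 bb(2)[OF F(1)], where C = "E * C"])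
        (auto simp: norm_mult intro!: mult_mono tendsto_mult_left)
    ultimately show "g \<in> ?G"
      using LIMSEQ_unique bounded_borel_lim(1)[of F C g] F C lim by simp
  qed auto
qed

text \<open>Determinacy of the moment problem on [0, 1] for two weighted image measures. As the
  weights vanish wherever the maps leave [0, 1], only the values of \<open>g\<close> on [0, 1]
  matter.\<close>

lemma LINT_eq_if_moments_eq:
  fixes m1 :: "'a::topological_space measure" and m2 :: "'b::topological_space measure"
  assumes m1: "finite_measure m1" "sets m1 = sets borel" and m2: "finite_measure m2" "sets m2 = sets borel"
    and w: "bounded_borel w1" "bounded_borel w2"
    and \<tau>: "\<tau>1 \<in> borel_measurable borel" "\<tau>2 \<in> borel_measurable borel"
    and range: "\<And>z. w1 z \<noteq> 0 \<Longrightarrow> \<tau>1 z \<in> {0..1}" "\<And>z. w2 z \<noteq> 0 \<Longrightarrow> \<tau>2 z \<in> {0..1}"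
    and moments: "\<And>n. (LINT z|m1. w1 z * of_real (\<tau>1 z ^ n)) = (LINT z|m2. w2 z * of_real (\<tau>2 z ^ n))"
    and g: "bounded_borel (\<lambda>t. indicator {0..1} t * g t)"
  shows "(LINT z|m1. w1 z * g (\<tau>1 z)) = (LINT z|m2. w2 z * g (\<tau>2 z))"
proof -
  define \<G> where "\<G> = {g. bounded_borel g \<and> (LINT z|m1. w1 z * g (\<tau>1 z)) = (LINT z|m2. w2 z * g (\<tau>2 z))}"
  have w1: "w1 z * (indicator {0..1} (\<tau>1 z) * c) = w1 z * c" and
    w2: "w2 z' * (indicator {0..1} (\<tau>2 z') * c) = w2 z' * c" for z z' c
    using range(1)[of z] range(2)[of z'] by (cases "w1 z = 0"; cases "w2 z' = 0"; force)+
  have "bounded_closed \<G>"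
    unfolding \<G>_def by (rule bounded_closed_LINT_eq[OF m1 m2 w \<tau>])
  moreover have "(\<lambda>t. complex_of_real (indicator {0..1} t * t ^ n)) \<in> \<G>" for n
  proof -
    have "bounded_borel (\<lambda>t. complex_of_real (indicator {0..1} t * t ^ n))"
      by (rule bounded_borelI[of _ 1]) (auto simp: indicator_def norm_power power_le_one)
    moreover have "complex_of_real (indicator {0..1} t * t ^ n) = indicator {0..1} t * of_real (t ^ n)" for t
      by (simp add: indicator_def)
    ultimately show ?thesis
      unfolding \<G>_def mem_Collect_eq by (simp only: w1 w2 moments)
  qed
  \<comment> \<open>One cut-off comes from the class, the other makes \<open>g\<close> bounded on
    the whole line; the weights absorb both.\<close>
  ultimately have "(\<lambda>t. indicator {0..1} t * (indicator {0..1} t * g t)) \<in> \<G>"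
    by (rule bounded_closed_from_monomials[OF _ _ g])
  then show ?thesis
    unfolding \<G>_def mem_Collect_eq by (simp only: w1 w2)
qed

section \<open>The Hausdorff moment problem\<close>

text \<open>The recurrence applied \<open>n\<close> times. For
  \<open>u k j = t^k * (1 - t)^j\<close> this is the binomial expansion of
  \<open>(t + (1 - t))^n\<close>.\<close>

lemma pascal_expansion:
  fixes u :: "nat \<Rightarrow> nat \<Rightarrow> real"
  assumes u: "\<And>k j. u k j = u (Suc k) j + u k (Suc j)"
  shows "u m i = (\<Sum>j\<le>n. real (n choose j) * u (m + j) (i + (n - j)))"
proof (induction n arbitrary: m i)
  case (Suc n)
  define v where "v j = u (m + j) (i + (Suc n - j))" for j
  have "u m i = u (Suc m) i + u m (Suc i)" by (rule u)
  also have "u (Suc m) i = (\<Sum>j\<le>n. real (n choose j) * v (Suc j))"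
    by (subst Suc) (simp add: v_def)
  also have "u m (Suc i) = (\<Sum>j\<le>n. real (n choose j) * v j)"
    by (subst Suc) (auto simp: v_def Suc_diff_le intro!: sum.cong)
  also have "\<dots> = (\<Sum>j\<le>Suc n. real (n choose j) * v j)"
    by (simp add: binomial_eq_0)
  also have "\<dots> = v 0 + (\<Sum>j\<le>n. real (n choose Suc j) * v (Suc j))"
    by (subst sum.atMost_Suc_shift) simp
  finally have "u m i = v 0 + (\<Sum>j\<le>n. real (Suc n choose Suc j) * v (Suc j))"
    by (simp add: algebra_simps flip: sum.distrib)
  also have "\<dots> = (\<Sum>j\<le>Suc n. real (Suc n choose j) * v j)"
    by (simp only: sum.atMost_Suc_shift) simp
  finally show ?case by (simp add: v_def)
qed simp

lemma binomial_ratio_prod: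
  assumes "m \<le> N"
  shows "real (k choose m) / real (N choose m) = (\<Prod>i<m. (real k - real i) / (real N - real i))"
  by (simp add: binomial_gbinomial gbinomial_prod_rev atLeast0LessThan prod_dividef)

text \<open>Both sides are products of \<open>m\<close> factors of modulus at most 1, so their
  difference is at most the sum of the differences of the factors. As \<open>i\<close> is at most
  \<open>N / 2\<close>, each of these is at most \<open>2 * m / N\<close>.\<close>

lemma binomial_ratio_approx:
  assumes "k \<le> N" "2 * m \<le> N" "0 < N"
  shows "\<bar>(real k / real N) ^ m - real (k choose m) / real (N choose m)\<bar> \<le> 2 * (real m)\<^sup>2 / real N"
proof -
  have i: "2 * real i \<le> real N" if "i < m" for i
    using assms that by (metis (no_types, opaque_lifting) less_imp_le mult_le_mono2 of_nat_le_iff of_nat_mult of_nat_numeral order.trans)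
  have "\<bar>(\<Prod>i<m. real k / real N) - (\<Prod>i<m. (real k - real i) / (real N - real i))\<bar>
      \<le> (\<Sum>i<m. \<bar>real k / real N - (real k - real i) / (real N - real i)\<bar>)"
  proof (rule norm_prod_diff[of _ "\<lambda>_. real k / real N", simplified real_norm_def])
    fix i assume "i \<in> {..<m}"
    then have "2 * real i \<le> real N" using i by simp
    then show "\<bar>(real k - real i) / (real N - real i)\<bar> \<le> 1"
      using assms by (auto simp: abs_le_iff divide_le_eq le_divide_eq)
  qed (use assms in simp)
  also have "\<dots> \<le> (\<Sum>i<m. 2 * real m / real N)"
  proof (rule sum_mono)
    fix i assume "i \<in> {..<m}"
    then have im: "i < m" and iN: "2 * real i \<le> real N" using i by simp_all
    have N: "0 < real N" "0 < real N - real i" using assms iN by simp_all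
    have "real k / real N - (real k - real i) / (real N - real i)
        = real i * (real N - real k) / (real N * (real N - real i))"
      using N by (simp add: field_simps)
    moreover have "0 \<le> real i * (real N - real k) / (real N * (real N - real i))"
      using N assms by simp
    moreover have "real i * (real N - real k) / (real N * (real N - real i)) \<le> 2 * real m / real N"
    proof -
      have "real i * (real N - real k) \<le> real m * real N"
        using im assms by (intro mult_mono) auto
      also have "\<dots> \<le> real m * (2 * (real N - real i))"
        using iN by (intro mult_left_mono) auto
      finally have "real i * (real N - real k) / (real N * (real N - real i))
          \<le> real m * (2 * (real N - real i)) / (real N * (real N - real i))"
        using N by (intro divide_right_mono) auto
      also have "\<dots> = 2 * real m / real N"
      proof -
        have "a * (2 * d) / (b * d) = 2 * a / b" if "d \<noteq> 0" for a b d :: real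
          using that by (cases "b = 0") (simp_all add: field_simps)
        then show ?thesis
          using N(2) by (metis less_irrefl)
      qed
      finally show ?thesis .
    qed
    ultimately show "\<bar>real k / real N - (real k - real i) / (real N - real i)\<bar> \<le> 2 * real m / real N"
      by (simp only: abs_of_nonneg)
  qed
  also have "\<dots> = 2 * (real m)\<^sup>2 / real N"
    by (simp add: power2_eq_square)
  finally show ?thesis
    using assms by (simp add: binomial_ratio_prod)
qed

text \<open>The approximating measures put the mass \<open>(N choose k) * u k (N - k)\<close> on \<open>k / N\<close>;
  Pascal's rule makes their moments converge, and Helly's theorem provides the limit measure.\<close>

theorem Hausdorff_moment:
  fixes u :: "nat \<Rightarrow> nat \<Rightarrow> real"
  assumes nonneg: "\<And>k j. 0 \<le> u k j"
    and u: "\<And>k j. u k j = u (Suc k) j + u k (Suc j)" and one: "u 0 0 = 1"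
  shows "\<exists>M. real_distribution M \<and> (\<forall>m. (\<integral>t. indicator {0..1} t * t ^ m \<partial>M) = u m 0)"
proof -
  define w where "w N k = (if k \<le> N then real (N choose k) * u k (N - k) else 0)" for N k
  have w_nonneg: "0 \<le> w N k" for N k
    by (simp add: w_def nonneg)
  have w_sum: "(\<Sum>k\<le>N. w N k) = 1" for N
    using pascal_expansion[of u 0 0 N, OF u] one by (simp add: w_def)
  \<comment> \<open>Expanding \<open>u m 0\<close> over \<open>N - m\<close> steps and reindexing by
    \<open>k = m + j\<close> shows that the factorial moments of the approximating measures are
    exact for every \<open>N\<close>; only the passage to ordinary moments needs a limit.\<close>
  have w_moment: "(\<Sum>k\<le>N. real (k choose m) / real (N choose m) * w N k) = u m 0" if m: "m \<le> N" for m N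
  proof -
    have "u m 0 = (\<Sum>j\<le>N-m. real ((N - m) choose j) * u (m + j) (N - m - j))"
      using pascal_expansion[of u m 0 "N - m", OF u] by simp
    also have "\<dots> = (\<Sum>k\<in>{m..N}. real ((N - m) choose (k - m)) * u k (N - k))"
      by (rule sum.reindex_bij_witness[of _ "\<lambda>k. k - m" "\<lambda>j. m + j"]) (use m in auto)
    also have "\<dots> = (\<Sum>k\<in>{m..N}. real (k choose m) / real (N choose m) * w N k)"
    proof (rule sum.cong[OF refl])
      fix k assume k: "k \<in> {m..N}"
      then have "real (N choose k) * real (k choose m) = real (N choose m) * real ((N - m) choose (k - m))"
        using choose_mult[of m k N] by (simp flip: of_nat_mult)
      moreover have "real (N choose m) \<noteq> 0" using m by simp
      ultimately have "real ((N - m) choose (k - m)) = real (N choose k) * real (k choose m) / real (N choose m)"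
        by (simp add: field_simps)
      then show "real ((N - m) choose (k - m)) * u k (N - k) = real (k choose m) / real (N choose m) * w N k"
        using k by (simp add: w_def)
    qed
    also have "\<dots> = (\<Sum>k\<le>N. real (k choose m) / real (N choose m) * w N k)"
      by (rule sum.mono_neutral_left) (auto simp: binomial_eq_0)
    finally show ?thesis by simp
  qed
  define p where "p N = embed_pmf (w N)" for N
  have pmf_p: "pmf (p N) k = w N k" for N k
    unfolding p_def
  proof (rule pmf_embed_pmf[OF w_nonneg])
    have "(\<integral>\<^sup>+k. ennreal (w N k) \<partial>count_space UNIV) = (\<Sum>k\<in>{..N}. ennreal (w N k))"
      by (rule nn_integral_count_space') (auto simp: w_def)
    also have "\<dots> = 1"
      by (simp add: sum_ennreal w_nonneg w_sum)
    finally show "(\<integral>\<^sup>+k. ennreal (w N k) \<partial>count_space UNIV) = 1" .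
  qed
  \<comment> \<open>\<open>min 1\<close> keeps the nodes in [0, 1] also for \<open>k > N\<close>,
    where there is no mass; for \<open>N = 0\<close> the quotient is 0.\<close>
  define node where "node N k = min 1 (real k / real N)" for N k
  define \<mu> where "\<mu> N = distr (measure_pmf (p N)) borel (node N)" for N
  have \<mu>: "real_distribution (\<mu> N)" for N
    unfolding \<mu>_def by (rule prob_space.real_distribution_distr[OF prob_space_measure_pmf]) simp
  have node01: "0 \<le> node N k" "node N k \<le> 1" for N k
    by (auto simp: node_def)
  have int_\<mu>: "(\<integral>t. h t \<partial>\<mu> N) = (\<Sum>k\<le>N. h (node N k) * w N k)"
    if [measurable]: "h \<in> borel_measurable borel" for h :: "real \<Rightarrow> real" and N
  proof -
    have "(\<integral>t. h t \<partial>\<mu> N) = (\<integral>k. h (node N k) \<partial>measure_pmf (p N))"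
      unfolding \<mu>_def by (rule integral_distr) auto
    also have "\<dots> = (\<Sum>k\<le>N. h (node N k) * pmf (p N) k)"
      by (rule integral_measure_pmf_real) (auto simp: set_pmf_eq pmf_p w_def split: if_splits)
    finally show ?thesis by (simp add: pmf_p)
  qed
  have tight: "tight \<mu>"
    unfolding tight_def
  proof (intro conjI allI impI)
    fix \<epsilon> :: real assume "0 < \<epsilon>"
    \<comment> \<open>\<open>tight\<close> is stated with intervals open on the left, and 0 is a
      node, so the left end has to be negative.\<close>
    have "measure (\<mu> N) {-1<..1} = 1" for N
    proof -
      have "node N -` {-1<..1} = UNIV"
        using less_le_trans[OF _ node01(1)] node01(2) by auto
      then show ?thesis
        unfolding \<mu>_def by (subst measure_distr) auto
    qed
    then show "\<exists>a b. a < b \<and> (\<forall>N. 1 - \<epsilon> < measure (\<mu> N) {a<..b})"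
      using \<open>0 < \<epsilon>\<close> by (intro exI[of _ "-1"] exI[of _ 1]) auto
  qed (rule \<mu>)
  obtain r M where r: "strict_mono (r :: nat \<Rightarrow> nat)" and M: "real_distribution M"
    and conv: "weak_conv_m (\<mu> \<circ> r) M"
    using tight_imp_convergent_subsubsequence[OF tight strict_mono_id] by auto
  interpret M: real_distribution M by fact
  have limit: "(\<lambda>n. \<integral>t. h t \<partial>\<mu> (r n)) \<longlonglongrightarrow> (\<integral>t. h t \<partial>M)"
    if "\<And>t. isCont h t" "\<And>t. \<bar>h t\<bar> \<le> 1" for h :: "real \<Rightarrow> real"
    using weak_conv_imp_integral_bdd_continuous_conv[OF _ M conv, of h 1] \<mu> that by simp
  \<comment> \<open>Weak convergence tests bounded continuous functions on the whole line; powers of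
    \<open>clip\<close> are such functions and agree with the monomials on [0, 1].\<close>
  define clip :: "real \<Rightarrow> real" where "clip t = max 0 (min 1 t)" for t
  have clip_cont: "isCont clip t" for t
    unfolding clip_def by (intro continuous_intros)
  have clip_meas [measurable]: "clip \<in> borel_measurable borel"
    unfolding clip_def by measurable
  have clip01: "0 \<le> clip t" "clip t \<le> 1" for t
    by (auto simp: clip_def)
  have clip_moment: "(\<integral>t. clip t ^ m \<partial>M) = u m 0" for m
  proof (rule LIMSEQ_unique)
    show "(\<lambda>n. \<integral>t. clip t ^ m \<partial>\<mu> (r n)) \<longlonglongrightarrow> (\<integral>t. clip t ^ m \<partial>M)"
      using clip01 by (intro limit continuous_intros clip_cont) (auto simp: power_le_one)
    have "(\<lambda>N. \<integral>t. clip t ^ m \<partial>\<mu> N) \<longlonglongrightarrow> u m 0"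
    proof (rule LIM_zero_cancel, rule Lim_null_comparison)
      show "(\<lambda>N. 2 * (real m)\<^sup>2 / real N) \<longlonglongrightarrow> 0"
        by (rule lim_const_over_n)
      have "norm ((\<integral>t. clip t ^ m \<partial>\<mu> N) - u m 0) \<le> 2 * (real m)\<^sup>2 / real N" if N: "2 * m + 1 \<le> N" for N
      proof -
        have "(\<integral>t. clip t ^ m \<partial>\<mu> N) = (\<Sum>k\<le>N. (real k / real N) ^ m * w N k)"
          using N by (subst int_\<mu>) (auto simp: node_def clip_def intro!: sum.cong)
        then have "(\<integral>t. clip t ^ m \<partial>\<mu> N) - u m 0
            = (\<Sum>k\<le>N. ((real k / real N) ^ m - real (k choose m) / real (N choose m)) * w N k)"
          using w_moment[of m N] N by (simp add: left_diff_distrib sum_subtractf)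
        also have "\<bar>\<dots>\<bar> \<le> (\<Sum>k\<le>N. 2 * (real m)\<^sup>2 / real N * w N k)"
          using N by (intro order.trans[OF sum_abs] sum_mono)
            (auto simp: abs_mult abs_of_nonneg[OF w_nonneg] simp del: times_divide_eq_left
              intro!: mult_right_mono binomial_ratio_approx w_nonneg)
        also have "\<dots> = 2 * (real m)\<^sup>2 / real N"
          by (simp only: w_sum mult_1_right flip: sum_distrib_left)
        finally show ?thesis by simp
      qed
      then show "\<forall>\<^sub>F N in sequentially. norm ((\<integral>t. clip t ^ m \<partial>\<mu> N) - u m 0) \<le> 2 * (real m)\<^sup>2 / real N"
        by (auto simp: eventually_sequentially)
    qed
    then show "(\<lambda>n. \<integral>t. clip t ^ m \<partial>\<mu> (r n)) \<longlonglongrightarrow> u m 0"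
      using LIMSEQ_subseq_LIMSEQ[OF _ r] by (simp add: comp_def)
  qed
  \<comment> \<open>A bounded continuous function that vanishes exactly on [0, 1]. Its integral is 0
    for every approximating measure, hence for \<open>M\<close>, so \<open>M\<close> is concentrated
    on [0, 1].\<close>
  define \<psi> where "\<psi> t = min 1 \<bar>t - clip t\<bar>" for t
  have \<psi>_meas [measurable]: "\<psi> \<in> borel_measurable borel"
    unfolding \<psi>_def by measurable
  have "(\<lambda>n. \<integral>t. \<psi> t \<partial>\<mu> (r n)) \<longlonglongrightarrow> (\<integral>t. \<psi> t \<partial>M)"
    unfolding \<psi>_def by (intro limit continuous_intros clip_cont) auto
  moreover have "(\<integral>t. \<psi> t \<partial>\<mu> N) = 0" for N
    using node01 by (subst int_\<mu>) (auto simp: \<psi>_def clip_def intro!: sum.neutral)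
  ultimately have "(\<integral>t. \<psi> t \<partial>M) = 0"
    using LIMSEQ_unique[OF tendsto_const] by fastforce
  moreover have "integrable M \<psi>"
    by (rule M.integrable_const_bound[of _ 1]) (auto simp: \<psi>_def)
  moreover have "AE t in M. 0 \<le> \<psi> t"
    by (simp add: \<psi>_def)
  ultimately have "AE t in M. \<psi> t = 0"
    using integral_nonneg_eq_0_iff_AE[of M \<psi>] by blast
  then have "AE t in M. indicator {0..1} t * t ^ m = clip t ^ m" for m
    by (rule AE_mp) (auto simp: \<psi>_def clip_def min_def max_def split: if_splits)
  then have "(\<integral>t. indicator {0..1} t * t ^ m \<partial>M) = u m 0" for m
    unfolding clip_moment[symmetric] by (intro integral_cong_AE) auto
  with M show ?thesis by blast
qed


text \<open>Division by \<open>u 0 0\<close> reduces to total mass 1. If \<open>u 0 0 = 0\<close>,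
  then every \<open>u k 0\<close> vanishes, since these numbers decrease in \<open>k\<close>, and
  the null measure serves.\<close>

corollary Hausdorff_moment_finite_measure:
  fixes u :: "nat \<Rightarrow> nat \<Rightarrow> real"
  assumes nonneg: "\<And>k j. 0 \<le> u k j" and u: "\<And>k j. u k j = u (Suc k) j + u k (Suc j)"
  shows "\<exists>M. finite_measure M \<and> sets M = sets borel \<and> measure M UNIV = u 0 0 \<and>
    (\<forall>m. (\<integral>t. indicator {0..1} t * t ^ m \<partial>M) = u m 0)"
proof (cases "u 0 0 = 0")
  case True
  have "u k 0 \<le> u 0 0" for k
  proof (induction k)
    case (Suc k)
    then show ?case using u[of k 0] nonneg[of k 1] by simp
  qed simp
  then have "u k 0 = 0" for k
    using True nonneg[of k 0] by (metis order_antisym)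
  moreover have "finite_measure (null_measure borel :: real measure)"
    by (rule finite_measureI) simp
  ultimately show ?thesis
    by (intro exI[of _ "null_measure borel"]) (simp add: measure_def)
next
  case False
  then have pos: "0 < u 0 0"
    using nonneg[of 0 0] by simp
  obtain N where N: "real_distribution N"
    "\<And>m. (\<integral>t. indicator {0..1} t * t ^ m \<partial>N) = u m 0 / u 0 0"
  proof -
    have "u k j / u 0 0 = u (Suc k) j / u 0 0 + u k (Suc j) / u 0 0" for k j
      by (subst u) (rule add_divide_distrib)
    from Hausdorff_moment[of "\<lambda>k j. u k j / u 0 0", OF _ this]
    have "\<exists>N. real_distribution N \<and> (\<forall>m. (\<integral>t. indicator {0..1} t * t ^ m \<partial>N) = u m 0 / u 0 0)"
      using nonneg pos by simp
    then show ?thesis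
      using that by blast
  qed
  interpret N: real_distribution N by fact
  define M where "M = density N (\<lambda>_. ennreal (u 0 0))"
  have [simp]: "sets M = sets borel"
    by (simp add: M_def)
  have "emeasure M UNIV = ennreal (u 0 0)"
    using N.emeasure_space_1 by (simp add: M_def emeasure_density)
  moreover from this have "finite_measure M"
    by (intro finite_measureI) (simp add: M_def)
  moreover have "(\<integral>t. indicator {0..1} t * t ^ m \<partial>M) = u m 0" for m
    using pos unfolding M_def
    by (subst integral_density) (auto simp: N(2))
  ultimately show ?thesis
    using nonneg by (intro exI[of _ M]) (simp add: measure_def)
qed

section \<open>Operators represented by integrals\<close>

text \<open>The weak form of "\<open>G\<close> is the integral of \<open>g\<close>". Nothing is
  assumed about how \<open>\<nu> x\<close> depends on \<open>x\<close>; the linearity is carried by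
  \<open>G\<close> alone.\<close>

definition represents ::
    "('h::chilbert_space \<Rightarrow> 'a::topological_space measure) \<Rightarrow> ('a \<Rightarrow> complex) \<Rightarrow> 'h op \<Rightarrow> bool" where
  "represents \<nu> g G \<longleftrightarrow> clinear_op G \<and> (\<forall>x. cinner (G x) x = (LINT t|\<nu> x. g t))"

lemma representsD:
  assumes "represents \<nu> g G"
  shows "clinear_op G" "cinner (G x) x = (LINT t|\<nu> x. g t)"
  using assms by (auto simp: represents_def)

lemma represents_unique: "represents \<nu> g G \<Longrightarrow> represents \<nu> g G' \<Longrightarrow> G = G'"
  by (intro op_eqI) (auto simp: represents_def)

locale form_measures =
  fixes \<nu> :: "'h::chilbert_space \<Rightarrow> 'a::topological_space measure"
  assumes finite: "finite_measure (\<nu> x)" and sets: "sets (\<nu> x) = sets borel"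
    and mass: "measure (\<nu> x) UNIV \<le> (norm x)\<^sup>2"
begin

lemma cmod_LINT_le:
  assumes g: "bounded_borel g" and C: "\<And>t. cmod (g t) \<le> C"
  shows "cmod (LINT t|\<nu> x. g t) \<le> C * (norm x)\<^sup>2"
proof -
  interpret finite_measure "\<nu> x" by (rule finite)
  have space: "space (\<nu> x) = UNIV"
    using sets_eq_imp_space_eq[OF sets] by simp
  have "cmod (LINT t|\<nu> x. g t) \<le> (LINT t|\<nu> x. cmod (g t))"
    by (rule integral_norm_bound)
  also have "\<dots> \<le> (LINT t|\<nu> x. C)"
    using integrable_bounded_borel[OF finite sets g] C by (intro integral_mono) auto
  also have "\<dots> = C * measure (\<nu> x) UNIV"
    by (simp add: space)
  also have "\<dots> \<le> C * (norm x)\<^sup>2"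
    using order.trans[OF norm_ge_zero C] mass by (intro mult_left_mono) auto
  finally show ?thesis .
qed

lemma represents_norm_le:
  assumes "represents \<nu> g G" "bounded_borel g" "\<And>t. cmod (g t) \<le> C"
  shows "norm (G x) \<le> 2 * C * norm x" "norm G \<le> 2 * C"
  using norm_op_le_form[of G C] cmod_LINT_le[OF assms(2,3)] assms(1) order.trans[OF norm_ge_zero assms(3)]
  by (auto simp: represents_def)

lemma represents_lin:
  assumes "represents \<nu> f F" "represents \<nu> g G" "bounded_borel f" "bounded_borel g"
  shows "represents \<nu> (\<lambda>t. a * f t + b * g t) (scaleC_op a F + scaleC_op b G)"
  using assms by (auto simp: represents_def LINT_bounded_lin[OF finite sets] blinfun.add_left
      cinner.add_left cinner_scaleC_left)

lemma represents_lim: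
  assumes F: "\<And>n. bounded_borel (F n)" "\<And>n t. cmod (F n t) \<le> C" "\<And>t. (\<lambda>n. F n t) \<longlonglongrightarrow> g t"
    and G: "\<And>n. represents \<nu> (F n) (G n)"
  shows "\<exists>L. represents \<nu> g L \<and> (\<forall>x y. (\<lambda>n. cinner (G n x) y) \<longlonglongrightarrow> cinner (L x) y)"
proof -
  have "\<exists>L. clinear_op L \<and> (\<forall>x. cinner (L x) x = (LINT t|\<nu> x. g t)) \<and>
      (\<forall>x y. (\<lambda>n. cinner (G n x) y) \<longlonglongrightarrow> cinner (L x) y)"
  proof (rule weak_limit_op)
    show "clinear_op (G n)" for n
      by (rule representsD[OF G])
    show "cmod (cinner (G n x) x) \<le> C * (norm x)\<^sup>2" for n x
      using cmod_LINT_le[OF F(1,2)] by (simp add: representsD(2)[OF G])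
    show "(\<lambda>n. cinner (G n x) x) \<longlonglongrightarrow> (LINT t|\<nu> x. g t)" for x
      using LINT_bounded_lim[OF finite sets F] by (simp add: representsD(2)[OF G])
  qed
  then show ?thesis
    by (auto simp: represents_def)
qed

lemma represents_weak_lim:
  assumes F: "\<And>n. bounded_borel (F n)" "\<And>n t. cmod (F n t) \<le> C" "\<And>t. (\<lambda>n. F n t) \<longlonglongrightarrow> g t"
    and G: "\<And>n. represents \<nu> (F n) (G n)"
    and L: "clinear_op L" "\<And>x. (\<lambda>n. cinner (G n x) x) \<longlonglongrightarrow> cinner (L x) x"
  shows "represents \<nu> g L"
  using L LIMSEQ_unique[OF L(2) LINT_bounded_lim[OF finite sets F, folded representsD(2)[OF G]]]
  by (simp add: represents_def)

text \<open>Both products are recorded because multiplicativity is obtained by running through the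
  bounded Borel functions twice, with the two factors exchanged.\<close>

definition multipliers :: "(('a \<Rightarrow> complex) \<times> 'h op) set \<Rightarrow> ('a \<Rightarrow> complex) set" where
  "multipliers S = {g. bounded_borel g \<and> (\<exists>G. represents \<nu> g G \<and> (\<forall>(h, H)\<in>S.
     represents \<nu> (\<lambda>t. h t * g t) (H o\<^sub>L G) \<and> represents \<nu> (\<lambda>t. h t * g t) (G o\<^sub>L H)))}"

lemma multipliersD:
  assumes "g \<in> multipliers S" "represents \<nu> g G" "(h, H) \<in> S"
  shows "represents \<nu> (\<lambda>t. h t * g t) (H o\<^sub>L G)" "represents \<nu> (\<lambda>t. h t * g t) (G o\<^sub>L H)"
  using assms represents_unique[OF assms(2)] unfolding multipliers_def by fastforce+

lemma bounded_closed_multipliers: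
  assumes S: "\<And>h H. (h, H) \<in> S \<Longrightarrow> bounded_borel h \<and> clinear_op H"
  shows "bounded_closed (multipliers S)"
  unfolding bounded_closed_def
proof (intro conjI subsetI ballI allI impI)
  have "represents \<nu> (\<lambda>_. 0) 0"
    by (simp add: represents_def)
  then show "(\<lambda>_. 0) \<in> multipliers S"
    using S by (auto simp: multipliers_def intro!: exI[of _ 0]  simp: represents_def blinfun.zero_right)
next
  fix f g a b assume "f \<in> multipliers S" "g \<in> multipliers S"
  then obtain F G where F: "bounded_borel f" "represents \<nu> f F" and G: "bounded_borel g" "represents \<nu> g G"
    and FS: "\<And>h H. (h, H) \<in> S \<Longrightarrow> represents \<nu> (\<lambda>t. h t * f t) (H o\<^sub>L F) \<and> represents \<nu> (\<lambda>t. h t * f t) (F o\<^sub>L H)"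
    and GS: "\<And>h H. (h, H) \<in> S \<Longrightarrow> represents \<nu> (\<lambda>t. h t * g t) (H o\<^sub>L G) \<and> represents \<nu> (\<lambda>t. h t * g t) (G o\<^sub>L H)"
    unfolding multipliers_def by blast
  define K where "K = scaleC_op a F + scaleC_op b G"
  have "represents \<nu> (\<lambda>t. h t * (a * f t + b * g t)) (H o\<^sub>L K)"
    "represents \<nu> (\<lambda>t. h t * (a * f t + b * g t)) (K o\<^sub>L H)" if hH: "(h, H) \<in> S" for h H
  proof -
    have bb: "bounded_borel (\<lambda>t. h t * f t)" "bounded_borel (\<lambda>t. h t * g t)"
      using S[OF hH] F G by (auto intro: bounded_borel_mult)
    have eq: "(\<lambda>t. h t * (a * f t + b * g t)) = (\<lambda>t. a * (h t * f t) + b * (h t * g t))"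
      by (simp add: algebra_simps)
    have "H o\<^sub>L K = scaleC_op a (H o\<^sub>L F) + scaleC_op b (H o\<^sub>L G)"
      using S[OF hH] by (intro blinfun_eqI) (simp add: K_def blinfun.add_left blinfun.add_right clinear_opD)
    then show "represents \<nu> (\<lambda>t. h t * (a * f t + b * g t)) (H o\<^sub>L K)"
      unfolding eq using FS[OF hH] GS[OF hH] bb by (simp add: represents_lin)
    have "K o\<^sub>L H = scaleC_op a (F o\<^sub>L H) + scaleC_op b (G o\<^sub>L H)"
      by (intro blinfun_eqI) (simp add: K_def blinfun.add_left)
    then show "represents \<nu> (\<lambda>t. h t * (a * f t + b * g t)) (K o\<^sub>L H)"
      unfolding eq using FS[OF hH] GS[OF hH] bb by (simp add: represents_lin)
  qed
  moreover have "represents \<nu> (\<lambda>t. a * f t + b * g t) K"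
    unfolding K_def by (intro represents_lin F G)
  ultimately show "(\<lambda>t. a * f t + b * g t) \<in> multipliers S"
    using F G by (auto simp: multipliers_def intro!: bounded_borel_lin)
next
  fix F C g assume *: "\<forall>n. F n \<in> multipliers S" and C: "\<forall>n t. cmod (F n t) \<le> C"
    and lim: "\<forall>t. (\<lambda>n::nat. F n t) \<longlonglongrightarrow> g t"
  from * have "\<forall>n. \<exists>G. represents \<nu> (F n) G"
    by (auto simp: multipliers_def)
  then obtain G where G: "\<And>n. represents \<nu> (F n) (G n)" by metis
  have F: "bounded_borel (F n)" for n
    using * by (auto simp: multipliers_def)
  obtain L where L: "represents \<nu> g L" "\<And>x y. (\<lambda>n. cinner (G n x) y) \<longlonglongrightarrow> cinner (L x) y"
    using represents_lim[of F C g G] F G C lim by blast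
  have "represents \<nu> (\<lambda>t. h t * g t) (H o\<^sub>L L) \<and> represents \<nu> (\<lambda>t. h t * g t) (L o\<^sub>L H)"
    if hH: "(h, H) \<in> S" for h H
  proof -
    note hS = S[OF hH, THEN conjunct1] S[OF hH, THEN conjunct2]
    obtain B where B: "\<And>t. cmod (h t) \<le> B"
      using hS by (auto simp: bounded_borel_def)
    have B0: "0 \<le> B"
      using B norm_ge_zero order.trans by blast
    have bound: "cmod (h t * F n t) \<le> B * C" for n t
      using C B B0 by (auto simp: norm_mult intro!: mult_mono)
    have lim': "(\<lambda>n. h t * F n t) \<longlonglongrightarrow> h t * g t" for t
      using lim by (intro tendsto_mult_left) auto
    have bb: "bounded_borel (\<lambda>t. h t * F n t)" for n
      using hS F by (intro bounded_borel_mult)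
    have HG: "represents \<nu> (\<lambda>t. h t * F n t) (H o\<^sub>L G n)" "represents \<nu> (\<lambda>t. h t * F n t) (G n o\<^sub>L H)" for n
      using multipliersD[OF _ G hH] * by auto
    \<comment> \<open>Weak convergence survives the fixed left factor \<open>H\<close> once
      \<open>H\<close> is moved to the other side as its adjoint.\<close>
    have "(\<lambda>n. cinner ((H o\<^sub>L G n) x) x) \<longlonglongrightarrow> cinner ((H o\<^sub>L L) x) x" for x
      using L(2) by (simp add: adj_props(1)[OF hS(2)])
    moreover have "(\<lambda>n. cinner ((G n o\<^sub>L H) x) x) \<longlonglongrightarrow> cinner ((L o\<^sub>L H) x) x" for x
      using L(2) by simp
    ultimately show ?thesis
      using represents_weak_lim[OF bb bound lim' HG(1), of "H o\<^sub>L L"]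
        represents_weak_lim[OF bb bound lim' HG(2), of "L o\<^sub>L H"] hS representsD(1)[OF L(1)] by simp
  qed
  then show "g \<in> multipliers S"
    using L(1) bounded_borel_lim(1)[of F C g] F C lim unfolding multipliers_def by blast
qed (auto simp: multipliers_def)

end

lemma LINT_indicator_complex:
  assumes "finite_measure m" "sets m = sets borel" "D \<in> sets borel"
  shows "(LINT t|m. indicator D t :: complex) = of_real (measure m D)"
proof -
  interpret finite_measure m by fact
  have "(LINT t|m. indicator D t :: complex) = (LINT t|m. of_real (indicator D t))"
    by (intro Bochner_Integration.integral_cong) (auto simp: indicator_def)
  also have "\<dots> = of_real (LINT t|m. indicator D t)"
    using assms
    by (intro integral_of_real integrable_real_indicator) (auto simp: emeasure_finite less_top[symmetric])
  also have "(LINT t|m. indicator D t :: real) = measure m D"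
    using assms sets_eq_imp_space_eq[OF assms(2)] by simp
  finally show ?thesis .
qed

section \<open>Integration with respect to a projection-valued measure\<close>

locale pvm =
  fixes M :: "'h::chilbert_space set" and E :: "complex set \<Rightarrow> 'h op"
  assumes M: "csubspace M" and pvm: "projection_valued_measure M E"
begin

abbreviation \<nu> :: "'h \<Rightarrow> complex measure" where "\<nu> \<equiv> scalar_measure E"

lemma E_props:
  assumes "D \<in> sets borel"
  shows "op_on M (E D)" "adj (E D) = E D" "clinear_op (E D)" "cinner (E D x) y = cinner x (E D y)"
    "D' \<in> sets borel \<Longrightarrow> E (D \<inter> D') = E D o\<^sub>L E D'"
    "cinner (E D x) x = of_real ((norm (E D x))\<^sup>2)"
proof -
  show 1: "op_on M (E D)" "adj (E D) = E D" and 2: "\<And>D'. D' \<in> sets borel \<Longrightarrow> E (D \<inter> D') = E D o\<^sub>L E D'"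
    using pvm assms unfolding projection_valued_measure_def by blast+
  show 3: "clinear_op (E D)"
    using op_onD[OF 1(1)] by simp
  show 4: "cinner (E D x) y = cinner x (E D y)" for x y
    using adj_props(1)[OF 3, of x y] 1(2) by simp
  have "E D x = E D (E D x)"
    using 2[OF assms] by (metis blinfun_apply_blinfun_compose inf.idem)
  then show "cinner (E D x) x = of_real ((norm (E D x))\<^sup>2)"
    using 4[of "E D x" x] by (simp add: cinner_eq_norm)
qed

lemma E_UNIV: "E UNIV = proj M"
  using pvm by (simp add: projection_valued_measure_def)

lemma E_sums:
  assumes "range F \<subseteq> sets borel" "disjoint_family F"
  shows "(\<lambda>n. E (F n) x) sums E (\<Union>n. F n) x"
  using pvm assms by (auto simp: projection_valued_measure_def)

lemma E_empty: "E {} = 0"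
proof (rule blinfun_eqI)
  fix x
  have "(\<lambda>n::nat. E {} x) sums E (\<Union>n::nat. {}) x"
    by (rule E_sums) (auto simp: disjoint_family_on_def)
  then have "(\<lambda>n::nat. E {} x) \<longlonglongrightarrow> 0"
    by (intro summable_LIMSEQ_zero sums_summable)
  then show "E {} x = blinfun_apply 0 x"
    using LIMSEQ_unique[OF tendsto_const] by fastforce
qed

lemma sets_scalar_measure: "sets (\<nu> x) = sets borel"
  unfolding scalar_measure_def by (metis sets.sets_measure_of_eq space_borel)

lemma emeasure_scalar_measure:
  assumes "D \<in> sets borel"
  shows "emeasure (\<nu> x) D = ennreal ((norm (E D x))\<^sup>2)"
proof -
  have Re: "Re (cinner (E D x) x) = (norm (E D x))\<^sup>2" if "D \<in> sets borel" for D
    using E_props(6)[OF that] by simp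
  have "emeasure (\<nu> x) D = ennreal (Re (cinner (E D x) x))"
    unfolding scalar_measure_def
  proof (rule emeasure_measure_of_sigma)
    show "sigma_algebra UNIV (sets borel :: complex set set)"
      using sets.sigma_algebra_axioms[of borel] by simp
    show "positive (sets borel) (\<lambda>D. ennreal (Re (cinner (E D x) x)))"
      by (simp add: positive_def E_empty)
    show "countably_additive (sets borel) (\<lambda>D. ennreal (Re (cinner (E D x) x)))"
      unfolding countably_additive_def
    proof (intro allI impI)
      fix F :: "nat \<Rightarrow> complex set" assume F: "range F \<subseteq> sets borel" "disjoint_family F"
      have "(\<lambda>n. Re (cinner (E (F n) x) x)) sums Re (cinner (E (\<Union>n. F n) x) x)"
        using bounded_linear.sums[OF bounded_linear_compose[OF bounded_linear_Re
            cinner.bounded_linear_left] E_sums[OF F]] .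
      then show "(\<Sum>n. ennreal (Re (cinner (E (F n) x) x))) = ennreal (Re (cinner (E (\<Union>n. F n) x) x))"
        using F(1) by (intro suminf_ennreal_eq) (auto simp: Re range_subsetD)
    qed
  qed (use assms in auto)
  with Re[OF assms] show ?thesis by simp
qed

sublocale form_measures \<nu>
proof (rule form_measures.intro)
  fix x
  show "sets (\<nu> x) = sets borel" by (rule sets_scalar_measure)
  have UNIV: "emeasure (\<nu> x) UNIV = ennreal ((norm (proj M x))\<^sup>2)"
    by (simp add: emeasure_scalar_measure E_UNIV)
  have "space (\<nu> x) = UNIV"
    using sets_eq_imp_space_eq[OF sets_scalar_measure] by simp
  then show "finite_measure (\<nu> x)"
    by (intro finite_measureI) (simp add: UNIV)
  show "measure (\<nu> x) UNIV \<le> (norm x)\<^sup>2"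
    using cinner_proj_self(2)[OF M, of x] by (simp add: measure_def UNIV power_mono)
qed

lemma represents_indicator:
  assumes "D \<in> sets borel"
  shows "represents \<nu> (indicator D) (E D)"
  using assms by (auto simp: represents_def E_props(3,6) LINT_indicator_complex[OF finite sets]
      measure_def emeasure_scalar_measure)

definition \<Phi> :: "(complex \<Rightarrow> complex) \<Rightarrow> 'h op" where
  "\<Phi> g = (THE G. represents \<nu> g G)"

lemma \<Phi>_eqI: "represents \<nu> g G \<Longrightarrow> \<Phi> g = G"
  unfolding \<Phi>_def by (rule the_equality) (auto intro: represents_unique)

text \<open>The first of the two runs: for two indicators the product rule is the intersection
  property of \<open>E\<close>, and the class argument frees one factor. In
  \<open>\<Phi>_mult\<close> that factor is fixed and the other one is freed.\<close>

lemma indicator_multiplier: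
  assumes "bounded_borel g"
  shows "g \<in> multipliers {(indicator D, E D) |D. D \<in> sets borel}" (is "_ \<in> multipliers ?S")
proof (rule bounded_closed_from_indicators[OF bounded_closed_multipliers _ assms])
  show "bounded_borel h \<and> clinear_op H" if "(h, H) \<in> ?S" for h H
    using that by (auto intro: bounded_borel_indicator E_props)
  fix D' :: "complex set" assume D': "D' \<in> sets borel"
  have "represents \<nu> (\<lambda>t. indicator D t * indicator D' t) (E D o\<^sub>L E D')"
    "represents \<nu> (\<lambda>t. indicator D t * indicator D' t) (E D' o\<^sub>L E D)" if D: "D \<in> sets borel" for D
  proof -
    have "(\<lambda>t. indicator D t * indicator D' t) = (indicator (D \<inter> D') :: complex \<Rightarrow> complex)"
      by (auto simp: indicator_def)
    moreover have "E (D \<inter> D') = E D o\<^sub>L E D'" "E (D \<inter> D') = E D' o\<^sub>L E D"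
      using E_props(5)[OF D D'] E_props(5)[OF D' D] by (auto simp: Int_commute)
    ultimately show "represents \<nu> (\<lambda>t. indicator D t * indicator D' t) (E D o\<^sub>L E D')"
      "represents \<nu> (\<lambda>t. indicator D t * indicator D' t) (E D' o\<^sub>L E D)"
      using represents_indicator[of "D \<inter> D'"] D D' by auto
  qed
  then show "indicator D' \<in> multipliers ?S"
    unfolding multipliers_def using represents_indicator[OF D'] bounded_borel_indicator[OF D'] by blast
qed

lemma \<Phi>_represents:
  assumes "bounded_borel g"
  shows "represents \<nu> g (\<Phi> g)"
proof -
  obtain G where "represents \<nu> g G"
    using indicator_multiplier[OF assms] by (auto simp: multipliers_def)
  then show ?thesis
    using \<Phi>_eqI by metis
qed

lemma \<Phi>_form:
  assumes "bounded_borel g"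
  shows "cinner (\<Phi> g x) x = (LINT z|\<nu> x. g z)"
  using representsD(2)[OF \<Phi>_represents[OF assms]] .

lemma \<Phi>_clinear: "bounded_borel g \<Longrightarrow> clinear_op (\<Phi> g)"
  using representsD(1)[OF \<Phi>_represents] .

lemma \<Phi>_indicator: "D \<in> sets borel \<Longrightarrow> \<Phi> (indicator D) = E D"
  by (intro \<Phi>_eqI represents_indicator)

lemma \<Phi>_one: "\<Phi> (\<lambda>_. 1) = proj M"
  using \<Phi>_indicator[of UNIV] by (simp add: E_UNIV)

lemma \<Phi>_lin:
  assumes "bounded_borel f" "bounded_borel g"
  shows "\<Phi> (\<lambda>z. a * f z + b * g z) = scaleC_op a (\<Phi> f) + scaleC_op b (\<Phi> g)"
  by (intro \<Phi>_eqI represents_lin \<Phi>_represents assms)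

lemma \<Phi>_scale:
  assumes "bounded_borel f"
  shows "\<Phi> (\<lambda>z. a * f z) = scaleC_op a (\<Phi> f)"
proof -
  have [simp]: "scaleC_op 0 T = 0" for T :: "'h op"
    by (intro blinfun_eqI) simp
  show ?thesis
    using \<Phi>_lin[OF assms assms, of a 0] by simp
qed

lemma \<Phi>_diff:
  assumes "bounded_borel f" "bounded_borel g"
  shows "\<Phi> (\<lambda>z. f z - g z) = \<Phi> f - \<Phi> g"
proof -
  have "scaleC_op 1 T + scaleC_op (-1) T' = T - T'" for T T' :: "'h op"
    by (intro blinfun_eqI) (simp add: scaleC_minus_left blinfun.add_left blinfun.diff_left)
  then show ?thesis
    using \<Phi>_lin[OF assms, of 1 "-1"] by simp
qed

lemma \<Phi>_mult:
  assumes f: "bounded_borel f" and g: "bounded_borel g"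
  shows "\<Phi> (\<lambda>z. f z * g z) = \<Phi> f o\<^sub>L \<Phi> g"
proof -
  have "g \<in> multipliers {(f, \<Phi> f)}"
  proof (rule bounded_closed_from_indicators[OF bounded_closed_multipliers _ g])
    show "bounded_borel h \<and> clinear_op H" if "(h, H) \<in> {(f, \<Phi> f)}" for h H
      using that f \<Phi>_clinear by auto
    fix D :: "complex set" assume D: "D \<in> sets borel"
    have "represents \<nu> (\<lambda>t. indicator D t * f t) (E D o\<^sub>L \<Phi> f)" "represents \<nu> (\<lambda>t. indicator D t * f t) (\<Phi> f o\<^sub>L E D)"
      using multipliersD[OF indicator_multiplier[OF f] \<Phi>_represents[OF f]] D by blast+
    then show "indicator D \<in> multipliers {(f, \<Phi> f)}"
      unfolding multipliers_def using represents_indicator[OF D] bounded_borel_indicator[OF D]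
      by (auto simp: mult.commute)
  qed
  from multipliersD(1)[OF this \<Phi>_represents[OF g]] show ?thesis
    by (intro \<Phi>_eqI) auto
qed

lemma \<Phi>_op_on:
  assumes g: "bounded_borel g"
  shows "op_on M (\<Phi> g)"
proof -
  have "\<Phi> g o\<^sub>L proj M = \<Phi> g" "proj M o\<^sub>L \<Phi> g = \<Phi> g"
    using \<Phi>_mult[OF g bounded_borel_const[of 1], symmetric]
      \<Phi>_mult[OF bounded_borel_const[of 1] g, symmetric]
    by (simp_all add: \<Phi>_one)
  then show ?thesis
    using \<Phi>_clinear[OF g] by (simp add: op_on_iff[OF M])
qed

lemma \<Phi>_norm_le:
  assumes "bounded_borel g" "\<And>z. cmod (g z) \<le> C"
  shows "norm (\<Phi> g x) \<le> 2 * C * norm x" "norm (\<Phi> g) \<le> 2 * C"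
  using represents_norm_le[OF \<Phi>_represents[OF assms(1)] assms] by auto

end

section \<open>The spectral theorem for positive contractions\<close>

lemma op_comp_assoc: "(A o\<^sub>L B) o\<^sub>L C = A o\<^sub>L (B o\<^sub>L C)"
  by (rule blinfun_eqI) simp

text \<open>The zeroth power is \<open>proj M\<close>, the unit of the operators on
  \<open>M\<close>, so that power 0 matches the integral of the constant 1.\<close>

definition op_power :: "'h::chilbert_space set \<Rightarrow> 'h op \<Rightarrow> nat \<Rightarrow> 'h op" where
  "op_power M T n = ((o\<^sub>L) T ^^ n) (proj M)"

lemma op_power_0 [simp]: "op_power M T 0 = proj M"
  and op_power_Suc: "op_power M T (Suc n) = T o\<^sub>L op_power M T n"
  by (simp_all add: op_power_def)

lemma op_power_props:
  assumes M: "csubspace M" and T: "op_on M T"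
  shows "op_on M (op_power M T n)" "op_power M T m o\<^sub>L op_power M T n = op_power M T (m + n)"
proof -
  note [simp] = op_on_iff[OF M] proj_idem[OF M] proj_props(3)[OF M]
  show *: "op_on M (op_power M T n)" for n
  proof (induction n)
    case (Suc n)
    then show ?case using T
      by (simp add: op_power_Suc) (metis op_comp_assoc)
  qed simp
  show "op_power M T m o\<^sub>L op_power M T n = op_power M T (m + n)"
  proof (induction m)
    case 0
    show ?case using *[of n] by simp
  next
    case (Suc m)
    then show ?case by (simp add: op_power_Suc op_comp_assoc)
  qed
qed

lemma op_power_selfadjoint:
  assumes M: "csubspace M" and T: "op_on M T" and sa: "\<And>x y. cinner (T x) y = cinner x (T y)"
  shows "cinner (op_power M T n x) y = cinner x (op_power M T n y)"
proof (induction n arbitrary: x y)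
  case 0
  show ?case using cinner_proj[OF M, of x y] by simp
next
  case (Suc n)
  have "op_power M T n (T y) = op_power M T (Suc n) y" for y
  proof -
    have "op_power M T 1 = T"
      using T by (simp add: op_power_Suc op_on_iff[OF M])
    then show ?thesis
      using op_power_props(2)[OF M T, of n 1] by (metis Suc_eq_plus1 blinfun_apply_blinfun_compose)
  qed
  moreover have "cinner (op_power M T (Suc n) x) y = cinner x (op_power M T n (T y))"
    by (simp add: op_power_Suc sa Suc)
  ultimately show ?case by simp
qed

text \<open>\<open>u x k j\<close> is the form of \<open>T^k (1 - T)^j\<close> at \<open>x\<close>.
  Two factors \<open>T\<close>, or two factors \<open>1 - T\<close>, can be split between the two
  arguments, which lowers the exponents to at most 1. The case \<open>k = j = 1\<close> follows from
  \<open>T (1 - T) = T\<^sup>2 (1 - T) + T (1 - T)\<^sup>2\<close>.\<close>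

lemma contraction_moments:
  assumes T: "positive_op T" and le: "\<And>x. inner (T x) x \<le> inner x x"
  shows "\<exists>m. finite_measure m \<and> sets m = sets borel \<and> measure m UNIV = inner x x \<and>
    (\<forall>n. (\<integral>t. indicator {0..1} t * t ^ n \<partial>m) = inner ((blinfun_apply T ^^ n) x) x)"
proof -
  define t where "t = blinfun_apply T"
  define s where "s y = y - t y" for y
  define u where "u x k j = inner ((t ^^ k) ((s ^^ j) x)) x" for x k j
  have t_sym: "inner (t x) y = inner x (t y)" for x y
    using positive_opD(2)[OF T, of x y] by (simp add: t_def flip: Re_cinner)
  have s_sym: "inner (s x) y = inner x (s y)" for x y
    by (simp add: s_def inner_simps t_sym)
  have t_add: "t (x + y) = t x + t y" for x y
    by (simp add: t_def blinfun.add_right)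
  have st: "s (t x) = t (s x)" for x
    by (simp add: s_def t_def blinfun.diff_right)
  have tk_add: "(t ^^ k) (x + y) = (t ^^ k) x + (t ^^ k) y" for k x y
    by (induction k) (simp_all add: t_add)
  have s_tk: "(t ^^ k) (s x) = s ((t ^^ k) x)" for k x
    by (induction k) (simp_all add: st)
  have t_sj: "(s ^^ j) (t x) = t ((s ^^ j) x)" for j x
    by (induction j) (simp_all add: st)
  have rec: "u x k j = u x (Suc k) j + u x k (Suc j)" for x k j
  proof -
    have "(t ^^ k) (t ((s ^^ j) x)) + (t ^^ k) (s ((s ^^ j) x)) = (t ^^ k) ((s ^^ j) x)"
      by (simp add: s_def flip: tk_add)
    then show ?thesis
      unfolding u_def by (simp add: funpow_swap1 flip: inner_add_left)
  qed
  have u_t: "u x (Suc (Suc k)) j = u (t x) k j" for x k j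
    unfolding u_def by (simp add: t_sym t_sj flip: funpow_swap1)
  have u_s: "u x k (Suc (Suc j)) = u (s x) k j" for x k j
    unfolding u_def by (simp add: s_tk s_sym flip: funpow_swap1)
  have u01: "0 \<le> u x 0 (Suc 0)" and u10: "0 \<le> u x (Suc 0) 0" for x
    using le[of x] positive_opD(4)[OF T, of x] by (simp_all add: u_def s_def t_def inner_diff_left)
  have nonneg: "0 \<le> u x k j" for x k j
  proof (induction "k + j" arbitrary: x k j rule: less_induct)
    case less
    show ?case
    proof (cases "2 \<le> k \<or> 2 \<le> j")
      case True
      then consider k' where "k = Suc (Suc k')" | j' where "j = Suc (Suc j')"
        by (metis add_2_eq_Suc le_Suc_ex)
      then show ?thesis
        by cases (use less in \<open>simp_all add: u_t u_s\<close>)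
    next
      case False
      then have "k = 0 \<or> k = Suc 0" "j = 0 \<or> j = Suc 0" by auto
      moreover have "0 \<le> u x (Suc 0) (Suc 0)"
        unfolding rec[of x "Suc 0" "Suc 0"] u_t u_s by (intro add_nonneg_nonneg u01 u10)
      ultimately show ?thesis
        using u01[of x] u10[of x] by (auto simp: u_def)
    qed
  qed
  show ?thesis
    using Hausdorff_moment_finite_measure[of "u x", OF nonneg rec] by (simp add: u_def t_def)
qed

text \<open>Finite additivity and weak continuity at the empty set suffice: for projections
  \<open>(norm (E D x))\<^sup>2\<close> is the form of \<open>E D\<close> at \<open>x\<close>, so
  weak convergence to 0 is already convergence in norm at each \<open>x\<close>.\<close>

lemma projection_valued_measureI:
  fixes M :: "'h::chilbert_space set"
  assumes M: "csubspace M"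
    and clinear: "\<And>D. D \<in> sets borel \<Longrightarrow> clinear_op (E D)"
    and real: "\<And>D x. D \<in> sets borel \<Longrightarrow> cinner (E D x) x \<in> \<real>"
    and Int: "\<And>D D'. D \<in> sets borel \<Longrightarrow> D' \<in> sets borel \<Longrightarrow> E (D \<inter> D') = E D o\<^sub>L E D'"
    and UNIV: "E UNIV = proj M"
    and Un: "\<And>D D'. D \<in> sets borel \<Longrightarrow> D' \<in> sets borel \<Longrightarrow> D \<inter> D' = {} \<Longrightarrow> E (D \<union> D') = E D + E D'"
    and continuous: "\<And>F x. range F \<subseteq> sets borel \<Longrightarrow> decseq F \<Longrightarrow> (\<Inter>n. F n) = {} \<Longrightarrow>
        (\<lambda>n::nat. cinner (E (F n) x) x) \<longlonglongrightarrow> 0"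
    and other: "\<And>D. D \<notin> sets borel \<Longrightarrow> E D = 0"
  shows "projection_valued_measure M E"
proof -
  have sa: "cinner (E D x) y = cinner x (E D y)" if "D \<in> sets borel" for D x y
    using selfadjoint_if_real_form[OF clinear real] that by blast
  have norm: "(norm (E D x))\<^sup>2 = Re (cinner (E D x) x)" if D: "D \<in> sets borel" for D x
  proof -
    have "E D (E D x) = E D x"
      using Int[OF D D] by (metis Int_absorb blinfun_apply_blinfun_compose)
    then have "cinner (E D x) x = cinner (E D x) (E D x)"
      using sa[OF D, of "E D x" x] by simp
    then show ?thesis by (simp add: cinner_eq_norm)
  qed
  have "E D o\<^sub>L proj M = E D" "proj M o\<^sub>L E D = E D" if "D \<in> sets borel" for D
    using Int[OF that, of UNIV] Int[OF _ that, of UNIV] UNIV by simp_all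
  then have "op_on M (E D)" if "D \<in> sets borel" for D
    using that clinear by (simp add: op_on_iff[OF M])
  moreover have "(\<lambda>n. E (F n) x) sums E (\<Union>n. F n) x"
    if F: "range F \<subseteq> sets borel" "disjoint_family F" for F :: "nat \<Rightarrow> complex set" and x
  proof -
    have [measurable]: "F n \<in> sets borel" for n
      using F by auto
    define U where "U n = (\<Union>k<n. F k)" for n
    define V where "V n = (\<Union>k. F k) - U n" for n
    have UV [measurable]: "U n \<in> sets borel" "V n \<in> sets borel" for n
      unfolding U_def V_def by measurable
    have partial: "(\<Sum>k<n. E (F k) x) = E (U n) x" for n
    proof (induction n)
      case 0
      have "E {} = E {} + E {}" using Un[of "{}" "{}"] by simp
      then show ?case by (simp add: U_def)
    next
      case (Suc n)
      have "U n \<inter> F n = {}"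
        using disjoint_family_onD[OF F(2), of n] by (fastforce simp: U_def)
      moreover have "U (Suc n) = U n \<union> F n"
        by (auto simp: U_def lessThan_Suc)
      ultimately show ?case
        using Un[of "U n" "F n"] Suc by (simp add: blinfun.add_left)
    qed
    have rest: "E (\<Union>k. F k) x = E (U n) x + E (V n) x" for n
    proof -
      have "(\<Union>k. F k) = U n \<union> V n" "U n \<inter> V n = {}"
        by (auto simp: U_def V_def)
      then show ?thesis using Un[of "U n" "V n"] by (simp add: blinfun.add_left)
    qed
    have "(\<Inter>n. V n) = {}"
      by (auto simp: V_def U_def)
    moreover have "decseq V"
      by (auto simp: decseq_def V_def U_def)
    ultimately have "(\<lambda>n. cinner (E (V n) x) x) \<longlonglongrightarrow> 0"
      by (intro continuous) auto
    from tendsto_Re[OF this] have "(\<lambda>n. (norm (E (V n) x))\<^sup>2) \<longlonglongrightarrow> 0"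
      by (simp add: norm)
    from tendsto_real_sqrt[OF this] have "(\<lambda>n. E (V n) x) \<longlonglongrightarrow> 0"
      by (simp add: tendsto_norm_zero_iff)
    have diff: "E (\<Union>k. F k) x - E (V n) x = E (U n) x" for n
      using rest[of n] by simp
    from tendsto_diff[OF tendsto_const \<open>(\<lambda>n. E (V n) x) \<longlonglongrightarrow> 0\<close>, of "E (\<Union>k. F k) x"] show ?thesis
      unfolding sums_def partial diff by simp
  qed
  ultimately show ?thesis
    unfolding projection_valued_measure_def using sa Int UNIV other by (auto intro!: adj_eqI)
qed

text \<open>Products are known for powers of \<open>T\<close> only. A first class argument extends
  them to (bounded function) times (power), a second one to two bounded functions; indicators then
  give commuting projections. The measure is finally moved from the line to the plane.\<close>

lemma spectral_theorem_contraction: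
  fixes M :: "'h::chilbert_space set"
  assumes M: "csubspace M" and T: "op_on M T" "positive_op T" and le: "\<And>x. inner (T x) x \<le> inner x x"
  shows "\<exists>E. projection_valued_measure M E \<and> E (complex_of_real ` {0..1}) = proj M \<and>
    represents (scalar_measure E) (\<lambda>z. indicator (complex_of_real ` {0..1}) z * z) T"
proof -
  let ?P = "proj M" and ?Q = "op_power M T"
  have Q_apply: "?Q n x = (blinfun_apply T ^^ n) (?P x)" for n x
    by (induction n) (simp_all add: op_power_Suc)
  have Q_form: "cinner (?Q n x) x = of_real (inner ((blinfun_apply T ^^ n) (?P x)) (?P x))" for n x
  proof -
    note sa = op_power_selfadjoint[OF M T(1) positive_opD(2)[OF T(2)]]
    have Q: "op_on M (?Q n)" by (rule op_power_props[OF M T(1)])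
    have "cinner (?Q n x) x = cnj (cinner (?Q n x) x)"
      by (metis cinner_commute sa)
    then have real: "cinner (?Q n x) x = of_real (Re (cinner (?Q n x) x))"
      by (metis Reals_cnj_iff complex_is_Real_iff of_real_Re)
    have "cinner (?Q n x) x = cinner (?Q n x) (?P x)"
      using cinner_proj(1)[OF M, of "?Q n x" x] proj_fix[OF M op_onD(2)[OF Q]] by simp
    then have "Re (cinner (?Q n x) x) = inner ((blinfun_apply T ^^ n) (?P x)) (?P x)"
      by (simp add: Re_cinner Q_apply)
    with real show ?thesis by simp
  qed
  \<comment> \<open>The moments are taken at the projection of \<open>x\<close>, so that the total
    mass is the form of \<open>proj M\<close> at \<open>x\<close>.\<close>
  obtain \<nu> where \<nu>: "\<And>x. finite_measure (\<nu> x)" "\<And>x. sets (\<nu> x) = sets borel"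
    "\<And>x. measure (\<nu> x) UNIV = inner (?P x) (?P x)"
    "\<And>x n. (\<integral>t. indicator {0..1} t * t ^ n \<partial>\<nu> x) = inner ((blinfun_apply T ^^ n) (?P x)) (?P x)"
  proof -
    have "\<forall>x. \<exists>m. finite_measure m \<and> sets m = sets borel \<and> measure m UNIV = inner (?P x) (?P x) \<and>
        (\<forall>n. (\<integral>t. indicator {0..1} t * t ^ n \<partial>m) = inner ((blinfun_apply T ^^ n) (?P x)) (?P x))"
      using contraction_moments[OF T(2) le] by blast
    from choice[OF this] show ?thesis
      using that by blast
  qed
  interpret form_measures \<nu>
    using \<nu> cinner_proj_self(2)[OF M]
    by (intro form_measures.intro) (auto simp: power_mono simp flip: power2_norm_eq_inner)
  let ?mono = "\<lambda>n t. complex_of_real (indicator {0..1} t * t ^ n)"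
  have mono_bb: "bounded_borel (?mono n)" for n
    by (rule bounded_borelI[of _ 1]) (auto simp: indicator_def norm_power power_le_one)
  have mono_rep: "represents \<nu> (?mono n) (?Q n)" for n
  proof -
    have "integrable (\<nu> x) (\<lambda>t. indicator {0..1} t * t ^ n)" for x
      using integrable_Re[OF integrable_bounded_borel[OF finite sets mono_bb]] by simp
    then have "(LINT t|\<nu> x. ?mono n t) = of_real (inner ((blinfun_apply T ^^ n) (?P x)) (?P x))" for x
      unfolding \<nu>(4)[symmetric] by (intro integral_of_real)
    then show ?thesis
      using op_onD(1)[OF op_power_props(1)[OF M T(1)]] by (simp add: represents_def Q_form)
  qed
  have mono_mult: "?mono m t * ?mono n t = ?mono (m + n) t" for m n t
    by (simp add: indicator_def power_add)
  define S1 where "S1 = range (\<lambda>n. (?mono n, ?Q n))"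
  have mult1: "(\<lambda>t. indicator {0..1} t * g t) \<in> multipliers S1" if g: "bounded_borel g" for g
  proof (rule bounded_closed_from_monomials[OF bounded_closed_multipliers _ g])
    show "bounded_borel h \<and> clinear_op H" if "(h, H) \<in> S1" for h H
      using that mono_bb mono_rep by (auto simp: S1_def represents_def)
    show "?mono n \<in> multipliers S1" for n
      unfolding multipliers_def S1_def
      using mono_bb mono_rep
      by (auto simp only: mono_mult op_power_props(2)[OF M T(1)] add.commute[of n] intro!: exI[of _ "?Q n"])
  qed
  define S2 where "S2 = {(f, F). bounded_borel f \<and> (\<forall>t. f t = indicator {0..1} t * f t) \<and> represents \<nu> f F}"
  have mult2: "(\<lambda>t. indicator {0..1} t * g t) \<in> multipliers S2" if g: "bounded_borel g" for g
  proof (rule bounded_closed_from_monomials[OF bounded_closed_multipliers _ g])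
    show "bounded_borel h \<and> clinear_op H" if "(h, H) \<in> S2" for h H
      using that by (auto simp: S2_def represents_def)
    fix n
    have "represents \<nu> (\<lambda>t. f t * ?mono n t) (F o\<^sub>L ?Q n)" "represents \<nu> (\<lambda>t. f t * ?mono n t) (?Q n o\<^sub>L F)"
      if f: "(f, F) \<in> S2" for f F
    proof -
      have f': "(\<lambda>t. indicator {0..1} t * f t) = f"
        using f by (auto simp: S2_def)
      have "f \<in> multipliers S1"
        using mult1[of f] f unfolding f' by (simp add: S2_def)
      moreover have "represents \<nu> f F" "(?mono n, ?Q n) \<in> S1"
        using f by (auto simp: S1_def S2_def)
      moreover have "(\<lambda>t. f t * ?mono n t) = (\<lambda>t. ?mono n t * f t)"
        by (simp only: mult.commute)
      ultimately show "represents \<nu> (\<lambda>t. f t * ?mono n t) (F o\<^sub>L ?Q n)" "represents \<nu> (\<lambda>t. f t * ?mono n t) (?Q n o\<^sub>L F)"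
        using multipliersD[of f S1 F "?mono n" "?Q n"] by presburger+
    qed
    then show "?mono n \<in> multipliers S2"
      unfolding multipliers_def using mono_bb mono_rep by blast
  qed
  \<comment> \<open>The function on the line that stands for the plane set \<open>D\<close>, cut to
    [0, 1] because the class arguments reach cut-off functions only.\<close>
  define \<rho> :: "complex set \<Rightarrow> real \<Rightarrow> complex" where "\<rho> D t = indicator {0..1} t * indicator D (complex_of_real t)" for D t
  have ofreal_meas [measurable]: "complex_of_real \<in> borel_measurable borel" by simp
  have \<rho>_bb': "bounded_borel (\<lambda>t. indicator D (complex_of_real t))" if "D \<in> sets borel" for D
    by (rule bounded_borel_compose[OF bounded_borel_indicator[OF that] ofreal_meas])
  have \<rho>_bb: "bounded_borel (\<rho> D)" if "D \<in> sets borel" for D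
    unfolding \<rho>_def using \<rho>_bb'[OF that] by (intro bounded_borel_mult bounded_borel_indicator) auto
  define E where "E D = (if D \<in> sets borel then THE G. represents \<nu> (\<rho> D) G else 0)" for D
  have E_eqI: "E D = G" if "D \<in> sets borel" "represents \<nu> (\<rho> D) G" for D G
  proof -
    have "(THE G. represents \<nu> (\<rho> D) G) = G"
      by (rule the_equality) (fact that(2), rule represents_unique[OF _ that(2)])
    then show ?thesis
      unfolding E_def using that(1) by simp
  qed
  have E_rep: "represents \<nu> (\<rho> D) (E D)" if D: "D \<in> sets borel" for D
  proof -
    obtain G where "represents \<nu> (\<rho> D) G"
      using mult1[OF \<rho>_bb'[OF D]] by (auto simp: multipliers_def \<rho>_def[abs_def])
    then show ?thesis
      using E_eqI[OF D] by simp
  qed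
  have E_form: "cinner (E D x) x = (LINT t|\<nu> x. \<rho> D t)" if "D \<in> sets borel" for D x
    by (rule representsD(2)[OF E_rep[OF that]])
  have \<rho>_S2: "(\<rho> D, E D) \<in> S2" if "D \<in> sets borel" for D
  proof -
    have "\<rho> D t = indicator {0..1} t * \<rho> D t" for t
      by (simp add: \<rho>_def indicator_def)
    then show ?thesis
      unfolding S2_def using that \<rho>_bb E_rep by blast
  qed
  have pvm: "projection_valued_measure M E"
  proof (rule projection_valued_measureI[OF M])
    fix D :: "complex set" and x assume D: "D \<in> sets borel"
    show "clinear_op (E D)"
      by (rule representsD[OF E_rep[OF D]])
    have "of_real -` D \<inter> {0..1} \<in> sets (borel :: real measure)"
      using measurable_sets[OF ofreal_meas D] by auto
    moreover have "\<rho> D = indicator (of_real -` D \<inter> {0..1})"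
      by (auto simp: \<rho>_def indicator_def)
    ultimately have "cinner (E D x) x = of_real (measure (\<nu> x) (of_real -` D \<inter> {0..1}))"
      by (simp add: E_form[OF D] LINT_indicator_complex[OF finite sets])
    then show "cinner (E D x) x \<in> \<real>" by simp
  next
    fix D D' :: "complex set" assume D: "D \<in> sets borel" "D' \<in> sets borel"
    have "represents \<nu> (\<lambda>t. \<rho> D t * \<rho> D' t) (E D o\<^sub>L E D')"
      by (rule multipliersD(1)[of _ S2, OF mult2[OF \<rho>_bb'[OF D(2)], folded \<rho>_def] E_rep[OF D(2)] \<rho>_S2[OF D(1)]])
    moreover have "(\<lambda>t. \<rho> D t * \<rho> D' t) = \<rho> (D \<inter> D')"
      by (auto simp: \<rho>_def indicator_def)
    ultimately show "E (D \<inter> D') = E D o\<^sub>L E D'"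
      using D by (intro E_eqI) auto
  next
    have "\<rho> UNIV = ?mono 0" by (auto simp: \<rho>_def indicator_def)
    then show "E UNIV = ?P"
      using mono_rep[of 0] by (intro E_eqI) auto
  next
    fix D D' :: "complex set" assume D: "D \<in> sets borel" "D' \<in> sets borel" "D \<inter> D' = {}"
    have "\<rho> (D \<union> D') = (\<lambda>t. 1 * \<rho> D t + 1 * \<rho> D' t)"
      using D(3) by (intro ext) (auto simp: \<rho>_def indicator_def)
    moreover have "scaleC_op 1 (E D) + scaleC_op 1 (E D') = E D + E D'"
      by (intro blinfun_eqI) (simp add: blinfun.add_left)
    ultimately show "E (D \<union> D') = E D + E D'"
      using represents_lin[OF E_rep[OF D(1)] E_rep[OF D(2)] \<rho>_bb[OF D(1)] \<rho>_bb[OF D(2)], of 1 1] D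
      by (intro E_eqI) auto
  next
    fix F :: "nat \<Rightarrow> complex set" and x
    assume F: "range F \<subseteq> sets borel" "decseq F" "(\<Inter>n. F n) = {}"
    have Fn: "F n \<in> sets borel" for n using F by auto
    have "(\<lambda>n. LINT t|\<nu> x. \<rho> (F n) t) \<longlonglongrightarrow> (LINT t|\<nu> x. 0)"
    proof (rule LINT_bounded_lim[OF finite sets \<rho>_bb[OF Fn], where C = 1])
      show "cmod (\<rho> (F n) t) \<le> 1" for n t by (auto simp: \<rho>_def indicator_def)
      fix t
      have "(\<lambda>n. indicator (F n) (complex_of_real t) :: complex) \<longlonglongrightarrow> indicator (\<Inter>n. F n) (complex_of_real t)"
        by (rule LIMSEQ_indicator_decseq[OF F(2)])
      from tendsto_mult_left[OF this, of "indicator {0..1} t"] show "(\<lambda>n. \<rho> (F n) t) \<longlonglongrightarrow> 0"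
        by (simp add: \<rho>_def F(3))
    qed
    then show "(\<lambda>n. cinner (E (F n) x) x) \<longlonglongrightarrow> 0"
      by (simp add: E_form[OF Fn])
  qed (simp add: E_def)
  interpret E: pvm M E
    by unfold_locales (rule M pvm)+
  have transfer: "(LINT z|scalar_measure E x. g z) = (LINT t|\<nu> x. indicator {0..1} t * g (complex_of_real t))"
    if g: "bounded_borel g" for g x
  proof -
    let ?G = "{g. bounded_borel g \<and> (LINT z|scalar_measure E x. 1 * g z)
      = (LINT t|\<nu> x. indicator {0..1} t * g (complex_of_real t))}"
    have "g \<in> ?G"
    proof (rule bounded_closed_from_indicators[OF _ _ g])
      show "bounded_closed ?G"
        by (rule bounded_closed_LINT_eq[OF E.finite E.sets finite sets])
          (auto intro: bounded_borel_indicator)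
      fix D :: "complex set" assume D: "D \<in> sets borel"
      have "(LINT z|scalar_measure E x. indicator D z) = cinner (E D x) x"
        using representsD(2)[OF E.represents_indicator[OF D]] by simp
      then show "indicator D \<in> ?G"
        using D by (simp add: bounded_borel_indicator E_form \<rho>_def)
    qed
    then show ?thesis by simp
  qed
  let ?K = "complex_of_real ` {0..1}"
  have K: "?K \<in> sets borel"
    by (intro borel_compact compact_continuous_image continuous_intros) auto
  have "\<rho> ?K = ?mono 0" by (auto simp: \<rho>_def indicator_def)
  then have "E ?K = ?P"
    using mono_rep[of 0] K by (intro E_eqI) auto
  moreover have "represents (scalar_measure E) (\<lambda>z. indicator ?K z * z) T"
  proof -
    have bb: "bounded_borel (\<lambda>z. indicator ?K z * z)"
      using K by (intro bounded_borelI[of _ 1]) (auto simp: indicator_def)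
    have "(\<lambda>t. indicator {0..1} t * (indicator ?K (complex_of_real t) * complex_of_real t)) = ?mono 1"
      by (auto simp: indicator_def)
    moreover have "?Q 1 = T"
      using T(1) by (simp add: op_power_Suc op_on_iff[OF M])
    ultimately show ?thesis
      using mono_rep[of 1] by (simp add: represents_def transfer[OF bb])
  qed
  ultimately show ?thesis
    using pvm by blast
qed

section \<open>The spectrum as the support of the spectral measure\<close>

text \<open>A candidate for the spectral measure, known only to live on some compact set
  \<open>L\<close> that keeps the identity function bounded. The definition requires the spectrum in
  place of \<open>L\<close>, so the spectrum is identified with the support of
  \<open>E\<close>.\<close>

locale spectral_pvm = pvm M E for M :: "'h::chilbert_space set" and E +
  fixes N :: "'h op" and L :: "complex set"
  assumes L: "compact L" and E_L: "E L = proj M"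
    and represents_N: "represents \<nu> (\<lambda>z. indicator L z * z) N"
begin

lemma L_borel [measurable]: "L \<in> sets borel"
  by (rule borel_compact[OF L])

lemma bb_L:
  assumes g: "continuous_on UNIV g"
  shows "bounded_borel (\<lambda>z. indicator L z * g z)"
proof -
  obtain B where B: "\<And>z. z \<in> L \<Longrightarrow> cmod (g z) \<le> B"
    using compact_imp_bounded[OF compact_continuous_image[OF continuous_on_subset[OF g] L]]
    by (auto simp: bounded_iff)
  have [measurable]: "g \<in> borel_measurable borel"
    using g by (rule borel_measurable_continuous_onI)
  have "cmod (indicator L z * g z) \<le> max 0 B" for z
    using B[of z] by (auto simp: indicator_def)
  then show ?thesis
    by (intro bounded_borelI[of _ "max 0 B"]) auto
qed

lemma \<Phi>_N: "\<Phi> (\<lambda>z. indicator L z * z) = N"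
  by (rule \<Phi>_eqI[OF represents_N])

lemma \<Phi>_resolvent: "\<Phi> (\<lambda>z. indicator L z * (z0 - z)) = scaleC_op z0 (proj M) - N"
proof -
  have "\<Phi> (\<lambda>z. indicator L z * (z0 - z)) = \<Phi> (\<lambda>z. z0 * indicator L z - indicator L z * z)"
    by (simp add: algebra_simps)
  also have "\<dots> = \<Phi> (\<lambda>z. z0 * indicator L z) - N"
    using bb_L[OF continuous_on_id] by (simp add: \<Phi>_diff bounded_borel_mult bounded_borel_indicator \<Phi>_N)
  finally show ?thesis
    by (simp add: \<Phi>_scale bounded_borel_indicator \<Phi>_indicator E_L)
qed

lemma E_subset_zero:
  assumes "D \<in> sets borel" "D' \<in> sets borel" "E D = 0" "D' \<subseteq> D"
  shows "E D' = 0"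
proof -
  have "D \<inter> D' = D'" using assms by auto
  then show ?thesis
    using E_props(5)[OF assms(1,2)] assms(3) by (simp add: blinfun_eqI)
qed

lemma E_Compl: "D \<in> sets borel \<Longrightarrow> E (- D) = proj M - E D"
proof -
  assume D: "D \<in> sets borel"
  have "indicator (- D) = (\<lambda>z. 1 - indicator D z :: complex)"
    by (auto simp: indicator_def)
  then show ?thesis
    using \<Phi>_indicator[of "- D"] \<Phi>_indicator[OF D] D by (simp add: \<Phi>_diff bounded_borel_indicator \<Phi>_one)
qed

text \<open>If \<open>E\<close> vanishes on a ball, then \<open>1 / (z0 - z)\<close> is bounded off
  the ball and integrates to an inverse. Conversely, on the range of
  \<open>E (ball z0 \<delta>)\<close> the operator \<open>z0 - N\<close> is so small that no bounded
  inverse is possible unless this range is zero.\<close>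

lemma spectrum_iff_support: "z0 \<in> spectrum_on M N \<longleftrightarrow> (\<forall>\<delta>>0. E (ball z0 \<delta>) \<noteq> 0)"
proof
  assume spec: "z0 \<in> spectrum_on M N"
  show "\<forall>\<delta>>0. E (ball z0 \<delta>) \<noteq> 0"
  proof (intro allI impI notI)
    fix \<delta> :: real assume \<delta>: "0 < \<delta>" and zero: "E (ball z0 \<delta>) = 0"
    define D where "D = L - ball z0 \<delta>"
    have D [measurable]: "D \<in> sets borel" by (simp add: D_def)
    have "E D = proj M"
      using E_props(5)[of L "- ball z0 \<delta>"] E_Compl[of "ball z0 \<delta>"] zero
      by (simp add: D_def Diff_eq E_L proj_idem[OF M])
    define g where "g z = indicator D z / (z0 - z)" for z
    have g: "bounded_borel g"
    proof (rule bounded_borelI)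
      show "g \<in> borel_measurable borel"
        unfolding g_def by measurable
      show "cmod (g z) \<le> 1 / \<delta>" for z
      proof (cases "z \<in> D")
        case True
        then have *: "\<delta> \<le> cmod (z0 - z)"
          by (simp add: D_def dist_norm)
        have "cmod (g z) = 1 / cmod (z0 - z)"
          using True by (simp add: g_def norm_divide)
        also have "\<dots> \<le> 1 / \<delta>"
          using * \<delta> by (intro divide_left_mono mult_pos_pos) auto
        finally show ?thesis .
      qed (use \<delta> in \<open>simp add: g_def\<close>)
    qed
    let ?h = "\<lambda>z. indicator L z * (z0 - z)"
    have h: "bounded_borel ?h" by (intro bb_L continuous_intros)
    have "(\<lambda>z. ?h z * g z) = indicator D" "(\<lambda>z. g z * ?h z) = indicator D"
      using \<delta> by (auto simp: g_def D_def indicator_def)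
    then have "is_inverse_on M (scaleC_op z0 (proj M) - N) (\<Phi> g)"
      using \<Phi>_mult[OF h g] \<Phi>_mult[OF g h] \<Phi>_op_on[OF g] \<open>E D = proj M\<close>
      by (simp add: is_inverse_on_def \<Phi>_resolvent \<Phi>_indicator)
    then show False
      using spec by (auto simp: spectrum_on_def)
  qed
next
  assume supp: "\<forall>\<delta>>0. E (ball z0 \<delta>) \<noteq> 0"
  show "z0 \<in> spectrum_on M N"
  proof (rule ccontr)
    assume "z0 \<notin> spectrum_on M N"
    then obtain T where T: "is_inverse_on M (scaleC_op z0 (proj M) - N) T"
      by (auto simp: spectrum_on_def)
    \<comment> \<open>Chosen to give \<open>2 * \<delta> * norm T < 1\<close>; the 2 comes from the
      norm bound \<open>\<Phi>_norm_le\<close>.\<close>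
    define \<delta> where "\<delta> = 1 / (2 * norm T + 1)"
    have \<delta>: "0 < \<delta>" "2 * \<delta> * norm T < 1"
      by (auto simp: \<delta>_def field_simps add_pos_nonneg add_nonneg_pos)
    define Q where "Q = E (ball z0 \<delta>)"
    let ?h = "\<lambda>z. indicator L z * (z0 - z)"
    have h: "bounded_borel ?h" by (intro bb_L continuous_intros)
    have Q_on: "op_on M Q" and QQ: "Q o\<^sub>L Q = Q"
      using E_props(1)[of "ball z0 \<delta>"] E_props(5)[of "ball z0 \<delta>" "ball z0 \<delta>"] by (auto simp: Q_def)
    have "Q x = 0" for x
    proof (rule ccontr)
      assume ne: "Q x \<noteq> 0"
      have Qx: "Q (Q x) = Q x"
        using QQ by (metis blinfun_apply_blinfun_compose)
      have "Q x = T ((scaleC_op z0 (proj M) - N) (Q x))"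
        using T proj_fix[OF M op_onD(2)[OF Q_on]] unfolding is_inverse_on_def
        by (metis blinfun_apply_blinfun_compose)
      also have "(scaleC_op z0 (proj M) - N) (Q x) = \<Phi> (\<lambda>z. ?h z * indicator (ball z0 \<delta>) z) (Q x)"
        using \<Phi>_mult[OF h, of "indicator (ball z0 \<delta>)"] Qx
        by (simp add: bounded_borel_indicator \<Phi>_indicator \<Phi>_resolvent Q_def)
      finally have "norm (Q x) \<le> norm T * norm (\<Phi> (\<lambda>z. ?h z * indicator (ball z0 \<delta>) z) (Q x))"
        by (metis norm_blinfun)
      also have "\<dots> \<le> norm T * (2 * \<delta> * norm (Q x))"
      proof (intro mult_left_mono \<Phi>_norm_le(1))
        show "bounded_borel (\<lambda>z. ?h z * indicator (ball z0 \<delta>) z)"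
          by (intro bounded_borel_mult h bounded_borel_indicator) auto
        show "cmod (?h z * indicator (ball z0 \<delta>) z) \<le> \<delta>" for z
          using \<delta> by (auto simp: indicator_def dist_norm)
      qed auto
      finally have "norm (Q x) \<le> (2 * \<delta> * norm T) * norm (Q x)"
        by (simp add: ac_simps)
      then show False
        using \<delta> ne by (simp add: mult_le_cancel_right1)
    qed
    then have "Q = 0" by (intro blinfun_eqI) simp
    then show False using supp \<delta> by (simp add: Q_def)
  qed
qed

lemma spectrum_closed: "closed (spectrum_on M N)"
proof -
  have "open (- spectrum_on M N)"
    unfolding open_contains_ball
  proof
    fix z0 assume "z0 \<in> - spectrum_on M N"
    then obtain \<delta> where \<delta>: "0 < \<delta>" "E (ball z0 \<delta>) = 0"
      by (auto simp: spectrum_iff_support)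
    have "z \<in> - spectrum_on M N" if z: "z \<in> ball z0 \<delta>" for z
    proof -
      obtain e where "0 < e" "ball z e \<subseteq> ball z0 \<delta>"
        using openE[OF open_ball z] by metis
      then show ?thesis
        using E_subset_zero[of "ball z0 \<delta>" "ball z e"] \<delta> by (auto simp: spectrum_iff_support)
    qed
    then show "\<exists>e>0. ball z0 e \<subseteq> - spectrum_on M N"
      using \<delta> by blast
  qed
  then show ?thesis by (simp add: closed_def)
qed

lemma spectrum_borel [measurable]: "spectrum_on M N \<in> sets borel"
  using spectrum_closed by simp

lemma spectrum_subset: "spectrum_on M N \<subseteq> L"
proof (rule ccontr)
  assume "\<not> spectrum_on M N \<subseteq> L"
  then obtain z where z: "z \<in> spectrum_on M N" "z \<in> - L" by blast
  have "open (- L)"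
    using compact_imp_closed[OF L] by (rule open_Compl)
  with z(2) obtain e where e: "0 < e" "ball z e \<subseteq> - L"
    by (meson openE)
  have "E (- L) = 0"
    by (simp add: E_Compl E_L)
  then have "E (ball z e) = 0"
    using E_subset_zero[of "- L" "ball z e"] e by simp
  then show False
    using z e by (auto simp: spectrum_iff_support)
qed

text \<open>The complement of the spectrum is covered by balls on which \<open>E\<close> vanishes.
  By Lindelof countably many of them suffice, so the complement is a null set for every scalar
  measure.\<close>

lemma E_spectrum: "E (spectrum_on M N) = proj M"
proof -
  have "\<forall>z\<in>- spectrum_on M N. \<exists>\<delta>>0. E (ball z \<delta>) = 0"
    by (auto simp: spectrum_iff_support)
  then obtain \<delta> where \<delta>: "\<And>z. z \<in> - spectrum_on M N \<Longrightarrow> 0 < \<delta> z \<and> E (ball z (\<delta> z)) = 0"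
    by metis
  define B where "B = (\<lambda>z. ball z (\<delta> z)) ` (- spectrum_on M N)"
  have "- spectrum_on M N \<subseteq> \<Union> B"
    using \<delta> by (force simp: B_def)
  obtain B' where B': "B' \<subseteq> B" "countable B'" "\<Union> B' = \<Union> B"
    using Lindelof[of B] by (auto simp: B_def)
  have "E (- spectrum_on M N) = 0"
  proof (rule blinfun_eqI)
    fix x
    have "emeasure (\<nu> x) D = 0" "D \<in> sets borel" if "D \<in> B'" for D
      using that B'(1) \<delta> by (auto simp: B_def emeasure_scalar_measure)
    then have "\<Union> B' \<in> null_sets (\<nu> x)"
      using null_sets_UN'[OF B'(2), of "\<lambda>D. D" "\<nu> x"] by (auto simp: null_sets_def sets)
    then have "- spectrum_on M N \<in> null_sets (\<nu> x)"
      using null_sets_subset[of "\<Union> B" "\<nu> x" "- spectrum_on M N"] \<open>- spectrum_on M N \<subseteq> \<Union> B\<close>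
      unfolding B'(3) by (simp add: sets)
    then have "emeasure (\<nu> x) (- spectrum_on M N) = 0"
      by auto
    then show "E (- spectrum_on M N) x = blinfun_apply 0 x"
      by (simp add: emeasure_scalar_measure)
  qed
  then show ?thesis
    using E_Compl[of "- spectrum_on M N"] by simp
qed

lemma is_spectral_measure: "is_spectral_measure M N E"
proof -
  have "cinner (N x) x = (LINT z:spectrum_on M N|\<nu> x. z)" for x
  proof -
    have "(LINT z:spectrum_on M N|\<nu> x. z)
        = (LINT z|\<nu> x. indicator (spectrum_on M N) z * (indicator L z * z))"
      unfolding set_lebesgue_integral_def
      using spectrum_subset by (intro Bochner_Integration.integral_cong) (auto simp: indicator_def)
    also have "\<dots> = cinner (\<Phi> (\<lambda>z. indicator (spectrum_on M N) z * (indicator L z * z)) x) x"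
      using bb_L[OF continuous_on_id] by (simp add: \<Phi>_form bounded_borel_mult bounded_borel_indicator)
    also have "\<Phi> (\<lambda>z. indicator (spectrum_on M N) z * (indicator L z * z)) = proj M o\<^sub>L N"
      using bb_L[OF continuous_on_id]
      by (simp add: \<Phi>_mult[of "indicator _"] bounded_borel_indicator \<Phi>_indicator E_spectrum \<Phi>_N)
    also have "proj M o\<^sub>L N = N"
      using \<Phi>_op_on[OF bb_L[OF continuous_on_id]] by (simp add: \<Phi>_N op_on_iff[OF M])
    finally show ?thesis by simp
  qed
  then show ?thesis
    using pvm E_spectrum by (simp add: is_spectral_measure_def)
qed

end

section \<open>Borel functional calculus on a segment\<close>

text \<open>Both the selfadjoint operators and the normal operators \<open>R + i S\<close> with \<open>R + S = I\<close>
  are of the form \<open>c + d T\<close> with a positive contraction \<open>T\<close>.\<close>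

locale segment_operator =
  fixes M :: "'h::chilbert_space set" and c d :: complex and T :: "'h op"
  assumes M: "csubspace M" and T: "op_on M T" "positive_op T"
    and T_le: "\<And>x. inner (T x) x \<le> inner x x" and d: "d \<noteq> 0"
begin

definition N :: "'h op" where "N = scaleC_op c (proj M) + scaleC_op d T"

definition L :: "complex set" where "L = (\<lambda>t. c + d * complex_of_real t) ` {0..1}"

text \<open>The coordinate along the segment \<open>L\<close>, extended to a real function on the
  whole plane so that it is measurable everywhere.\<close>

definition \<tau> :: "complex \<Rightarrow> real" where "\<tau> z = Re ((z - c) / d)"

lemma \<tau>_L:
  assumes "z \<in> L"
  shows "c + d * complex_of_real (\<tau> z) = z" "complex_of_real (\<tau> z) = (z - c) / d" "\<tau> z \<in> {0..1}"
proof -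
  obtain t where "t \<in> {0..1}" "z = c + d * complex_of_real t"
    using assms by (auto simp: L_def)
  then show "c + d * complex_of_real (\<tau> z) = z" "complex_of_real (\<tau> z) = (z - c) / d" "\<tau> z \<in> {0..1}"
    using d by (auto simp: \<tau>_def)
qed

lemma \<tau>_measurable [measurable]: "\<tau> \<in> borel_measurable borel"
  unfolding \<tau>_def using d by (intro borel_measurable_continuous_onI continuous_intros) auto

lemma compact_L: "compact L"
  unfolding L_def by (intro compact_continuous_image continuous_intros) auto

text \<open>The image of the spectral measure of \<open>T\<close> under the affine map
  \<open>\<gamma>\<close> is a spectral measure of \<open>N = \<gamma>(T)\<close>.\<close>

lemma ex_spectral_pvm: "\<exists>E. spectral_pvm M E N L"
proof -
  let ?K = "complex_of_real ` {0..1}"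
  obtain E0 where pvm0: "projection_valued_measure M E0" and K0: "E0 ?K = proj M"
    and rep0: "represents (scalar_measure E0) (\<lambda>z. indicator ?K z * z) T"
    using spectral_theorem_contraction[OF M T T_le] by blast
  interpret E0: pvm M E0 by (unfold_locales) (rule M pvm0)+
  have K [measurable]: "?K \<in> sets borel"
    by (intro borel_compact compact_continuous_image continuous_intros) auto
  define \<gamma> where "\<gamma> z = c + d * z" for z
  have \<gamma> [measurable]: "\<gamma> \<in> borel_measurable borel"
    unfolding \<gamma>_def by measurable
  have vimage: "\<gamma> -` D \<in> sets borel" if "D \<in> sets borel" for D
    using measurable_sets[OF \<gamma> that] by simp
  define E where "E D = (if D \<in> sets borel then E0 (\<gamma> -` D) else 0)" for D
  have pvm: "projection_valued_measure M E"
    unfolding projection_valued_measure_def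
  proof (intro conjI ballI allI impI)
    fix D :: "complex set" assume D: "D \<in> sets borel"
    show "op_on M (E D)" "adj (E D) = E D"
      using D E0.E_props[OF vimage[OF D]] by (simp_all add: E_def)
    fix D' :: "complex set" assume D': "D' \<in> sets borel"
    show "E (D \<inter> D') = E D o\<^sub>L E D'"
      using D D' E0.E_props(5)[OF vimage[OF D] vimage[OF D']] by (simp add: E_def vimage_Int)
  next
    fix F :: "nat \<Rightarrow> complex set" and x assume F: "range F \<subseteq> sets borel" "disjoint_family F"
    have "disjoint_family (\<lambda>n. \<gamma> -` F n)"
      using F(2) by (auto simp: disjoint_family_on_def)
    moreover have Fn: "F n \<in> sets borel" for n using F by auto
    moreover have "(\<Union>n. F n) \<in> sets borel" using Fn by auto
    ultimately show "(\<lambda>n. E (F n) x) sums E (\<Union>n. F n) x"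
      using E0.E_sums[of "\<lambda>n. \<gamma> -` F n" x] vimage by (auto simp: E_def vimage_UN)
  qed (simp_all add: E_def E0.E_UNIV)
  interpret E: pvm M E by (unfold_locales) (rule M pvm)+
  have transfer: "(LINT z|scalar_measure E x. g z) = (LINT z|scalar_measure E0 x. g (\<gamma> z))"
    if g: "bounded_borel g" for g x
  proof -
    let ?G = "{g. bounded_borel g \<and> (LINT z|scalar_measure E x. 1 * g z)
      = (LINT z|scalar_measure E0 x. 1 * g (\<gamma> z))}"
    have "g \<in> ?G"
    proof (rule bounded_closed_from_indicators[OF _ _ g])
      show "bounded_closed ?G"
        by (rule bounded_closed_LINT_eq[OF E.finite E.sets E0.finite E0.sets]) auto
      fix D :: "complex set" assume D: "D \<in> sets borel"
      have "(LINT z|scalar_measure E x. indicator D z) = cinner (E D x) x"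
        using representsD(2)[OF E.represents_indicator[OF D]] by simp
      also have "\<dots> = (LINT z|scalar_measure E0 x. indicator (\<gamma> -` D) z)"
        using representsD(2)[OF E0.represents_indicator[OF vimage[OF D]]] D by (simp add: E_def)
      also have "\<dots> = (LINT z|scalar_measure E0 x. indicator D (\<gamma> z))"
        by (simp add: indicator_def)
      finally show "indicator D \<in> ?G"
        using D by (simp add: bounded_borel_indicator)
    qed
    then show ?thesis by simp
  qed
  have L_borel [measurable]: "L \<in> sets borel"
    using compact_L by (rule borel_compact)
  have \<gamma>_K: "\<gamma> z \<in> L" if "z \<in> ?K" for z
    using that by (auto simp: \<gamma>_def L_def)
  have E_L: "E L = proj M"
  proof -
    have "\<gamma> -` L \<inter> ?K = ?K" using \<gamma>_K by auto
    then have "E0 ?K = E0 (\<gamma> -` L) o\<^sub>L E0 ?K"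
      using E0.E_props(5)[OF vimage[OF L_borel] K] by simp
    then show ?thesis
      using E0.E_props(1)[OF vimage[OF L_borel]] by (simp add: K0 E_def op_on_iff[OF M])
  qed
  have bb: "bounded_borel (\<lambda>z. indicator L z * z)"
  proof -
    obtain B where "\<And>z. z \<in> L \<Longrightarrow> cmod z \<le> B"
      using compact_imp_bounded[OF compact_L] by (auto simp: bounded_iff)
    then show ?thesis
      by (intro bounded_borelI[of _ "max 0 B"]) (auto simp: indicator_def le_max_iff_disj)
  qed
  have bbK: "bounded_borel (\<lambda>z. indicator ?K z * z)"
    using K by (intro bounded_borelI[of _ 1]) (auto simp: indicator_def)
  have "represents (scalar_measure E) (\<lambda>z. indicator L z * z) N"
  proof -
    let ?g = "\<lambda>z. indicator L (\<gamma> z) * \<gamma> z"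
    have g: "bounded_borel ?g"
      using bounded_borel_compose[OF bb \<gamma>] .
    \<comment> \<open>\<open>E0 ?K\<close> is the unit, so the integrand may be cut to
      \<open>?K\<close>; there \<open>\<gamma>\<close> takes values in \<open>L\<close> and the
      integrand is affine in \<open>z\<close>.\<close>
    have "E0.\<Phi> ?g = E0 ?K o\<^sub>L E0.\<Phi> ?g"
      using E0.\<Phi>_op_on[OF g] by (simp add: K0 op_on_iff[OF M])
    also have "\<dots> = E0.\<Phi> (\<lambda>z. indicator ?K z * ?g z)"
      using g K by (simp add: E0.\<Phi>_mult[of "indicator _"] bounded_borel_indicator E0.\<Phi>_indicator)
    also have "(\<lambda>z. indicator ?K z * ?g z) = (\<lambda>z. c * indicator ?K z + d * (indicator ?K z * z))"
      using \<gamma>_K by (auto simp: indicator_def \<gamma>_def)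
    also have "E0.\<Phi> \<dots> = N"
      using K bbK E0.\<Phi>_eqI[OF rep0] by (simp add: E0.\<Phi>_lin bounded_borel_indicator E0.\<Phi>_indicator K0 N_def)
    finally have "represents (scalar_measure E0) ?g N"
      using E0.\<Phi>_represents[OF g] by simp
    then show ?thesis
      by (simp add: represents_def transfer[OF bb])
  qed
  then have "spectral_pvm M E N L"
    using compact_L E_L by unfold_locales auto
  then show ?thesis by blast
qed

lemma spectrum_facts:
  "closed (spectrum_on M N)" "spectrum_on M N \<in> sets borel" "spectrum_on M N \<subseteq> L"
proof -
  obtain E where "spectral_pvm M E N L" using ex_spectral_pvm by blast
  then interpret spectral_pvm M E N L .
  show "closed (spectrum_on M N)" "spectrum_on M N \<in> sets borel" "spectrum_on M N \<subseteq> L"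
    by (rule spectrum_closed spectrum_borel spectrum_subset)+
qed

abbreviation \<sigma> :: "complex set" where "\<sigma> \<equiv> spectrum_on M N"

lemma bb_spectrum:
  assumes "continuous_on UNIV g"
  shows "bounded_borel (\<lambda>z. indicator \<sigma> z * g z)"
proof -
  obtain B where B: "\<And>z. z \<in> L \<Longrightarrow> cmod (g z) \<le> B"
    using compact_imp_bounded[OF compact_continuous_image[OF continuous_on_subset[OF assms] compact_L]]
    by (auto simp: bounded_iff)
  have [measurable]: "g \<in> borel_measurable borel" "\<sigma> \<in> sets borel"
    using assms spectrum_facts by (auto intro: borel_measurable_continuous_onI)
  have "cmod (indicator \<sigma> z * g z) \<le> max 0 B" for z
    using B[of z] spectrum_facts(3) by (auto simp: indicator_def)
  then show ?thesis
    by (intro bounded_borelI[of _ "max 0 B"]) auto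
qed

lemma \<tau>_continuous: "continuous_on UNIV (\<lambda>z. complex_of_real (\<tau> z ^ n))"
  unfolding \<tau>_def using d by (intro continuous_intros) auto

text \<open>Stated for an arbitrary spectral measure, because uniqueness is to follow from it. The
  definition provides the integral of \<open>z\<close> alone; on \<open>\<sigma>\<close> the
  coordinate \<open>\<tau>\<close> is affine in \<open>z\<close>, and multiplicativity yields its
  powers.\<close>

lemma spectral_measure_moments:
  assumes E: "is_spectral_measure M N E"
  shows "pvm M E"
    "represents (scalar_measure E) (\<lambda>z. indicator \<sigma> z * complex_of_real (\<tau> z ^ n)) (op_power M T n)"
    "represents (scalar_measure E) (\<lambda>z. indicator \<sigma> z * z) N"
proof -
  show "pvm M E"
    using E M by unfold_locales (auto simp: is_spectral_measure_def)
  then interpret pvm M E .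
  have \<sigma>: "\<sigma> \<in> sets borel" and E\<sigma>: "E \<sigma> = proj M"
    using spectrum_facts E by (auto simp: is_spectral_measure_def)
  have N_on: "op_on M N"
  proof -
    have "proj M (T x) = T x" "T (proj M x) = T x" for x
      using T(1) unfolding op_on_iff[OF M] by (metis blinfun_apply_blinfun_compose)+
    then show ?thesis
      using op_onD(1)[OF T(1)] by (simp add: op_on_iff[OF M] N_def proj_props[OF M])
        (auto intro!: blinfun_eqI simp: blinfun.add_left blinfun.add_right
          clinear_opD[OF proj_props(3)[OF M]] proj_fix[OF M] proj_props(1)[OF M])
  qed
  show repN: "represents (scalar_measure E) (\<lambda>z. indicator \<sigma> z * z) N"
  proof -
    have "(LINT z:\<sigma>|scalar_measure E x. z) = (LINT z|scalar_measure E x. indicator \<sigma> z * z)" for x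
      unfolding set_lebesgue_integral_def by (intro Bochner_Integration.integral_cong) (auto simp: indicator_def)
    then show ?thesis
      using E op_onD(1)[OF N_on] by (simp add: represents_def is_spectral_measure_def)
  qed
  have bb: "bounded_borel (\<lambda>z. indicator \<sigma> z * z)" "bounded_borel (\<lambda>z. indicator \<sigma> z * complex_of_real (\<tau> z ^ n))" for n
    by (intro bb_spectrum \<tau>_continuous continuous_on_id)+
  have bb\<sigma>: "bounded_borel (indicator \<sigma>)"
    using \<sigma> by (rule bounded_borel_indicator)
  have \<tau>: "indicator \<sigma> z * complex_of_real (\<tau> z) = (1/d) * (indicator \<sigma> z * z) + (- c/d) * indicator \<sigma> z" for z
    using \<tau>_L(2)[of z] spectrum_facts(3) d by (auto simp: indicator_def field_simps)
  have \<Phi>\<tau>: "\<Phi> (\<lambda>z. indicator \<sigma> z * complex_of_real (\<tau> z)) = T"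
  proof -
    have "\<Phi> (\<lambda>z. indicator \<sigma> z * complex_of_real (\<tau> z)) = scaleC_op (1/d) N + scaleC_op (- c/d) (proj M)"
      using \<Phi>_eqI[OF repN] by (simp only: \<tau> \<Phi>_lin[OF bb(1) bb\<sigma>] \<Phi>_indicator[OF \<sigma>] E\<sigma>)
    also have "\<dots> = T"
      using d by (intro blinfun_eqI)
        (simp add: N_def blinfun.add_left scaleC_add_right scaleC_scaleC flip: scaleC_add_left)
    finally show ?thesis .
  qed
  have "\<Phi> (\<lambda>z. indicator \<sigma> z * complex_of_real (\<tau> z ^ n)) = op_power M T n"
  proof (induction n)
    case 0
    then show ?case by (simp add: \<Phi>_indicator[OF \<sigma>] E\<sigma>)
  next
    case (Suc n)
    have "(\<lambda>z. indicator \<sigma> z * complex_of_real (\<tau> z ^ Suc n))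
        = (\<lambda>z. (indicator \<sigma> z * complex_of_real (\<tau> z)) * (indicator \<sigma> z * complex_of_real (\<tau> z ^ n)))"
      by (auto simp: indicator_def)
    then show ?case
      using \<Phi>_mult[OF bb(2)[of 1] bb(2)[of n]] Suc \<Phi>\<tau> by (simp add: op_power_Suc)
  qed
  then show "represents (scalar_measure E) (\<lambda>z. indicator \<sigma> z * complex_of_real (\<tau> z ^ n)) (op_power M T n)"
    using \<Phi>_represents[OF bb(2)] by metis
qed

text \<open>Both scalar measures have the moments of \<open>T\<close> in the coordinate
  \<open>\<tau>\<close>, hence agree on subsets of \<open>\<sigma>\<close>; both projection-valued
  measures are concentrated there.\<close>

lemma spectral_measure_unique:
  assumes E: "is_spectral_measure M N E" and E': "is_spectral_measure M N E'"
  shows "E = E'"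
proof (rule ext)
  interpret E: pvm M E by (rule spectral_measure_moments[OF E])
  interpret E': pvm M E' by (rule spectral_measure_moments[OF E'])
  fix D :: "complex set"
  show "E D = E' D"
  proof (cases "D \<in> sets borel")
    case D: True
    have \<sigma>: "\<sigma> \<in> sets borel" by (rule spectrum_facts)
    have E\<sigma>: "E (\<sigma> \<inter> D) = E D" "E' (\<sigma> \<inter> D) = E' D"
      using E.E_props(5)[OF \<sigma> D] E'.E_props(5)[OF \<sigma> D] E.E_props(1)[OF D] E'.E_props(1)[OF D] E E'
      by (simp_all add: is_spectral_measure_def op_on_iff[OF M])
    let ?g = "\<lambda>t. indicator D (c + d * complex_of_real t) :: complex"
    have g: "bounded_borel (\<lambda>t. indicator {0..1} t * ?g t)"
    proof -
      have "(\<lambda>t. c + d * complex_of_real t) \<in> borel_measurable borel"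
        by (intro borel_measurable_continuous_onI continuous_intros)
      from bounded_borel_compose[OF bounded_borel_indicator[OF D] this] show ?thesis
        by (intro bounded_borel_mult bounded_borel_indicator) auto
    qed
    have \<sigma>D: "indicator \<sigma> z * ?g (\<tau> z) = indicator (\<sigma> \<inter> D) z" for z
      using \<tau>_L(1)[of z] spectrum_facts(3) by (auto simp: indicator_def)
    have "(LINT z|scalar_measure E x. indicator \<sigma> z * ?g (\<tau> z))
        = (LINT z|scalar_measure E' x. indicator \<sigma> z * ?g (\<tau> z))" for x
    proof (rule LINT_eq_if_moments_eq[OF E.finite E.sets E'.finite E'.sets _ _ _ _ _ _ _ g])
      show "(LINT z|scalar_measure E x. indicator \<sigma> z * complex_of_real (\<tau> z ^ n))
          = (LINT z|scalar_measure E' x. indicator \<sigma> z * complex_of_real (\<tau> z ^ n))" for n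
        using representsD(2)[OF spectral_measure_moments(2)[OF E]]
          representsD(2)[OF spectral_measure_moments(2)[OF E']] by metis
      show "\<tau> z \<in> {0..1}" if "indicator \<sigma> z \<noteq> (0::complex)" for z
        using \<tau>_L(3)[of z] that spectrum_facts(3) by (auto simp: indicator_def split: if_splits)
      then show "\<tau> z \<in> {0..1}" if "indicator \<sigma> z \<noteq> (0::complex)" for z
        using that .
    qed (use \<sigma> in \<open>auto intro: bounded_borel_indicator\<close>)
    then have "cinner (E (\<sigma> \<inter> D) x) x = cinner (E' (\<sigma> \<inter> D) x) x" for x
      using representsD(2)[OF E.represents_indicator, of "\<sigma> \<inter> D" x]
        representsD(2)[OF E'.represents_indicator, of "\<sigma> \<inter> D" x] \<sigma> D by (simp add: \<sigma>D)
    then show ?thesis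
      using op_eqI[of "E (\<sigma> \<inter> D)" "E' (\<sigma> \<inter> D)"] \<sigma> D E.E_props(3) E'.E_props(3) E\<sigma> by simp
  next
    case False
    then show ?thesis
      using E.pvm E'.pvm by (simp add: projection_valued_measure_def)
  qed
qed

lemma spectral_measure: "is_spectral_measure M N (spectral_measure M N)"
proof -
  obtain E where E: "spectral_pvm M E N L" using ex_spectral_pvm by blast
  have "is_spectral_measure M N E"
    by (rule spectral_pvm.is_spectral_measure[OF E])
  then show ?thesis
    unfolding spectral_measure_def
    using theI[where P = "is_spectral_measure M N"] spectral_measure_unique by blast
qed

abbreviation E :: "complex set \<Rightarrow> 'h op" where "E \<equiv> spectral_measure M N"

sublocale calc: pvm M E
  by (rule spectral_measure_moments[OF spectral_measure])

lemma E_spectrum: "E \<sigma> = proj M"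
  using spectral_measure by (simp add: is_spectral_measure_def)

lemma bb_indicator_spectrum: "bounded_borel (indicator \<sigma>)"
  using spectrum_facts(2) by (rule bounded_borel_indicator)

lemma calc_moments: "(LINT z|scalar_measure E x. indicator \<sigma> z * complex_of_real (\<tau> z ^ n)) = cinner (op_power M T n x) x"
  by (rule representsD(2)[OF spectral_measure_moments(2)[OF spectral_measure], symmetric])

lemma calc_\<tau>: "calc.\<Phi> (\<lambda>z. indicator \<sigma> z * complex_of_real (\<tau> z ^ n)) = op_power M T n"
  by (rule calc.\<Phi>_eqI[OF spectral_measure_moments(2)[OF spectral_measure]])

lemma calc_id: "calc.\<Phi> (\<lambda>z. indicator \<sigma> z * z) = N"
  by (rule calc.\<Phi>_eqI[OF spectral_measure_moments(3)[OF spectral_measure]])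

lemma borel_calc_eq:
  assumes g: "bounded_borel (\<lambda>z. indicator \<sigma> z * g z)"
  shows "borel_calc M N g = calc.\<Phi> (\<lambda>z. indicator \<sigma> z * g z)"
proof -
  have "(LINT z:\<sigma>|scalar_measure E x. g z) = (LINT z|scalar_measure E x. indicator \<sigma> z * g z)" for x
    unfolding set_lebesgue_integral_def by (intro Bochner_Integration.integral_cong) (auto simp: indicator_def)
  then show ?thesis
    unfolding borel_calc_def
    by (intro the_equality) (auto simp: calc.\<Phi>_op_on[OF g] calc.\<Phi>_form[OF g] calc.\<Phi>_clinear[OF g]
        intro!: op_eqI dest: op_onD(1))
qed

text \<open>The means of identifying a functional calculus: a weighted measure and a map into [0, 1]
  with the moments of \<open>T\<close> at \<open>x\<close> compute every integral against the
  spectral measure.\<close>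

lemma LINT_spectral_eq:
  assumes m: "finite_measure m" "sets m = sets borel" and w: "bounded_borel w" "\<rho> \<in> borel_measurable borel"
    and range: "\<And>z. w z \<noteq> 0 \<Longrightarrow> \<rho> z \<in> {0..1}"
    and moments: "\<And>n. (LINT z|m. w z * of_real (\<rho> z ^ n)) = cinner (op_power M T n x) x"
    and g: "bounded_borel (\<lambda>t. indicator {0..1} t * g t)"
  shows "(LINT z|scalar_measure E x. indicator \<sigma> z * g (\<tau> z)) = (LINT z|m. w z * g (\<rho> z))"
proof (rule LINT_eq_if_moments_eq[OF calc.finite calc.sets m bb_indicator_spectrum w(1) \<tau>_measurable w(2) _ range _ g])
  show "\<tau> z \<in> {0..1}" if "indicator \<sigma> z \<noteq> (0::complex)" for z
    using \<tau>_L(3)[of z] that spectrum_facts(3) by (auto simp: indicator_def split: if_splits)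
  show "(LINT z|calc.\<nu> x. indicator \<sigma> z * complex_of_real (\<tau> z ^ n)) = (LINT z|m. w z * of_real (\<rho> z ^ n))" for n
    unfolding calc_moments moments ..
qed

end

section \<open>Positive operators and their square roots\<close>

lemma blinfun_compose_simps:
  "(A + B) o\<^sub>L C = (A o\<^sub>L C) + (B o\<^sub>L C)" "A o\<^sub>L (B + C) = (A o\<^sub>L B) + (A o\<^sub>L C)"
  "(A - B) o\<^sub>L C = (A o\<^sub>L C) - (B o\<^sub>L C)" "A o\<^sub>L (B - C) = (A o\<^sub>L B) - (A o\<^sub>L C)"
  "(r *\<^sub>R A) o\<^sub>L C = r *\<^sub>R (A o\<^sub>L C)" "A o\<^sub>L (r *\<^sub>R C) = r *\<^sub>R (A o\<^sub>L C)"
  "A o\<^sub>L 0 = 0" "0 o\<^sub>L A = 0" "id_blinfun o\<^sub>L A = A" "A o\<^sub>L id_blinfun = A"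
  by (auto intro!: blinfun_eqI simp: blinfun.add_left blinfun.add_right blinfun.diff_left
      blinfun.diff_right blinfun.scaleR_left blinfun.scaleR_right blinfun.zero_right)

lemma positive_op_add: "positive_op A \<Longrightarrow> positive_op B \<Longrightarrow> positive_op (A + B)"
proof (rule positive_opI)
  assume A: "positive_op A" and B: "positive_op B"
  show "clinear_op (A + B)"
    using positive_opD(1)[OF A] positive_opD(1)[OF B] by simp
  show "\<exists>r\<ge>0. cinner ((A + B) x) x = of_real r" for x
    using positive_opD(3,4)[OF A, of x] positive_opD(3,4)[OF B, of x]
    by (intro exI[of _ "inner (A x) x + inner (B x) x"]) (simp add: blinfun.add_left cinner.add_left)
qed

lemma positive_op_scaleR: "positive_op A \<Longrightarrow> 0 \<le> r \<Longrightarrow> positive_op (r *\<^sub>R A)"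
proof (rule positive_opI)
  assume A: "positive_op A" and r: "0 \<le> r"
  show "clinear_op (r *\<^sub>R A)"
    using positive_opD(1)[OF A] by simp
  show "\<exists>s\<ge>0. cinner ((r *\<^sub>R A) x) x = of_real s" for x
    using positive_opD(3,4)[OF A, of x] r
    by (intro exI[of _ "r * inner (A x) x"])
      (simp add: blinfun.scaleR_left cinner.scaleR_left scaleR_conv_of_real del: inner_scaleR_left)
qed

lemma positive_op_id: "positive_op id_blinfun"
  by (rule positive_opI) (auto simp: cinner_eq_norm intro!: exI[of _ "(norm _)\<^sup>2"])

text \<open>A free bound \<open>K\<close> in place of \<open>norm A\<close> allows two operators to
  share one scale, and its strict positivity covers \<open>A = 0\<close>.\<close>

locale positive_operator =
  fixes A :: "'h::chilbert_space op" and K :: real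
  assumes A: "positive_op A" and K: "0 < K" "norm A \<le> K"
begin

lemma segment: "segment_operator UNIV (complex_of_real K) ((1/K) *\<^sub>R A)"
proof
  show "op_on UNIV ((1/K) *\<^sub>R A)"
    using positive_opD(1)[OF A] by (simp add: op_on_UNIV)
  show "positive_op ((1/K) *\<^sub>R A)"
    using A K by (intro positive_op_scaleR) auto
  fix x
  have "inner (A x) x \<le> norm (A x) * norm x"
    by (rule norm_cauchy_schwarz)
  also have "\<dots> \<le> (norm A * norm x) * norm x"
    by (intro mult_right_mono norm_blinfun) auto
  also have "\<dots> \<le> K * inner x x"
    using K(2) by (simp add: power2_norm_eq_inner[symmetric] power2_eq_square mult.assoc mult_right_mono)
  finally show "inner (((1/K) *\<^sub>R A) x) x \<le> inner x x"
    using K(1) by (simp add: blinfun.scaleR_left field_simps)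
qed (use K in auto)

sublocale segment_operator UNIV 0 "complex_of_real K" "(1/K) *\<^sub>R A"
  by (rule segment)

lemma N_eq: "N = A"
  using K(1) unfolding N_def
  by (intro blinfun_eqI) (simp add: blinfun.add_left blinfun.scaleR_left scaleR_scaleC scaleC_scaleC)

lemma \<tau>_eq: "\<tau> z = Re z / K"
  using K(1) by (simp add: \<tau>_def Re_divide_of_real)

lemma spectrum_real:
  assumes "z \<in> \<sigma>"
  shows "complex_of_real (Re z) = z" "0 \<le> Re z" "Re z \<le> K"
proof -
  have "z \<in> L" using assms spectrum_facts(3) by blast
  from \<tau>_L[OF this] show "complex_of_real (Re z) = z" "0 \<le> Re z" "Re z \<le> K"
    using K(1) by (auto simp: \<tau>_eq field_simps)
qed

definition fc :: "(real \<Rightarrow> complex) \<Rightarrow> 'h op" where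
  "fc h = calc.\<Phi> (\<lambda>z. indicator \<sigma> z * h (Re z))"

definition admissible :: "(real \<Rightarrow> complex) \<Rightarrow> bool" where
  "admissible h \<longleftrightarrow> h \<in> borel_measurable borel \<and> (\<exists>B. \<forall>t\<in>{0..K}. cmod (h t) \<le> B)"

lemma admissibleI: "h \<in> borel_measurable borel \<Longrightarrow> (\<And>t. 0 \<le> t \<Longrightarrow> t \<le> K \<Longrightarrow> cmod (h t) \<le> B) \<Longrightarrow> admissible h"
  unfolding admissible_def by (metis atLeastAtMost_iff)

lemma bb_admissible:
  assumes "admissible h"
  shows "bounded_borel (\<lambda>z. indicator \<sigma> z * h (Re z))"
proof -
  obtain B where "\<forall>t\<in>{0..K}. cmod (h t) \<le> B"
    using assms unfolding admissible_def by blast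
  then have B: "t \<in> {0..K} \<Longrightarrow> cmod (h t) \<le> B" for t by blast
  have [measurable]: "h \<in> borel_measurable borel" "\<sigma> \<in> sets borel"
    using assms spectrum_facts by (auto simp: admissible_def)
  have "cmod (indicator \<sigma> z * h (Re z)) \<le> max 0 B" for z
    using B[of "Re z"] spectrum_real[of z] by (auto simp: indicator_def)
  then show ?thesis
    by (intro bounded_borelI[of _ "max 0 B"]) auto
qed

lemma admissible_mult: "admissible f \<Longrightarrow> admissible g \<Longrightarrow> admissible (\<lambda>t. f t * g t)"
proof -
  assume "admissible f" "admissible g"
  then obtain B C where "\<forall>t\<in>{0..K}. cmod (f t) \<le> B" "\<forall>t\<in>{0..K}. cmod (g t) \<le> C"
    and meas: "f \<in> borel_measurable borel" "g \<in> borel_measurable borel"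
    unfolding admissible_def by blast
  then have B: "t \<in> {0..K} \<Longrightarrow> cmod (f t) \<le> B" and C: "t \<in> {0..K} \<Longrightarrow> cmod (g t) \<le> C" for t
    by blast+
  have "0 \<le> B" using order.trans[OF norm_ge_zero B[of 0]] K by simp
  then show ?thesis
    using meas B C by (intro admissibleI[of _ "B * C"]) (auto simp: norm_mult intro!: mult_mono)
qed

lemma admissible_id: "admissible complex_of_real"
  using K by (intro admissibleI[of _ K]) auto

lemma admissible_one: "admissible (\<lambda>_. 1)"
  by (intro admissibleI[of _ 1]) auto

lemma fc_mult:
  assumes "admissible f" "admissible g"
  shows "fc (\<lambda>t. f t * g t) = fc f o\<^sub>L fc g"
proof -
  have "(\<lambda>z. indicator \<sigma> z * (f (Re z) * g (Re z)))
      = (\<lambda>z. (indicator \<sigma> z * f (Re z)) * (indicator \<sigma> z * g (Re z)))"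
    by (auto simp: indicator_def)
  then show ?thesis
    unfolding fc_def by (simp add: calc.\<Phi>_mult[OF bb_admissible[OF assms(1)] bb_admissible[OF assms(2)]])
qed

lemma fc_diff:
  assumes "admissible f" "admissible g"
  shows "fc (\<lambda>t. f t - g t) = fc f - fc g"
  unfolding fc_def using calc.\<Phi>_diff[OF bb_admissible[OF assms(1)] bb_admissible[OF assms(2)]]
  by (simp add: right_diff_distrib)

lemma fc_clinear: "admissible f \<Longrightarrow> clinear_op (fc f)"
  unfolding fc_def by (rule calc.\<Phi>_clinear[OF bb_admissible])

lemma fc_form: "admissible f \<Longrightarrow> cinner (fc f x) x = (LINT z|scalar_measure E x. indicator \<sigma> z * f (Re z))"
  unfolding fc_def by (rule calc.\<Phi>_form[OF bb_admissible])

lemma fc_cong: "(\<And>t. 0 \<le> t \<Longrightarrow> t \<le> K \<Longrightarrow> f t = g t) \<Longrightarrow> fc f = fc g"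
proof -
  assume "\<And>t. 0 \<le> t \<Longrightarrow> t \<le> K \<Longrightarrow> f t = g t"
  then have "(\<lambda>z. indicator \<sigma> z * f (Re z)) = (\<lambda>z. indicator \<sigma> z * g (Re z))"
    using spectrum_real by (auto simp: indicator_def)
  then show ?thesis by (simp add: fc_def)
qed

lemma fc_id: "fc complex_of_real = A"
proof -
  have "(\<lambda>z. indicator \<sigma> z * complex_of_real (Re z)) = (\<lambda>z. indicator \<sigma> z * z)"
    using spectrum_real(1) by (auto simp: indicator_def)
  then show ?thesis
    using calc_id by (simp add: fc_def N_eq)
qed

lemma fc_one: "fc (\<lambda>_. 1) = id_blinfun"
  using calc.\<Phi>_indicator[OF spectrum_facts(2)] by (simp add: fc_def E_spectrum)

lemma fc_form_real:
  assumes h: "admissible (\<lambda>t. complex_of_real (h t))"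
  shows "cinner (fc (\<lambda>t. complex_of_real (h t)) x) x = of_real (LINT z|scalar_measure E x. indicator \<sigma> z * h (Re z))"
    and fc_integrable: "integrable (scalar_measure E x) (\<lambda>z. indicator \<sigma> z * h (Re z))"
proof -
  have eq: "(\<lambda>z. indicator \<sigma> z * complex_of_real (h (Re z))) = (\<lambda>z. complex_of_real (indicator \<sigma> z * h (Re z)))"
    by (auto simp: indicator_def)
  have "integrable (scalar_measure E x) (\<lambda>z. complex_of_real (indicator \<sigma> z * h (Re z)))"
    using integrable_bounded_borel[OF calc.finite calc.sets bb_admissible[OF h]] unfolding eq .
  from integrable_Re[OF this] show int: "integrable (scalar_measure E x) (\<lambda>z. indicator \<sigma> z * h (Re z))"
    by simp
  show "cinner (fc (\<lambda>t. complex_of_real (h t)) x) x = of_real (LINT z|scalar_measure E x. indicator \<sigma> z * h (Re z))"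
    unfolding fc_form[OF h] eq using int by (rule integral_of_real)
qed

lemma fc_selfadjoint:
  assumes h: "admissible (\<lambda>t. complex_of_real (h t))"
  shows "cinner (fc (\<lambda>t. complex_of_real (h t)) x) y = cinner x (fc (\<lambda>t. complex_of_real (h t)) y)"
  by (rule selfadjoint_if_real_form[OF fc_clinear[OF h]]) (simp add: fc_form_real(1)[OF h])

lemma fc_positive:
  assumes h: "admissible (\<lambda>t. complex_of_real (h t))" and "\<And>t. 0 \<le> t \<Longrightarrow> t \<le> K \<Longrightarrow> 0 \<le> h t"
  shows "positive_op (fc (\<lambda>t. complex_of_real (h t)))"
proof (rule positive_opI[OF fc_clinear[OF h]])
  have "0 \<le> indicator \<sigma> z * h (Re z)" for z
    using assms(2)[of "Re z"] spectrum_real[of z] by (auto simp: indicator_def)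
  then show "\<exists>r\<ge>0. cinner (fc (\<lambda>t. complex_of_real (h t)) x) x = of_real r" for x
    by (auto simp: fc_form_real(1)[OF h] intro!: integral_nonneg)
qed

lemma fc_norm_le:
  assumes "admissible h" "\<And>t. 0 \<le> t \<Longrightarrow> t \<le> K \<Longrightarrow> cmod (h t) \<le> B"
  shows "norm (fc h) \<le> 2 * B"
  unfolding fc_def
proof (rule calc.\<Phi>_norm_le(2)[OF bb_admissible[OF assms(1)]])
  have "0 \<le> B" using order.trans[OF norm_ge_zero assms(2)[of 0]] K by simp
  then show "cmod (indicator \<sigma> z * h (Re z)) \<le> B" for z
    using assms(2)[of "Re z"] spectrum_real[of z] by (auto simp: indicator_def)
qed

lemma admissible_const: "admissible (\<lambda>_. c)"
  by (rule admissibleI[of _ "cmod c"]) auto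

lemma admissible_diff:
  assumes f: "admissible f" and g: "admissible g"
  shows "admissible (\<lambda>t. f t - g t)"
proof -
  obtain B C where "\<forall>t\<in>{0..K}. cmod (f t) \<le> B" "\<forall>t\<in>{0..K}. cmod (g t) \<le> C"
    using f g unfolding admissible_def by blast
  then have "\<forall>t\<in>{0..K}. cmod (f t - g t) \<le> B + C"
    by (meson add_mono norm_triangle_ineq4 order.trans)
  then show ?thesis
    using f g unfolding admissible_def by (auto intro!: borel_measurable_diff)
qed

lemma fc_zero: "fc (\<lambda>_. 0) = 0"
  using fc_diff[OF admissible_one admissible_one] by simp

lemma fc_const: "fc (\<lambda>_. complex_of_real r) = r *\<^sub>R id_blinfun"
proof -
  have "fc (\<lambda>_. complex_of_real r) = scaleC_op (complex_of_real r) id_blinfun"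
    using calc.\<Phi>_scale[OF bb_indicator_spectrum, of "complex_of_real r"] fc_one
    by (simp add: fc_def mult.commute)
  also have "\<dots> = r *\<^sub>R id_blinfun"
    by (intro blinfun_eqI) (simp add: blinfun.scaleR_left scaleR_scaleC)
  finally show ?thesis .
qed

lemma fc_shift: "fc (\<lambda>t. complex_of_real (t + r)) = A + r *\<^sub>R id_blinfun"
  and admissible_shift: "admissible (\<lambda>t. complex_of_real (t + r))"
  using fc_diff[OF admissible_id admissible_const[of "complex_of_real (- r)"]] fc_const[of "- r"]
    admissible_diff[OF admissible_id admissible_const[of "complex_of_real (- r)"]]
  by (simp_all add: fc_id)

definition root :: "'h op" where "root = fc (\<lambda>t. complex_of_real (sqrt t))"

lemma admissible_sqrt: "admissible (\<lambda>t. complex_of_real (sqrt t))"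
  using K by (intro admissibleI[of _ "sqrt K"]) auto

lemma root: "positive_op root" "root o\<^sub>L root = A"
proof -
  show "positive_op root"
    unfolding root_def by (intro fc_positive admissible_sqrt) auto
  have "root o\<^sub>L root = fc (\<lambda>t. complex_of_real (sqrt t) * complex_of_real (sqrt t))"
    unfolding root_def by (rule fc_mult[OF admissible_sqrt admissible_sqrt, symmetric])
  also have "\<dots> = fc complex_of_real"
    by (intro fc_cong) (simp flip: of_real_mult)
  finally show "root o\<^sub>L root = A" by (simp add: fc_id)
qed

end

lemma positive_operator_norm: "positive_op A \<Longrightarrow> positive_operator A (norm A + 1)"
  by unfold_locales (auto simp: add_nonneg_pos)

lemma op_power_double:
  "op_power UNIV T (2 * n) = op_power UNIV (T o\<^sub>L T) n" for T :: "'h::chilbert_space op"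
  by (induction n) (simp_all add: op_power_Suc op_comp_assoc)

text \<open>The image under \<open>t\<^sup>2\<close> of the spectral measure of a positive root \<open>C\<close> has the moments of \<open>C\<^sup>2\<close>.\<close>

lemma positive_root_unique:
  assumes C1: "positive_op C1" and C2: "positive_op C2" and eq: "C1 o\<^sub>L C1 = C2 o\<^sub>L C2"
  shows "C1 = C2"
proof -
  \<comment> \<open>A common scale, so that the even powers of the two rescaled roots are literally
    the same operators.\<close>
  define K where "K = max 1 (max (norm C1) (norm C2))"
  interpret c1: positive_operator C1 K by unfold_locales (auto simp: K_def C1)
  interpret c2: positive_operator C2 K by unfold_locales (auto simp: K_def C2)
  have K: "0 < K" by (rule c1.K)
  have "cinner (C1 x) x = cinner (C2 x) x" for x
  proof -
    have "(LINT z|scalar_measure c1.E x. indicator c1.\<sigma> z * complex_of_real (sqrt ((c1.\<tau> z)\<^sup>2)))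
        = (LINT z|scalar_measure c2.E x. indicator c2.\<sigma> z * complex_of_real (sqrt ((c2.\<tau> z)\<^sup>2)))"
    proof (rule LINT_eq_if_moments_eq[OF c1.calc.finite c1.calc.sets c2.calc.finite c2.calc.sets
          c1.bb_indicator_spectrum c2.bb_indicator_spectrum, where g = "\<lambda>t. complex_of_real (sqrt t)"])
      show "(\<lambda>z. (c1.\<tau> z)\<^sup>2) \<in> borel_measurable borel" "(\<lambda>z. (c2.\<tau> z)\<^sup>2) \<in> borel_measurable borel"
        by measurable
      show "(c1.\<tau> z)\<^sup>2 \<in> {0..1}" if "indicator c1.\<sigma> z \<noteq> (0::complex)" for z
        using c1.\<tau>_L(3)[of z] that c1.spectrum_facts(3)
        by (auto simp: indicator_def power_le_one split: if_splits)
      show "(c2.\<tau> z)\<^sup>2 \<in> {0..1}" if "indicator c2.\<sigma> z \<noteq> (0::complex)" for z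
        using c2.\<tau>_L(3)[of z] that c2.spectrum_facts(3)
        by (auto simp: indicator_def power_le_one split: if_splits)
      show "bounded_borel (\<lambda>t. indicator {0..1} t * complex_of_real (sqrt t))"
        by (rule bounded_borelI[of _ 1]) (auto simp: indicator_def)
      fix n
      have "op_power UNIV ((1/K) *\<^sub>R C1) (2 * n) = op_power UNIV ((1/K) *\<^sub>R C2) (2 * n)"
        by (simp add: op_power_double blinfun_compose_simps eq)
      then show "(LINT z|scalar_measure c1.E x. indicator c1.\<sigma> z * complex_of_real (((c1.\<tau> z)\<^sup>2) ^ n))
        = (LINT z|scalar_measure c2.E x. indicator c2.\<sigma> z * complex_of_real (((c2.\<tau> z)\<^sup>2) ^ n))"
        unfolding power_mult[symmetric] c1.calc_moments c2.calc_moments by simp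
    qed
    moreover have "indicator c1.\<sigma> z * complex_of_real (sqrt ((c1.\<tau> z)\<^sup>2)) = indicator c1.\<sigma> z * complex_of_real (c1.\<tau> z ^ 1)"
      "indicator c2.\<sigma> z * complex_of_real (sqrt ((c2.\<tau> z)\<^sup>2)) = indicator c2.\<sigma> z * complex_of_real (c2.\<tau> z ^ 1)" for z
      using c1.spectrum_real[of z] c2.spectrum_real[of z] K by (auto simp: indicator_def c1.\<tau>_eq c2.\<tau>_eq)
    ultimately have "cinner (op_power UNIV ((1/K) *\<^sub>R C1) 1 x) x = cinner (op_power UNIV ((1/K) *\<^sub>R C2) 1 x) x"
      by (simp only: c1.calc_moments c2.calc_moments)
    then show ?thesis
      using K by (simp add: op_power_Suc blinfun_compose_simps blinfun.scaleR_left cinner.scaleR_left)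
  qed
  then show ?thesis
    by (intro op_eqI positive_opD(1)[OF C1] positive_opD(1)[OF C2])
qed

lemma sqrt_op_eqI: "positive_op C \<Longrightarrow> C o\<^sub>L C = A \<Longrightarrow> sqrt_op A = C"
  unfolding sqrt_op_def by (rule the_equality) (auto intro: positive_root_unique)

lemma (in positive_operator) sqrt_op_eq_root: "sqrt_op A = root"
  by (rule sqrt_op_eqI[OF root])

lemma sqrt_op:
  assumes A: "positive_op A"
  shows "positive_op (sqrt_op A)" "sqrt_op A o\<^sub>L sqrt_op A = A" "sqrt_op A (sqrt_op A x) = A x"
    "(norm (sqrt_op A x))\<^sup>2 = inner (A x) x"
proof -
  interpret positive_operator A "norm A + 1"
    by (rule positive_operator_norm[OF A])
  show 1: "positive_op (sqrt_op A)" "sqrt_op A o\<^sub>L sqrt_op A = A"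
    by (simp_all add: sqrt_op_eq_root root)
  then show 2: "sqrt_op A (sqrt_op A x) = A x"
    by (metis blinfun_apply_blinfun_compose)
  have "cinner (sqrt_op A x) (sqrt_op A x) = cinner (A x) x"
    using positive_opD(2)[OF 1(1), of "sqrt_op A x" x] by (simp add: 2)
  then have "inner (sqrt_op A x) (sqrt_op A x) = inner (A x) x"
    by (metis Re_cinner)
  then show "(norm (sqrt_op A x))\<^sup>2 = inner (A x) x"
    by (simp add: power2_norm_eq_inner)
qed

lemma sqrt_op_eq_0_iff: "positive_op A \<Longrightarrow> sqrt_op A x = 0 \<longleftrightarrow> A x = 0"
  using sqrt_op(3)[of A x] sqrt_op(4)[of A x] by (auto simp: blinfun.zero_right)

lemma positive_op_eq_0_iff: "positive_op A \<Longrightarrow> A x = 0 \<longleftrightarrow> inner (A x) x = 0"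
  using sqrt_op_eq_0_iff[of A x] sqrt_op(4)[of A x] by auto

section \<open>Contractions factoring through a square root\<close>

lemma ocompl_ocompl:
  assumes K: "csubspace K"
  shows "ocompl (ocompl K) = K"
proof (intro set_eqI iffI)
  fix x assume x: "x \<in> K"
  have "cinner x y = 0" if "y \<in> ocompl K" for y
    using that x cinner_commute[of x y] by (auto simp: ocompl_def)
  then show "x \<in> ocompl (ocompl K)" by (auto simp: ocompl_def)
next
  fix x assume x: "x \<in> ocompl (ocompl K)"
  obtain m where m: "m \<in> K" "x - m \<in> ocompl K"
    using csubspace_decomposition[OF K] by blast
  have "cinner m (x - m) = 0"
    using m cinner_commute[of m "x - m"] by (auto simp: ocompl_def)
  moreover have "cinner x (x - m) = 0"
    using x m by (auto simp: ocompl_def)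
  ultimately have "cinner (x - m) (x - m) = 0"
    by (simp add: cinner.diff_left)
  then show "x \<in> K"
    using m(1) by (simp add: cinner_eq_norm)
qed

lemma csubspace_ker:
  assumes "clinear_op T"
  shows "csubspace (ker_op T)"
  unfolding csubspace_def ker_op_def
  using assms by (auto simp: blinfun.add_right blinfun.zero_right clinear_opD
      intro!: closed_Collect_eq continuous_intros)

lemma op_on_ocompl_ker:
  assumes H: "clinear_op H" and T: "positive_op T" and ker: "\<And>x. H x = 0 \<Longrightarrow> T x = 0"
  shows "op_on (ocompl (ker_op H)) T"
proof -
  have "T x \<in> ocompl (ker_op H)" for x
    using ker by (auto simp: ocompl_def ker_op_def positive_opD(2)[OF T])
  moreover have "T x = 0" if "x \<in> ocompl (ocompl (ker_op H))" for x
    using that[unfolded ocompl_ocompl[OF csubspace_ker[OF H]]] ker by (simp add: ker_op_def)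
  ultimately show ?thesis
    using positive_opD(1)[OF T] by (simp add: op_on_def clinear_op_def)
qed

text \<open>The range of \<open>C\<close> is dense in \<open>M\<close>, expressed through adjoints:
  \<open>D o C = 0\<close> gives \<open>C (adj D y) = 0\<close>, so \<open>adj D\<close> maps into
  the kernel of \<open>H\<close>, which is orthogonal to \<open>M\<close>.\<close>

lemma op_on_cancel_right:
  fixes C H D :: "'h::chilbert_space op"
  assumes C: "clinear_op C" "\<And>x y. cinner (C x) y = cinner x (C y)" and H: "\<And>x. C x = 0 \<Longrightarrow> H x = 0"
    and M: "M = ocompl (ker_op H)" and D: "op_on M D" "D o\<^sub>L C = 0"
  shows "D = 0"
proof -
  have Mc: "csubspace M" by (simp add: M)
  note Dc = op_onD(1)[OF D(1)]
  have ker: "adj D y \<in> ker_op H" for y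
  proof -
    have "cinner (C (adj D y)) x = 0" for x
    proof -
      have "cinner (D (C x)) y = 0"
        using D(2) by (metis blinfun_apply_blinfun_compose cinner.zero_left zero_blinfun.rep_eq)
      then have "cinner (C x) (adj D y) = 0"
        by (simp add: adj_props(1)[OF Dc])
      then show ?thesis
        using C(2)[of x "adj D y"] cinner_commute[of x "C (adj D y)"] by simp
    qed
    then have "C (adj D y) = 0"
      using cinner_eqI[of "C (adj D y)" 0] by simp
    then show ?thesis
      by (simp add: H ker_op_def)
  qed
  show ?thesis
  proof (intro blinfun_eqI cinner_eqI)
    fix x y
    have "cinner (D x) y = cinner (D (proj M x)) y"
      using D(1) unfolding op_on_iff[OF Mc] by (metis blinfun_apply_blinfun_compose)
    also have "\<dots> = cinner (proj M x) (adj D y)"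
      by (rule adj_props(1)[OF Dc])
    also have "\<dots> = 0"
      using proj_props(1)[OF Mc, of x] ker[of y] unfolding M by (auto simp: ocompl_def)
    finally show "cinner (D x) y = cinner (blinfun_apply 0 x) y" by simp
  qed
qed

context positive_operator
begin

lemma LINT_spectrum_one: "(LINT z|scalar_measure E x. indicator \<sigma> z * (1::real)) = (norm x)\<^sup>2"
proof -
  have "complex_of_real (LINT z|scalar_measure E x. indicator \<sigma> z * 1) = cinner (fc (\<lambda>_. complex_of_real 1) x) x"
    using admissible_one by (subst fc_form_real(1)) auto
  then have "complex_of_real (LINT z|scalar_measure E x. indicator \<sigma> z * 1) = of_real ((norm x)\<^sup>2)"
    by (simp add: fc_one cinner_eq_norm del: of_real_power)
  then show ?thesis
    by (simp only: of_real_eq_iff)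
qed

text \<open>The left side is the form of \<open>T\<close> at \<open>h(A) x\<close>, which is at most
  the form of \<open>A\<close> there, that is, the integral of \<open>t * (h t)\<^sup>2\<close>.
  Estimates for the approximants of the contraction thus become pointwise estimates in
  \<open>t\<close>.\<close>

lemma sqrt_fc_le:
  assumes T: "positive_op T" and TA: "\<And>x. inner (T x) x \<le> inner (A x) x"
    and h: "admissible (\<lambda>t. complex_of_real (h t))" and w: "admissible (\<lambda>t. complex_of_real (w t))"
    and hw: "\<And>t. 0 \<le> t \<Longrightarrow> t \<le> K \<Longrightarrow> t * (h t)\<^sup>2 \<le> w t"
  shows "(norm (sqrt_op T (fc (\<lambda>t. complex_of_real (h t)) x)))\<^sup>2
    \<le> (LINT z|scalar_measure E x. indicator \<sigma> z * w (Re z))"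
proof -
  let ?F = "fc (\<lambda>t. complex_of_real (h t))"
  have h2: "admissible (\<lambda>t. complex_of_real (h t * (t * h t)))"
    using admissible_mult[OF h admissible_mult[OF admissible_id h]] by simp
  have FAF: "?F o\<^sub>L (A o\<^sub>L ?F) = fc (\<lambda>t. complex_of_real (h t * (t * h t)))"
    using fc_mult[OF h admissible_mult[OF admissible_id h]] fc_mult[OF admissible_id h] by (simp add: fc_id)
  have "cinner (A (?F x)) (?F x) = cinner ((?F o\<^sub>L (A o\<^sub>L ?F)) x) x"
    by (simp add: fc_selfadjoint[OF h])
  also have "\<dots> = of_real (LINT z|scalar_measure E x. indicator \<sigma> z * (h (Re z) * (Re z * h (Re z))))"
    unfolding FAF by (rule fc_form_real(1)[OF h2])
  finally have "Re (cinner (A (?F x)) (?F x)) = (LINT z|scalar_measure E x. indicator \<sigma> z * (h (Re z) * (Re z * h (Re z))))"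
    by simp
  then have "inner (A (?F x)) (?F x) = (LINT z|scalar_measure E x. indicator \<sigma> z * (h (Re z) * (Re z * h (Re z))))"
    by (simp only: Re_cinner)
  also have "\<dots> \<le> (LINT z|scalar_measure E x. indicator \<sigma> z * w (Re z))"
    using fc_integrable[OF h2] fc_integrable[OF w]
  proof (rule integral_mono)
    fix z
    have eq: "h (Re z) * (Re z * h (Re z)) \<le> w (Re z)" if "z \<in> \<sigma>"
      using hw[of "Re z"] spectrum_real(2,3)[OF that] by (simp add: power2_eq_square mult.left_commute)
    show "indicator \<sigma> z * (h (Re z) * (Re z * h (Re z))) \<le> indicator \<sigma> z * w (Re z)"
      using eq by (cases "z \<in> \<sigma>") simp_all
  qed
  finally show ?thesis
    using TA[of "?F x"] by (simp add: sqrt_op(4)[OF T])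
qed

text \<open>\<open>X\<close> is the strong limit of \<open>sqrt_op T\<close> times \<open>g\<^sub>n(A)\<close>, where \<open>g\<^sub>n\<close> is the inverse square
  root cut off below \<open>1 / (n + 1)\<close>.\<close>

lemma ex_contraction:
  assumes T: "positive_op T" and TA: "\<And>x. inner (T x) x \<le> inner (A x) x"
  shows "\<exists>X. op_on (ocompl (ker_op A)) X \<and> norm X \<le> 1 \<and> X o\<^sub>L sqrt_op A = sqrt_op T"
proof -
  let ?M = "ocompl (ker_op A)" and ?S = "sqrt_op T"
  define g where "g n t = (if 1 / real (Suc n) \<le> t then 1 / sqrt t else 0)" for n :: nat and t
  have t_pos: "0 < t" if "1 / real (Suc n) \<le> t" for n t
    using that by (smt (verit) divide_pos_pos of_nat_0_less_iff zero_less_Suc)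
  have g_bound: "\<bar>g n t\<bar> \<le> sqrt (Suc n)" for n t
  proof (cases "1 / real (Suc n) \<le> t")
    case True
    then have "1 / t \<le> Suc n"
      using t_pos[OF True] by (simp add: field_simps)
    then have "sqrt (1 / t) \<le> sqrt (Suc n)" by (rule real_sqrt_le_mono)
    then show ?thesis using True t_pos[OF True] by (simp add: g_def real_sqrt_divide)
  qed (simp add: g_def)
  have g_meas: "g n \<in> borel_measurable borel" for n
    unfolding g_def by measurable
  have g_adm: "admissible (\<lambda>t. complex_of_real (g n t))" for n
    using g_meas[of n] g_bound[of n] by (intro admissibleI[of _ "sqrt (Suc n)"]) auto
  have g_sq: "t * (g n t)\<^sup>2 = (if 1 / real (Suc n) \<le> t then 1 else 0)" for n t
    using t_pos[of n t] by (auto simp: g_def power_divide)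
  define X' where "X' n = ?S o\<^sub>L fc (\<lambda>t. complex_of_real (g n t))" for n
  have X'_clinear: "clinear_op (X' n)" for n
    using fc_clinear[OF g_adm] sqrt_op(1)[OF T] by (simp add: X'_def positive_opD(1))
  have X'_bound: "norm (X' n x) \<le> norm x" for n x
  proof -
    have "(norm (X' n x))\<^sup>2 \<le> (LINT z|scalar_measure E x. indicator \<sigma> z * 1)"
      unfolding X'_def blinfun_apply_blinfun_compose
    proof (rule sqrt_fc_le[OF T TA g_adm, where w = "\<lambda>_. 1"])
      show "admissible (\<lambda>t. complex_of_real 1)"
        using admissible_one by simp
      show "t * (g n t)\<^sup>2 \<le> 1" for t
        unfolding g_sq by simp
    qed
    then show ?thesis
      unfolding LINT_spectrum_one by (rule power2_le_imp_le) simp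
  qed
  \<comment> \<open>For \<open>n\<close> at least \<open>m\<close>, the functions \<open>g n\<close>
    and \<open>g m\<close> can differ only on this interval. It excludes 0, where both vanish, so
    the intervals shrink to the empty set and \<open>W\<close> tends to 0.\<close>
  define v where "v m t = (indicator {0<..<1 / real (Suc m)} t :: real)" for m t
  have v_adm: "admissible (\<lambda>t. complex_of_real (v m t))" for m
    unfolding v_def by (intro admissibleI[of _ 1]) auto
  define W where "W x m = (LINT z|scalar_measure E x. indicator \<sigma> z * v m (Re z))" for x m
  have W_lim: "W x \<longlonglongrightarrow> 0" for x
  proof -
    interpret finite_measure "scalar_measure E x" by (rule calc.finite)
    have "(\<lambda>m. LINT z|scalar_measure E x. indicator \<sigma> z * v m (Re z)) \<longlonglongrightarrow> (LINT z|scalar_measure E x. 0)"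
    proof (rule integral_dominated_convergence[where w = "\<lambda>_. 1"])
      show "(\<lambda>z. indicator \<sigma> z * v m (Re z)) \<in> borel_measurable (scalar_measure E x)" for m
        using borel_measurable_integrable[OF fc_integrable[OF v_adm]] .
      show "AE z in scalar_measure E x. (\<lambda>m. indicator \<sigma> z * v m (Re z)) \<longlonglongrightarrow> 0"
      proof (rule AE_I2)
        fix z
        have "(\<lambda>m. v m t) \<longlonglongrightarrow> 0" for t
        proof (cases "0 < t")
          case True
          obtain N :: nat where "1 / t < N" using reals_Archimedean2 by blast
          have "v m t = 0" if "N \<le> m" for m
          proof -
            have "1 / t < Suc m" using \<open>1 / t < N\<close> that by (meson le_SucI of_nat_le_iff order_less_le_trans)
            then have "1 / real (Suc m) < t" using True by (simp add: field_simps)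
            then show ?thesis by (simp add: v_def)
          qed
          then show ?thesis
            by (intro tendsto_eventually) (auto simp: eventually_sequentially)
        qed (simp add: v_def)
        from tendsto_mult_left[OF this, of "indicator \<sigma> z"]
        show "(\<lambda>m. indicator \<sigma> z * v m (Re z)) \<longlonglongrightarrow> 0" by simp
      qed
      show "AE z in scalar_measure E x. norm (indicator \<sigma> z * v m (Re z)) \<le> 1" for m
        by (auto simp: v_def indicator_def)
    qed auto
    then show ?thesis by (simp add: W_def[abs_def])
  qed
  have diff: "(norm (X' n x - X' m x))\<^sup>2 \<le> W x m" if mn: "m \<le> n" for m n x
  proof -
    have adm: "admissible (\<lambda>t. complex_of_real (g n t - g m t))"
      using admissible_diff[OF g_adm g_adm] by simp
    have "X' n x - X' m x = ?S (fc (\<lambda>t. complex_of_real (g n t - g m t)) x)"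
      by (simp add: X'_def fc_diff[OF g_adm g_adm] blinfun.diff_left blinfun.diff_right)
    moreover have "t * (g n t - g m t)\<^sup>2 \<le> v m t" if t: "0 \<le> t" for t
    proof -
      have le: "1 / real (Suc n) \<le> 1 / real (Suc m)"
        using mn by (intro divide_left_mono) auto
      consider "1 / real (Suc m) \<le> t" | "t < 1 / real (Suc m)" "0 < t" | "t = 0"
        using t by linarith
      then show ?thesis
      proof cases
        case 1
        then have "g n t = g m t" using le by (simp add: g_def)
        then show ?thesis by (simp add: v_def)
      next
        case 2
        then have "g m t = 0" "v m t = 1" by (auto simp: g_def v_def)
        then show ?thesis using g_sq[of t n] by simp
      qed (simp add: v_def)
    qed
    ultimately show ?thesis
      unfolding W_def using sqrt_fc_le[OF T TA adm v_adm] by simp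
  qed
  have "convergent (\<lambda>n. X' n x)" for x
  proof -
    have "Cauchy (\<lambda>n. X' n x)"
      unfolding Cauchy_def
    proof (intro allI impI)
      fix e :: real assume e: "0 < e"
      then have "\<forall>\<^sub>F m in sequentially. W x m < e\<^sup>2"
        by (intro order_tendstoD(2)[OF W_lim]) auto
      then obtain N where N: "\<And>m. N \<le> m \<Longrightarrow> W x m < e\<^sup>2"
        by (auto simp: eventually_sequentially)
      have *: "norm (X' q x - X' p x) < e" if "N \<le> p" "p \<le> q" for p q
        using power2_less_imp_less[OF le_less_trans[OF diff[OF that(2)] N[OF that(1)]]] e by simp
      have "dist (X' p x) (X' q x) < e" if "N \<le> p" "N \<le> q" for p q
        using *[of p q] *[of q p] that by (cases "p \<le> q") (auto simp: dist_norm norm_minus_commute)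
      then show "\<exists>N. \<forall>p\<ge>N. \<forall>q\<ge>N. dist (X' p x) (X' q x) < e" by blast
    qed
    then show ?thesis by (simp add: Cauchy_convergent_iff)
  qed
  then obtain X0 where X0: "\<And>x. (\<lambda>n. X' n x) \<longlonglongrightarrow> X0 x"
    unfolding convergent_def by metis
  have X0_add: "X0 (x + y) = X0 x + X0 y" for x y
    using tendsto_add[OF X0[of x] X0[of y]] X0[of "x + y"] by (simp add: blinfun.add_right LIMSEQ_unique)
  have X0_scaleC: "X0 (c *\<^sub>C x) = c *\<^sub>C X0 x" for c x
  proof -
    have "(\<lambda>n. c *\<^sub>C X' n x) \<longlonglongrightarrow> c *\<^sub>C X0 x"
      using bounded_linear.tendsto[OF blinfun.bounded_linear_right[of "scaleC_op c id_blinfun"] X0[of x]]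
      by simp
    then show ?thesis
      using X0[of "c *\<^sub>C x"] by (simp add: clinear_opD[OF X'_clinear] LIMSEQ_unique)
  qed
  have X0_bound: "norm (X0 x) \<le> norm x" for x
    by (rule LIMSEQ_le_const2[OF tendsto_norm[OF X0]]) (use X'_bound in blast)
  have bl: "bounded_linear X0"
    using X0_bound by (intro bounded_linear_intro[of _ 1]) (auto simp: X0_add X0_scaleC scaleR_scaleC)
  define X where "X = Blinfun X0"
  have X: "X x = X0 x" for x
    by (simp add: X_def bounded_linear_Blinfun_apply[OF bl])
  have TA0: "T x = 0" if "A x = 0" for x
    using TA[of x] positive_opD(4)[OF T, of x] that by (simp add: positive_op_eq_0_iff[OF T])
  have S_on: "op_on ?M ?S"
    using TA0 sqrt_op_eq_0_iff[OF T] sqrt_op(1)[OF T]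
    by (intro op_on_ocompl_ker positive_opD(1)[OF A]) auto
  have "X x \<in> ?M" for x
    unfolding X using X0[of x] csubspaceD(1)[OF csubspace_ocompl]
    by (rule closed_sequentially[rotated 2]) (use op_onD(2)[OF S_on] in \<open>simp add: X'_def\<close>)
  moreover have "X x = 0" if "x \<in> ocompl ?M" for x
  proof -
    have "A x = 0"
      using that[unfolded ocompl_ocompl[OF csubspace_ker[OF positive_opD(1)[OF A]]]]
      by (simp add: ker_op_def)
    \<comment> \<open>Dividing by \<open>t\<close> makes \<open>g\<^sub>n(A)\<close> factor through
      \<open>A\<close>, so every approximant annihilates the kernel of \<open>A\<close>.\<close>
    define k where "k n t = complex_of_real (g n t / t)" for n t
    have k_adm: "admissible (k n)" for n
    proof (rule admissibleI)
      show "k n \<in> borel_measurable borel"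
        unfolding k_def g_def by measurable
      show "cmod (k n t) \<le> sqrt (Suc n) * Suc n" for t
      proof (cases "1 / real (Suc n) \<le> t")
        case True
        then have "\<bar>1 / t\<bar> \<le> Suc n"
          using t_pos[OF True] by (simp add: field_simps)
        then have "\<bar>g n t\<bar> * \<bar>1 / t\<bar> \<le> sqrt (Suc n) * Suc n"
          using g_bound by (intro mult_mono) auto
        then show ?thesis by (simp add: k_def abs_divide del: of_real_divide of_nat_Suc)
      qed (simp add: g_def k_def)
    qed
    have "fc (\<lambda>t. complex_of_real (g n t)) = fc (k n) o\<^sub>L A" for n
    proof -
      have "fc (\<lambda>t. complex_of_real (g n t)) = fc (\<lambda>t. k n t * complex_of_real t)"
        by (intro fc_cong) (auto simp: k_def g_def)
      then show ?thesis
        using fc_mult[OF k_adm admissible_id] by (simp add: fc_id)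
    qed
    then have "X' n x = 0" for n
      by (simp add: X'_def \<open>A x = 0\<close> blinfun.zero_right)
    then show ?thesis
      using X0[of x] LIMSEQ_unique[OF tendsto_const] by (fastforce simp: X)
  qed
  ultimately have "op_on ?M X"
    by (auto simp: op_on_def X X0_scaleC)
  moreover have "norm X \<le> 1"
    by (rule norm_blinfun_bound) (auto simp: X X0_bound)
  moreover have "X o\<^sub>L sqrt_op A = ?S"
  proof (rule blinfun_eqI)
    fix x
    have adm: "admissible (\<lambda>t. complex_of_real (1 - g n t * sqrt t))" for n
      using admissible_diff[OF admissible_one admissible_mult[OF g_adm admissible_sqrt]] by simp
    have "norm (X' n (sqrt_op A x) - ?S x) \<le> norm x * sqrt (1 / real (Suc n))" for n
    proof -
      let ?f = "fc (\<lambda>t. complex_of_real (1 - g n t * sqrt t))"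
      have "(\<lambda>t. complex_of_real (1 - g n t * sqrt t)) = (\<lambda>t. 1 - complex_of_real (g n t) * complex_of_real (sqrt t))"
        by simp
      then have "?f = id_blinfun - (fc (\<lambda>t. complex_of_real (g n t)) o\<^sub>L sqrt_op A)"
        using fc_diff[OF admissible_one admissible_mult[OF g_adm admissible_sqrt]] fc_mult[OF g_adm admissible_sqrt]
        by (simp add: fc_one sqrt_op_eq_root root_def)
      then have "?S x - X' n (sqrt_op A x) = ?S (?f x)"
        by (simp add: X'_def blinfun.diff_left blinfun.diff_right)
      moreover have "(norm (?S (?f x)))\<^sup>2 \<le> (LINT z|scalar_measure E x. indicator \<sigma> z * (1 / real (Suc n)))"
      proof (rule sqrt_fc_le[OF T TA adm, where w = "\<lambda>_. 1 / real (Suc n)"])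
        show "admissible (\<lambda>t. complex_of_real (1 / real (Suc n)))"
          by (rule admissible_const)
        fix t :: real assume "0 \<le> t"
        \<comment> \<open>Above the cut-off \<open>g n t * sqrt t\<close> equals 1 and nothing is
          left; below it \<open>g n t = 0\<close> and \<open>t\<close> itself is small.\<close>
        show "t * (1 - g n t * sqrt t)\<^sup>2 \<le> 1 / real (Suc n)"
        proof (cases "1 / real (Suc n) \<le> t")
          case True
          then show ?thesis using t_pos[OF True] by (simp add: g_def)
        qed (simp add: g_def)
      qed
      moreover have "(LINT z|scalar_measure E x. indicator \<sigma> z * (1 / real (Suc n))) = (norm x)\<^sup>2 * (1 / real (Suc n))"
        unfolding LINT_spectrum_one[symmetric] by simp
      ultimately have "(norm (?S x - X' n (sqrt_op A x)))\<^sup>2 \<le> (norm x * sqrt (1 / real (Suc n)))\<^sup>2"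
        by (simp add: power_mult_distrib del: of_nat_Suc)
      then have "norm (?S x - X' n (sqrt_op A x)) \<le> norm x * sqrt (1 / real (Suc n))"
        by (rule power2_le_imp_le) simp
      then show ?thesis
        by (simp only: norm_minus_commute)
    qed
    moreover have "(\<lambda>n. norm x * sqrt (1 / real (Suc n))) \<longlonglongrightarrow> norm x * sqrt 0"
      by (intro tendsto_intros LIMSEQ_Suc[OF lim_1_over_n])
    ultimately have le: "\<And>n. norm (X' n (sqrt_op A x) - ?S x) \<le> norm x * sqrt (1 / real (Suc n))"
      and lim: "(\<lambda>n. norm x * sqrt (1 / real (Suc n))) \<longlonglongrightarrow> norm x * sqrt 0"
      by blast+
    have "(\<lambda>n. X' n (sqrt_op A x) - ?S x) \<longlonglongrightarrow> 0"
    proof (rule Lim_null_comparison)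
      show "\<forall>\<^sub>F n in sequentially. norm (X' n (sqrt_op A x) - ?S x) \<le> norm x * sqrt (1 / real (Suc n))"
        using le by (intro always_eventually allI)
      show "(\<lambda>n. norm x * sqrt (1 / real (Suc n))) \<longlonglongrightarrow> 0"
        using lim by (simp only: real_sqrt_zero mult_zero_right)
    qed
    then have "(\<lambda>n. X' n (sqrt_op A x)) \<longlonglongrightarrow> ?S x"
      by (rule LIM_zero_cancel)
    then show "(X o\<^sub>L sqrt_op A) x = ?S x"
      using LIMSEQ_unique[OF X0[of "sqrt_op A x"]] by (simp add: X)
  qed
  ultimately show ?thesis by blast
qed

end

section \<open>The operators in the definition of the Pusz--Woronowicz calculus\<close>

text \<open>At \<open>x\<close> the form of \<open>C (adj X) X C\<close> is the squared norm of
  \<open>X (C x) = sqrt_op T x\<close>, hence the form of \<open>T\<close>. The sandwich identity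
  therefore needs no inverse of \<open>C\<close>.\<close>

lemma contraction_root_props:
  assumes M: "csubspace M" and T: "positive_op T" and C: "positive_op C"
    and X: "op_on M X" "norm X \<le> 1" "X o\<^sub>L C = sqrt_op T"
  shows "op_on M (adj X o\<^sub>L X)" "positive_op (adj X o\<^sub>L X)"
    "inner ((adj X o\<^sub>L X) x) x \<le> inner x x" "C o\<^sub>L (adj X o\<^sub>L X) o\<^sub>L C = T"
proof -
  note Xc = op_onD(1)[OF X(1)]
  have form: "cinner ((adj X o\<^sub>L X) x) y = cinner (X x) (X y)" for x y
    using adj_props(1)[OF Xc, of y "X x"] cinner_commute[of y "adj X (X x)"] cinner_commute[of "X y" "X x"]
    by simp
  have clin: "clinear_op (adj X o\<^sub>L X)"
    using Xc adj_props(2)[OF Xc] by simp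
  have XP: "X (proj M x) = X x" for x
    using X(1) unfolding op_on_iff[OF M] by (metis blinfun_apply_blinfun_compose)
  have "proj M o\<^sub>L (adj X o\<^sub>L X) = adj X o\<^sub>L X"
  proof (intro blinfun_eqI cinner_eqI)
    fix x y
    have "cinner (proj M (adj X (X x))) y = cinner (adj X (X x)) (proj M y)"
      using cinner_proj[OF M] by metis
    also have "\<dots> = cinner (adj X (X x)) y"
      using form[of x "proj M y"] form[of x y] by (simp add: XP)
    finally show "cinner ((proj M o\<^sub>L (adj X o\<^sub>L X)) x) y = cinner ((adj X o\<^sub>L X) x) y"
      by simp
  qed
  moreover have "(adj X o\<^sub>L X) o\<^sub>L proj M = adj X o\<^sub>L X"
    by (intro blinfun_eqI) (simp add: XP)
  ultimately show "op_on M (adj X o\<^sub>L X)"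
    using clin by (simp add: op_on_iff[OF M])
  show "positive_op (adj X o\<^sub>L X)"
  proof (rule positive_opI[OF clin])
    show "\<exists>r\<ge>0. cinner ((adj X o\<^sub>L X) x) x = of_real r" for x
      by (intro exI[of _ "(norm (X x))\<^sup>2"] conjI zero_le_power2) (simp only: form cinner_eq_norm)
  qed
  have "Re (cinner ((adj X o\<^sub>L X) x) x) = (norm (X x))\<^sup>2"
    by (simp only: form cinner_eq_norm) simp
  moreover have "norm (X x) \<le> norm x"
    using norm_blinfun[of X x] mult_right_mono[OF X(2) norm_ge_zero[of x]] by simp
  ultimately show "inner ((adj X o\<^sub>L X) x) x \<le> inner x x"
    unfolding Re_cinner by (simp add: power_mono flip: power2_norm_eq_inner)
  have XC: "X (C x) = sqrt_op T x" for x
    using X(3) by (metis blinfun_apply_blinfun_compose)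
  show "C o\<^sub>L (adj X o\<^sub>L X) o\<^sub>L C = T"
  proof (rule op_eqI)
    fix x
    have "cinner ((C o\<^sub>L (adj X o\<^sub>L X) o\<^sub>L C) x) x = cinner ((adj X o\<^sub>L X) (C x)) (C x)"
      by (simp add: positive_opD(2)[OF C])
    also have "\<dots> = of_real ((norm (sqrt_op T x))\<^sup>2)"
      by (simp only: form XC cinner_eq_norm)
    also have "\<dots> = cinner (T x) x"
      by (simp only: sqrt_op(4)[OF T] positive_opD(3)[OF T])
    finally show "cinner ((C o\<^sub>L (adj X o\<^sub>L X) o\<^sub>L C) x) x = cinner (T x) x" .
  qed (use clin positive_opD(1)[OF C] positive_opD(1)[OF T] in simp_all)
qed

locale pw_pair =
  fixes A B :: "'h::chilbert_space op"
  assumes A: "positive_op A" and B: "positive_op B"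
begin

definition H :: "'h op" where "H = A + B"
definition M :: "'h set" where "M = ocompl (ker_op H)"
definition P :: "'h op" where "P = proj M"
definition C :: "'h op" where "C = sqrt_op H"
definition X :: "'h op" where "X = (THE X. op_on M X \<and> norm X \<le> 1 \<and> X o\<^sub>L C = sqrt_op A)"
definition Y :: "'h op" where "Y = (THE Y. op_on M Y \<and> norm Y \<le> 1 \<and> Y o\<^sub>L C = sqrt_op B)"
definition R :: "'h op" where "R = adj X o\<^sub>L X"
definition S :: "'h op" where "S = adj Y o\<^sub>L Y"

lemma H: "positive_op H"
  unfolding H_def by (rule positive_op_add[OF A B])

lemma M: "csubspace M"
  by (simp add: M_def)

lemma C: "positive_op C" "C o\<^sub>L C = H" "C (C x) = H x"
  unfolding C_def by (rule sqrt_op[OF H])+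

lemma C_0: "C x = 0 \<longleftrightarrow> H x = 0"
  unfolding C_def by (rule sqrt_op_eq_0_iff[OF H])

lemma le_H: "inner (A x) x \<le> inner (H x) x" "inner (B x) x \<le> inner (H x) x"
  using positive_opD(4)[OF A, of x] positive_opD(4)[OF B, of x]
  by (auto simp: H_def blinfun.add_left inner_add_left)

lemma ker: "H x = 0 \<Longrightarrow> A x = 0" "H x = 0 \<Longrightarrow> B x = 0"
  using le_H[of x] positive_opD(4)[OF A, of x] positive_opD(4)[OF B, of x]
  by (simp_all add: positive_op_eq_0_iff[OF A] positive_op_eq_0_iff[OF B])

lemma op_on: "op_on M A" "op_on M B" "op_on M C" "op_on M H"
  unfolding M_def by (auto intro!: op_on_ocompl_ker positive_opD(1)[OF H] A B C(1) H dest: ker simp: C_0)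

lemma cancel: "op_on M D \<Longrightarrow> D o\<^sub>L C = 0 \<Longrightarrow> D = 0"
  by (rule op_on_cancel_right[OF positive_opD(1,2)[OF C(1)] _ M_def]) (auto simp: C_0)

lemma ex1_contraction:
  assumes T: "positive_op T" and le: "\<And>x. inner (T x) x \<le> inner (H x) x"
  shows "\<exists>!X. op_on M X \<and> norm X \<le> 1 \<and> X o\<^sub>L C = sqrt_op T"
proof (rule ex_ex1I)
  interpret positive_operator H "norm H + 1"
    by (rule positive_operator_norm[OF H])
  show "\<exists>X. op_on M X \<and> norm X \<le> 1 \<and> X o\<^sub>L C = sqrt_op T"
    using ex_contraction[OF assms] by (simp add: M_def C_def)
next
  fix U V assume "op_on M U \<and> norm U \<le> 1 \<and> U o\<^sub>L C = sqrt_op T" "op_on M V \<and> norm V \<le> 1 \<and> V o\<^sub>L C = sqrt_op T"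
  then have "op_on M (U - V)" "(U - V) o\<^sub>L C = 0"
    by (simp_all add: op_on_iff[OF M] blinfun_compose_simps)
  then show "U = V" using cancel[of "U - V"] by simp
qed

lemma X: "op_on M X" "norm X \<le> 1" "X o\<^sub>L C = sqrt_op A"
  using theI'[OF ex1_contraction[OF A le_H(1)]] unfolding X_def[symmetric] by auto

lemma Y: "op_on M Y" "norm Y \<le> 1" "Y o\<^sub>L C = sqrt_op B"
  using theI'[OF ex1_contraction[OF B le_H(2)]] unfolding Y_def[symmetric] by auto

lemma R: "op_on M R" "positive_op R" "inner (R x) x \<le> inner x x" "C o\<^sub>L R o\<^sub>L C = A"
  unfolding R_def by (rule contraction_root_props[OF M A C(1) X])+

lemma S: "op_on M S" "positive_op S" "inner (S x) x \<le> inner x x" "C o\<^sub>L S o\<^sub>L C = B"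
  unfolding S_def by (rule contraction_root_props[OF M B C(1) Y])+

lemma PC: "P o\<^sub>L C = C" "C o\<^sub>L P = C"
  using op_on(3) by (simp_all add: P_def op_on_iff[OF M])

lemma PP: "op_on M P"
  by (simp add: P_def op_on_iff[OF M] proj_idem[OF M] proj_props[OF M])

lemma M_ker: "x \<in> M \<Longrightarrow> C x = 0 \<Longrightarrow> x = 0"
proof -
  assume "x \<in> M" "C x = 0"
  then have "cinner x x = 0"
    by (auto simp: C_0 M_def ocompl_def ker_op_def)
  then show "x = 0" by (simp add: cinner_eq_norm)
qed

lemma cancel_left: "op_on M D \<Longrightarrow> C o\<^sub>L D = 0 \<Longrightarrow> D = 0"
proof (rule blinfun_eqI)
  fix x assume "op_on M D" "C o\<^sub>L D = 0"
  then have "D x \<in> M" "C (D x) = 0"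
    by (auto dest: op_onD(2) simp flip: blinfun_apply_blinfun_compose)
  then show "D x = blinfun_apply 0 x" using M_ker by simp
qed

lemma M_UNIV: "(\<And>x. H x = 0 \<Longrightarrow> x = 0) \<Longrightarrow> M = UNIV"
proof -
  assume "\<And>x. H x = 0 \<Longrightarrow> x = 0"
  then have "ker_op H = {0}"
    by (auto simp: ker_op_def blinfun.zero_right)
  then show "M = UNIV"
    by (auto simp: M_def ocompl_def)
qed

lemma op_on_compose: "op_on M U \<Longrightarrow> op_on M V \<Longrightarrow> op_on M (U o\<^sub>L V)"
  unfolding op_on_iff[OF M] by (metis clinear_op_simps(5) op_comp_assoc)

text \<open>Between two factors \<open>C\<close> the difference becomes
  \<open>A + B - H = 0\<close>, and \<open>C\<close> can be cancelled on either side among operators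
  on \<open>M\<close>.\<close>

lemma R_plus_S: "R + S = P"
proof -
  define D where "D = R + S - P"
  have D: "op_on M D"
    using R(1) S(1) PP by (simp add: D_def op_on_iff[OF M] blinfun_compose_simps)
  have "C o\<^sub>L (D o\<^sub>L C) = (C o\<^sub>L R o\<^sub>L C) + (C o\<^sub>L S o\<^sub>L C) - (C o\<^sub>L (P o\<^sub>L C))"
    by (simp add: D_def blinfun_compose_simps op_comp_assoc)
  also have "\<dots> = 0"
    by (simp add: R(4) S(4) PC C(2)) (simp add: H_def)
  finally have "D o\<^sub>L C = 0"
    by (rule cancel_left[OF op_on_compose[OF D op_on(3)]])
  then have "D = 0" by (rule cancel[OF D])
  then show ?thesis by (simp add: D_def)
qed

text \<open>With \<open>S = P - R\<close> the normal operator \<open>R + \<i> S\<close> is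
  \<open>\<i> P + (1 - \<i>) R\<close>, whose spectrum lies on the segment from \<open>\<i>\<close>
  to 1.\<close>

sublocale seg: segment_operator M \<i> "1 - \<i>" R
proof
  show "1 - \<i> \<noteq> 0"
    by (metis eq_iff_diff_eq_0 complex_i_not_one)
qed (rule M R)+

lemma seg_N: "seg.N = R + scaleC_op \<i> S"
proof -
  have S: "S = P - R" using R_plus_S by (simp add: algebra_simps)
  show ?thesis
    unfolding seg.N_def S P_def
    by (intro blinfun_eqI) (simp add: blinfun.add_left blinfun.diff_left scaleC_diff_left scaleC_diff_right)
qed

lemma compress: "compress M A = A" "compress M B = B"
  using op_on(1,2) by (simp_all add: compress_def op_on_iff[OF M])

lemma pw_calc_eq: "pw_calc f A B = C o\<^sub>L borel_calc M seg.N (\<lambda>z. f (Re z, Im z)) o\<^sub>L C"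
  unfolding pw_calc_def Let_def H_def[symmetric] M_def[symmetric] compress
  unfolding H_def[symmetric] C_def[symmetric] X_def[symmetric] Y_def[symmetric] R_def[symmetric]
    S_def[symmetric] joint_calc_def seg_N ..

lemma seg_L:
  assumes "z \<in> seg.L"
  shows "Re z = seg.\<tau> z" "Im z = 1 - seg.\<tau> z"
proof -
  have z: "\<i> + (1 - \<i>) * complex_of_real (seg.\<tau> z) = z"
    by (rule seg.\<tau>_L(1)[OF assms])
  show "Re z = seg.\<tau> z"
    by (subst z[symmetric]) simp
  show "Im z = 1 - seg.\<tau> z"
    by (subst z[symmetric]) simp
qed

text \<open>The joint spectrum of \<open>R\<close> and \<open>S\<close> lies on
  \<open>r + s = 1\<close>, so \<open>pw_calc\<close> sees \<open>f\<close> only along this segment,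
  parametrized by \<open>r\<close>.\<close>

definition segment_bounded :: "(real \<times> real \<Rightarrow> complex) \<Rightarrow> bool" where
  "segment_bounded f \<longleftrightarrow> bounded_borel (\<lambda>t. indicator {0..1} t * f (t, 1 - t))"

lemma spectrum_f_eq:
  fixes f :: "real \<times> real \<Rightarrow> complex"
  shows "indicator seg.\<sigma> z * f (Re z, Im z) = indicator seg.\<sigma> z * f (seg.\<tau> z, 1 - seg.\<tau> z)"
  using seg_L[of z] seg.spectrum_facts(3) by (auto simp: indicator_def)

lemma bb_segment:
  assumes f: "segment_bounded f"
  shows "bounded_borel (\<lambda>z. indicator seg.\<sigma> z * f (Re z, Im z))"
proof -
  have "bounded_borel (\<lambda>z. indicator seg.\<sigma> z * (indicator {0..1} (seg.\<tau> z) * f (seg.\<tau> z, 1 - seg.\<tau> z)))"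
    using bounded_borel_mult[OF seg.bb_indicator_spectrum
        bounded_borel_compose[OF f[unfolded segment_bounded_def] seg.\<tau>_measurable]] .
  also have "(\<lambda>z. indicator seg.\<sigma> z * (indicator {0..1} (seg.\<tau> z) * f (seg.\<tau> z, 1 - seg.\<tau> z)))
      = (\<lambda>z. indicator seg.\<sigma> z * f (Re z, Im z))"
    unfolding spectrum_f_eq using seg.\<tau>_L(3) seg.spectrum_facts(3)
    by (intro ext) (auto simp: indicator_def)
  finally show ?thesis .
qed

lemma pw_calc_clinear:
  assumes f: "segment_bounded f"
  shows "clinear_op (pw_calc f A B)"
  using seg.calc.\<Phi>_clinear[OF bb_segment[OF f]] positive_opD(1)[OF C(1)]
  by (simp add: pw_calc_eq seg.borel_calc_eq[OF bb_segment[OF f]])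

lemma pw_calc_form:
  assumes f: "segment_bounded f"
  shows "cinner (pw_calc f A B x) x
    = (LINT z|scalar_measure seg.E (C x). indicator seg.\<sigma> z * f (seg.\<tau> z, 1 - seg.\<tau> z))"
  using seg.calc.\<Phi>_form[OF bb_segment[OF f], of "C x"]
  by (simp add: pw_calc_eq seg.borel_calc_eq[OF bb_segment[OF f]] positive_opD(2)[OF C(1)] spectrum_f_eq)

lemma pw_calc_form_eq:
  assumes f: "segment_bounded f"
    and m: "finite_measure m" "sets m = sets borel" and w: "bounded_borel w" "\<rho> \<in> borel_measurable borel"
    and range: "\<And>z. w z \<noteq> 0 \<Longrightarrow> \<rho> z \<in> {0..1}"
    and moments: "\<And>n. (LINT z|m. w z * of_real (\<rho> z ^ n)) = cinner (op_power M R n (C x)) (C x)"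
  shows "cinner (pw_calc f A B x) x = (LINT z|m. w z * f (\<rho> z, 1 - \<rho> z))"
  unfolding pw_calc_form[OF f]
  by (rule seg.LINT_spectral_eq[OF m w range moments f[unfolded segment_bounded_def]])

lemma moment_0: "cinner (op_power M R 0 (C x)) (C x) = cinner (H x) x"
proof -
  have "proj M (C x) = C x"
    using PC(1) unfolding P_def by (metis blinfun_apply_blinfun_compose)
  then show ?thesis
    using positive_opD(2)[OF C(1), of "C x" x] by (simp add: C(3))
qed

text \<open>With a pseudo-inverse \<open>G\<close> of \<open>H\<close> the square roots disappear: \<open>C R\<^sup>n\<^sup>+\<^sup>1 C = (A G)\<^sup>n A\<close>.\<close>

lemma moment_Suc:
  assumes G: "op_on M G" "H o\<^sub>L G = P"
  shows "C o\<^sub>L op_power M R (Suc n) o\<^sub>L C = ((\<lambda>Z. A o\<^sub>L G o\<^sub>L Z) ^^ n) A"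
    "cinner (op_power M R (Suc n) (C x)) (C x) = cinner (((\<lambda>Z. A o\<^sub>L G o\<^sub>L Z) ^^ n) A x) x"
proof -
  have RP: "op_power M R n o\<^sub>L P = op_power M R n" "P o\<^sub>L op_power M R n = op_power M R n" for n
    using op_power_props(1)[OF M R(1), of n] by (simp_all add: P_def op_on_iff[OF M])
  \<comment> \<open>Multiplied by \<open>C\<close> from the left, both sides become
    \<open>C\<close>, because \<open>H o G = P\<close>; then \<open>C\<close> is cancelled.\<close>
  have CGC: "C o\<^sub>L G o\<^sub>L C = P"
  proof -
    have on: "op_on M ((C o\<^sub>L G o\<^sub>L C) - P)"
      using op_on_compose[OF op_on_compose[OF op_on(3) G(1)] op_on(3)] PP
      by (simp add: op_on_iff[OF M] blinfun_compose_simps)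
    have "C o\<^sub>L ((C o\<^sub>L G o\<^sub>L C) - P) = ((C o\<^sub>L C) o\<^sub>L G o\<^sub>L C) - (C o\<^sub>L P)"
      by (simp add: blinfun_compose_simps op_comp_assoc)
    also have "\<dots> = 0"
      by (simp add: C(2) G(2) PC)
    finally show ?thesis
      using cancel_left[OF on] by simp
  qed
  show *: "C o\<^sub>L op_power M R (Suc n) o\<^sub>L C = ((\<lambda>Z. A o\<^sub>L G o\<^sub>L Z) ^^ n) A" for n
  proof (induction n)
    case 0
    have "op_power M R (Suc 0) = R"
      using R(1) by (simp add: op_power_Suc op_on_iff[OF M])
    then show ?case by (simp add: R(4))
  next
    case (Suc n)
    have "C o\<^sub>L op_power M R (Suc (Suc n)) o\<^sub>L C = C o\<^sub>L R o\<^sub>L (P o\<^sub>L op_power M R (Suc n)) o\<^sub>L C"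
      by (simp only: RP(2)) (simp add: op_power_Suc op_comp_assoc)
    also have "\<dots> = (C o\<^sub>L R o\<^sub>L C) o\<^sub>L G o\<^sub>L (C o\<^sub>L op_power M R (Suc n) o\<^sub>L C)"
      unfolding CGC[symmetric] by (simp add: op_comp_assoc)
    finally show ?case by (simp add: R(4) Suc)
  qed
  have "cinner (op_power M R (Suc n) (C x)) (C x) = cinner ((C o\<^sub>L op_power M R (Suc n) o\<^sub>L C) x) x"
    by (simp add: positive_opD(2)[OF C(1)])
  then show "cinner (op_power M R (Suc n) (C x)) (C x) = cinner (((\<lambda>Z. A o\<^sub>L G o\<^sub>L Z) ^^ n) A x) x"
    by (simp only: *)
qed

end

section \<open>Locally bounded homogeneous functions\<close>

abbreviation (input) quadrant :: "(real \<times> real) set" where "quadrant \<equiv> {0..} \<times> {0..}"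

lemma borel_locally_boundedD:
  assumes f: "f \<in> borel_locally_bounded \<Omega>" and \<Omega>: "\<Omega> \<in> sets borel"
  shows "(\<lambda>x. indicator \<Omega> x * f x) \<in> borel_measurable borel"
    "compact K \<Longrightarrow> K \<subseteq> \<Omega> \<Longrightarrow> bounded (f ` K)"
proof -
  have "(\<lambda>x. indicator \<Omega> x *\<^sub>R f x) \<in> borel_measurable borel"
    using f \<Omega> by (simp add: borel_locally_bounded_def borel_measurable_restrict_space_iff)
  moreover have "(\<lambda>x. indicator \<Omega> x *\<^sub>R f x) = (\<lambda>x. indicator \<Omega> x * f x)"
    by (auto simp: indicator_def)
  ultimately show "(\<lambda>x. indicator \<Omega> x * f x) \<in> borel_measurable borel" by simp
  show "compact K \<Longrightarrow> K \<subseteq> \<Omega> \<Longrightarrow> bounded (f ` K)"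
    using f by (simp add: borel_locally_bounded_def)
qed

lemma borel_locally_boundedI:
  assumes meas: "(\<lambda>x. indicator \<Omega> x * f x) \<in> borel_measurable borel" and \<Omega>: "\<Omega> \<in> sets borel"
    and bdd: "\<And>K. compact K \<Longrightarrow> K \<subseteq> \<Omega> \<Longrightarrow> bounded (f ` K)"
  shows "f \<in> borel_locally_bounded \<Omega>"
proof -
  have "(\<lambda>x. indicator \<Omega> x *\<^sub>R f x) = (\<lambda>x. indicator \<Omega> x * f x)"
    by (auto simp: indicator_def)
  then show ?thesis
    using assms by (simp add: borel_locally_bounded_def borel_measurable_restrict_space_iff)
qed

lemma quadrant_borel [measurable]: "quadrant \<in> sets borel"
  by (intro borel_closed closed_Times) auto

lemma bounded_borel_along:
  assumes f: "f \<in> borel_locally_bounded \<Omega>" and \<Omega>: "\<Omega> \<in> sets borel"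
    and \<gamma>: "continuous_on UNIV \<gamma>" and K: "compact K" "\<gamma> ` K \<subseteq> \<Omega>" and D: "D \<in> sets borel" "D \<subseteq> K"
  shows "bounded_borel (\<lambda>z. indicator D z * f (\<gamma> z))"
proof -
  have "bounded (f ` \<gamma> ` K)"
    by (intro borel_locally_boundedD(2)[OF f \<Omega>] compact_continuous_image continuous_on_subset[OF \<gamma>] K) auto
  then obtain B where "\<forall>y\<in>f ` \<gamma> ` K. norm y \<le> B"
    unfolding bounded_iff by blast
  then have B: "cmod (f (\<gamma> z)) \<le> B" if "z \<in> K" for z
    using that by blast
  have "(\<lambda>z. indicator \<Omega> (\<gamma> z) * f (\<gamma> z)) \<in> borel_measurable borel"
    using measurable_compose[OF borel_measurable_continuous_onI[OF \<gamma>] borel_locally_boundedD(1)[OF f \<Omega>]] .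
  then have "(\<lambda>z. indicator D z * (indicator \<Omega> (\<gamma> z) * f (\<gamma> z))) \<in> borel_measurable borel"
    by (rule borel_measurable_times[OF borel_measurable_indicator[OF D(1)]])
  also have "(\<lambda>z. indicator D z * (indicator \<Omega> (\<gamma> z) * f (\<gamma> z))) = (\<lambda>z. indicator D z * f (\<gamma> z))"
    using K(2) D(2) by (intro ext) (auto simp: indicator_def)
  finally show ?thesis
  proof (rule bounded_borelI)
    show "cmod (indicator D z * f (\<gamma> z)) \<le> max 0 B" for z
      using B[of z] D(2) by (auto simp: indicator_def)
  qed
qed

lemma borel_calc_cong:
  assumes "\<And>z. z \<in> spectrum_on M N \<Longrightarrow> g z = g' z"
  shows "borel_calc M N g = borel_calc M N g'"
proof -
  have "(\<lambda>z. indicator (spectrum_on M N) z *\<^sub>R g z) = (\<lambda>z. indicator (spectrum_on M N) z *\<^sub>R g' z)"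
    using assms by (intro ext) (auto simp: indicator_def)
  then show ?thesis
    unfolding borel_calc_def set_lebesgue_integral_def by simp
qed

section \<open>Inverses\<close>

lemma is_inverse_unique:
  assumes "is_inverse_on UNIV T U" "is_inverse_on UNIV T V"
  shows "U = V"
proof -
  have "U = U o\<^sub>L (T o\<^sub>L V)"
    using assms(2) by (simp add: is_inverse_on_def blinfun_compose_simps)
  also have "\<dots> = (U o\<^sub>L T) o\<^sub>L V" by (simp add: op_comp_assoc)
  also have "\<dots> = V"
    using assms(1) by (simp add: is_inverse_on_def blinfun_compose_simps)
  finally show ?thesis .
qed

text \<open>An inverse of \<open>A = S o S\<close> commutes with \<open>S\<close>, so
  \<open>S\<close> times this inverse is a two-sided inverse of \<open>S\<close>.\<close>

lemma inv_sqrt_op: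
  assumes A: "positive_op A" and inv: "invertible_op A"
  defines "J \<equiv> inv_op (sqrt_op A)"
  shows "sqrt_op A o\<^sub>L J = id_blinfun" "J o\<^sub>L sqrt_op A = id_blinfun" "clinear_op J"
    "cinner (J x) y = cinner x (J y)"
proof -
  let ?S = "sqrt_op A"
  obtain A' where A': "is_inverse_on UNIV A A'"
    using inv by (auto simp: invertible_op_def)
  then have inv: "A o\<^sub>L A' = id_blinfun" "A' o\<^sub>L A = id_blinfun" "clinear_op A'"
    by (auto simp: is_inverse_on_def op_on_UNIV)
  have SS: "?S o\<^sub>L ?S = A" and S: "positive_op ?S"
    using sqrt_op[OF A] by auto
  \<comment> \<open>Inserts \<open>A o A'\<close> on the right and regroups the three factors
    \<open>?S\<close> so that \<open>A' o A\<close> cancels on the left.\<close>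
  have "A' o\<^sub>L ?S = A' o\<^sub>L (?S o\<^sub>L (?S o\<^sub>L ?S)) o\<^sub>L A'"
    using inv(1) unfolding SS by (simp add: op_comp_assoc blinfun_compose_simps)
  also have "\<dots> = (A' o\<^sub>L (?S o\<^sub>L ?S)) o\<^sub>L ?S o\<^sub>L A'"
    by (simp add: op_comp_assoc)
  also have "\<dots> = ?S o\<^sub>L A'"
    using inv(2) unfolding SS by (simp add: blinfun_compose_simps)
  finally have comm: "A' o\<^sub>L ?S = ?S o\<^sub>L A'" .
  have 1: "?S o\<^sub>L (?S o\<^sub>L A') = id_blinfun" "(?S o\<^sub>L A') o\<^sub>L ?S = id_blinfun"
    using inv(1) by (simp_all add: SS comm op_comp_assoc flip: op_comp_assoc[of ?S ?S])
  then have "is_inverse_on UNIV ?S (?S o\<^sub>L A')"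
    using inv(3) positive_opD(1)[OF S] by (simp add: is_inverse_on_def op_on_UNIV)
  then have J: "J = ?S o\<^sub>L A'"
    unfolding J_def inv_op_def by (intro the_equality) (auto intro: is_inverse_unique)
  show 2: "?S o\<^sub>L J = id_blinfun" "J o\<^sub>L ?S = id_blinfun" and "clinear_op J"
    using 1 inv(3) positive_opD(1)[OF S] by (auto simp: J)
  have SJ: "?S (J x) = x" for x
    using 2(1) by (metis blinfun_apply_blinfun_compose blinfun_apply_id_blinfun id_apply)
  show "cinner (J x) y = cinner x (J y)"
    using positive_opD(2)[OF S, of "J x" "J y"] by (simp add: SJ)
qed

lemma invertible_positive_bound:
  assumes A: "positive_op A" and inv: "invertible_op A"
  shows "\<exists>k>0. \<forall>x. inner x x \<le> k * inner (A x) x"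
proof -
  let ?J = "inv_op (sqrt_op A)"
  have "inner x x \<le> ((norm ?J)\<^sup>2 + 1) * inner (A x) x" for x
  proof -
    have "x = ?J (sqrt_op A x)"
      using inv_sqrt_op(2)[OF A inv] by (metis blinfun_apply_blinfun_compose blinfun_apply_id_blinfun id_apply)
    then have "norm x \<le> norm ?J * norm (sqrt_op A x)"
      by (metis norm_blinfun)
    then have "(norm x)\<^sup>2 \<le> (norm ?J * norm (sqrt_op A x))\<^sup>2"
      by (intro power_mono) auto
    also have "\<dots> = (norm ?J)\<^sup>2 * inner (A x) x"
      by (simp add: power_mult_distrib sqrt_op(4)[OF A])
    also have "\<dots> \<le> ((norm ?J)\<^sup>2 + 1) * inner (A x) x"
      using positive_opD(4)[OF A, of x] by (intro mult_right_mono) auto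
    finally show ?thesis by (simp add: power2_norm_eq_inner)
  qed
  moreover have "0 < (norm ?J)\<^sup>2 + 1"
    by (simp add: add_nonneg_pos)
  ultimately show ?thesis by blast
qed

lemma inner_le_norm: "inner (T x) x \<le> norm T * inner x x" for T :: "'h::chilbert_space op"
proof -
  have "inner (T x) x \<le> norm (T x) * norm x" by (rule norm_cauchy_schwarz)
  also have "\<dots> \<le> norm T * norm x * norm x" by (intro mult_right_mono norm_blinfun) auto
  finally show ?thesis by (simp add: power2_norm_eq_inner[symmetric] power2_eq_square mult.assoc)
qed

context segment_operator
begin

text \<open>The same \<open>N\<close> is rewritten with the contraction
  \<open>(T - k proj M) / (k' - k)\<close>; the inclusion of the spectrum in the segment of that
  contraction is the claim.\<close>

lemma spectrum_subset_segment:
  assumes k: "k < k'" and lower: "\<And>x. k * inner (proj M x) x \<le> inner (T x) x"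
    and upper: "\<And>x. inner (T x) x \<le> k' * inner (proj M x) x"
  shows "\<sigma> \<subseteq> (\<lambda>t. c + d * complex_of_real t) ` {k..k'}"
proof -
  define T' where "T' = (1 / (k' - k)) *\<^sub>R (T - k *\<^sub>R proj M)"
  have inner_T': "inner (T' x) x = (inner (T x) x - k * inner (proj M x) x) / (k' - k)" for x
    by (simp add: T'_def blinfun.scaleR_left blinfun.diff_left inner_diff_left)
  have P_form: "inner (proj M x) x = (norm (proj M x))\<^sup>2" for x
    using cinner_proj_self(1)[OF M, of x] by (metis Re_cinner Re_complex_of_real)
  have "segment_operator M (d * complex_of_real (k' - k)) T'"
  proof
    show "op_on M T'"
      using T(1) by (simp add: T'_def op_on_iff[OF M] blinfun_compose_simps proj_idem[OF M] proj_props[OF M])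
    then have clin: "clinear_op T'" by (rule op_onD)
    show "positive_op T'"
    proof (rule positive_opI[OF clin])
      fix x
      have "cinner (T' x) x = of_real (inner (T' x) x)"
        using positive_opD(3)[OF T(2), of x] cinner_proj_self(1)[OF M, of x] k unfolding inner_T' P_form
        by (simp add: T'_def blinfun.scaleR_left blinfun.diff_left cinner.scaleR_left cinner.diff_left
            scaleR_conv_of_real)
      moreover have "0 \<le> inner (T' x) x"
        using lower[of x] k by (simp add: inner_T')
      ultimately show "\<exists>r\<ge>0. cinner (T' x) x = of_real r" by blast
    qed
    fix x
    have "inner (T' x) x \<le> inner (proj M x) x"
      using upper[of x] k by (simp add: inner_T' field_simps)
    also have "\<dots> \<le> inner x x"
      using cinner_proj_self(2)[OF M, of x] by (simp add: P_form power_mono flip: power2_norm_eq_inner)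
    finally show "inner (T' x) x \<le> inner x x" .
  qed (use M d k in auto)
  then interpret s: segment_operator M "c + d * complex_of_real k" "d * complex_of_real (k' - k)" T' .
  have "s.N = N"
  proof (rule blinfun_eqI)
    fix x
    have "d * complex_of_real (k' - k) * complex_of_real (1 / (k' - k)) = d"
      using k by (simp add: field_simps del: of_real_diff flip: of_real_mult)
    then have "(d * complex_of_real (k' - k)) *\<^sub>C T' x = d *\<^sub>C (T x - k *\<^sub>R proj M x)"
      by (simp only: T'_def blinfun.scaleR_left blinfun.diff_left scaleR_scaleC[of "1 / (k' - k)"] scaleC_scaleC)
    then show "s.N x = N x"
      unfolding s.N_def N_def
      by (simp add: blinfun.add_left scaleR_scaleC scaleC_scaleC scaleC_diff_right scaleC_add_left)
  qed
  then have "\<sigma> \<subseteq> s.L" using s.spectrum_facts(3) by simp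
  also have "\<dots> \<subseteq> (\<lambda>t. c + d * complex_of_real t) ` {k..k'}"
  proof
    fix z assume "z \<in> s.L"
    then obtain t where t: "t \<in> {0..1}" "z = c + d * complex_of_real k + d * complex_of_real (k' - k) * complex_of_real t"
      unfolding s.L_def by blast
    have "(k' - k) * t \<le> k' - k" "0 \<le> (k' - k) * t"
      using t k by (auto simp: mult_left_le)
    then have "k + (k' - k) * t \<in> {k..k'}" by auto
    moreover have "z = c + d * complex_of_real (k + (k' - k) * t)"
      unfolding t(2) by (simp add: algebra_simps)
    ultimately show "z \<in> (\<lambda>t. c + d * complex_of_real t) ` {k..k'}" by blast
  qed
  finally show ?thesis .
qed

end

lemma (in positive_operator) spectrum_between:
  assumes ab: "a < b" and lower: "\<And>x. a * inner x x \<le> inner (A x) x" and upper: "\<And>x. inner (A x) x \<le> b * inner x x"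
    and z: "z \<in> spectrum_on UNIV A"
  shows "a \<le> Re z" "Re z \<le> b"
proof -
  have "\<sigma> \<subseteq> (\<lambda>t. 0 + complex_of_real K * complex_of_real t) ` {a / K..b / K}"
    using K(1) ab lower upper
    by (intro spectrum_subset_segment) (auto simp: divide_strict_right_mono blinfun.scaleR_left divide_right_mono)
  then obtain t where "t \<in> {a / K..b / K}" "z = complex_of_real K * complex_of_real t"
    using z by (auto simp: N_eq)
  then show "a \<le> Re z" "Re z \<le> b"
    using K(1) by (auto simp: field_simps)
qed

section \<open>The calculus when one of the operators is invertible\<close>

lemma closed_quadrant_segment: "continuous_on UNIV (\<lambda>t::real. (t, 1 - t))" "(\<lambda>t. (t, 1 - t)) ` {0..1} \<subseteq> quadrant"
  by (auto intro!: continuous_intros)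

context pw_pair
begin

lemma segment_boundedI:
  assumes f: "f \<in> borel_locally_bounded quadrant"
  shows "segment_bounded f"
  unfolding segment_bounded_def
  by (rule bounded_borel_along[OF f quadrant_borel closed_quadrant_segment(1) compact_Icc closed_quadrant_segment(2)])
    auto

text \<open>Exchanging \<open>A\<close> and \<open>B\<close> keeps \<open>H\<close>,
  \<open>M\<close> and \<open>C\<close> and exchanges \<open>R\<close> with
  \<open>S = P - R\<close>. The moments of \<open>R\<close> are therefore integrals of
  \<open>(1 - \<tau>)^n\<close> against the spectral measure belonging to \<open>S\<close>.\<close>

lemma pw_calc_swap:
  assumes f: "segment_bounded f"
  shows "pw_calc f A B = pw_calc (\<lambda>(r, s). f (s, r)) B A"
proof -
  interpret ba: pw_pair B A by unfold_locales (rule B A)+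
  have H_eq: "ba.H = H" by (simp add: ba.H_def H_def add.commute)
  then have M_eq: "ba.M = M" and C_eq: "ba.C = C"
    by (simp_all add: ba.M_def M_def ba.C_def C_def)
  then have X_eq: "ba.X = Y" by (simp add: ba.X_def Y_def)
  then have R_eq: "ba.R = S" by (simp add: ba.R_def S_def)
  have f': "ba.segment_bounded (\<lambda>(r, s). f (s, r))"
  proof -
    have "(\<lambda>t. 1 - t) \<in> borel_measurable (borel :: real measure)" by measurable
    from bounded_borel_compose[OF f[unfolded segment_bounded_def] this]
    have "bounded_borel (\<lambda>t. indicator {0..1} (1 - t) * f (1 - t, 1 - (1 - t)))" .
    also have "(\<lambda>t. indicator {0..1} (1 - t) * f (1 - t, 1 - (1 - t))) = (\<lambda>t. indicator {0..1} t * f (1 - t, t))"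
      by (intro ext) (auto simp: indicator_def)
    finally show ?thesis
      by (simp add: ba.segment_bounded_def)
  qed
  let ?w = "indicator ba.seg.\<sigma> :: complex \<Rightarrow> complex"
  have bb\<tau>: "bounded_borel (\<lambda>z. ?w z * complex_of_real (1 - ba.seg.\<tau> z))"
    unfolding ba.seg.\<tau>_def using ba.seg.d by (intro ba.seg.bb_spectrum continuous_intros) auto
  have bb: "bounded_borel (\<lambda>z. ?w z * complex_of_real ((1 - ba.seg.\<tau> z) ^ n))" for n
    unfolding ba.seg.\<tau>_def using ba.seg.d by (intro ba.seg.bb_spectrum continuous_intros) auto
  have \<Phi>1: "ba.seg.calc.\<Phi> (\<lambda>z. ?w z * complex_of_real (1 - ba.seg.\<tau> z)) = R"
  proof -
    have "ba.seg.calc.\<Phi> (\<lambda>z. ?w z * complex_of_real (1 - ba.seg.\<tau> z))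
        = ba.seg.calc.\<Phi> (\<lambda>z. ?w z - ?w z * complex_of_real (ba.seg.\<tau> z ^ 1))"
      by (simp add: algebra_simps)
    also have "\<dots> = proj ba.M - op_power ba.M ba.R 1"
      by (simp only: ba.seg.calc.\<Phi>_diff[OF ba.seg.bb_indicator_spectrum ba.seg.bb_spectrum[OF ba.seg.\<tau>_continuous]]
          ba.seg.calc_\<tau> ba.seg.calc.\<Phi>_indicator[OF ba.seg.spectrum_facts(2)] ba.seg.E_spectrum)
    also have "op_power ba.M ba.R 1 = S"
      using S(1) by (simp add: op_power_Suc op_on_iff[OF M] M_eq R_eq)
    also have "proj ba.M - S = R"
      using R_plus_S by (simp add: M_eq P_def algebra_simps)
    finally show ?thesis .
  qed
  have \<Phi>n: "ba.seg.calc.\<Phi> (\<lambda>z. ?w z * complex_of_real ((1 - ba.seg.\<tau> z) ^ n)) = op_power M R n" for n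
  proof (induction n)
    case 0
    have "ba.seg.calc.\<Phi> ?w = proj ba.M"
      by (simp only: ba.seg.calc.\<Phi>_indicator[OF ba.seg.spectrum_facts(2)] ba.seg.E_spectrum)
    then show ?case
      unfolding M_eq by simp
  next
    case (Suc n)
    have "(\<lambda>z. ?w z * complex_of_real ((1 - ba.seg.\<tau> z) ^ Suc n))
        = (\<lambda>z. (?w z * complex_of_real (1 - ba.seg.\<tau> z)) * (?w z * complex_of_real ((1 - ba.seg.\<tau> z) ^ n)))"
      by (intro ext) (auto simp: indicator_def)
    then show ?case
      using ba.seg.calc.\<Phi>_mult[OF bb\<tau> bb[of n]] \<Phi>1 Suc by (simp only: op_power_Suc)
  qed
  show ?thesis
  proof (rule op_eqI[OF pw_calc_clinear[OF f] ba.pw_calc_clinear[OF f']])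
    fix x
    have "cinner (pw_calc f A B x) x = (LINT z|scalar_measure ba.seg.E (C x).
        ?w z * f (1 - ba.seg.\<tau> z, 1 - (1 - ba.seg.\<tau> z)))"
    proof (rule pw_calc_form_eq[OF f ba.seg.calc.finite ba.seg.calc.sets ba.seg.bb_indicator_spectrum])
      show "(\<lambda>z. 1 - ba.seg.\<tau> z) \<in> borel_measurable borel" by measurable
      show "1 - ba.seg.\<tau> z \<in> {0..1}" if "?w z \<noteq> 0" for z
        using ba.seg.\<tau>_L(3)[of z] that ba.seg.spectrum_facts(3) by (auto simp: indicator_def split: if_splits)
      show "(LINT z|scalar_measure ba.seg.E (C x). ?w z * complex_of_real ((1 - ba.seg.\<tau> z) ^ n))
          = cinner (op_power M R n (C x)) (C x)" for n
        using ba.seg.calc.\<Phi>_form[OF bb[of n], of "C x"] unfolding \<Phi>n by simp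
    qed
    also have "\<dots> = cinner (pw_calc (\<lambda>(r, s). f (s, r)) B A x) x"
      using ba.pw_calc_form[OF f', of x] by (simp add: C_eq)
    finally show "cinner (pw_calc f A B x) x = cinner (pw_calc (\<lambda>(r, s). f (s, r)) B A x) x" .
  qed
qed

text \<open>The substitution \<open>r = 1 / (1 + t)\<close> turns the integral over the spectrum of \<open>R\<close> into one over
  the spectrum of \<open>T\<close> with the weight \<open>1 + t\<close>, which homogeneity absorbs into \<open>f\<close>.\<close>

lemma pw_calc_left_invertible:
  assumes inv: "invertible_op A"
    and f: "f \<in> borel_locally_bounded quadrant" and hom: "homogeneous_on {0..} f"
  shows "pw_calc f A B = sqrt_op A o\<^sub>L
    selfadjoint_calc (\<lambda>t. f (1, t)) (inv_op (sqrt_op A) o\<^sub>L B o\<^sub>L inv_op (sqrt_op A)) o\<^sub>L sqrt_op A"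
proof -
  define Q where "Q = sqrt_op A"
  define J where "J = inv_op Q"
  define T where "T = J o\<^sub>L B o\<^sub>L J"
  have Q: "positive_op Q" "Q o\<^sub>L Q = A"
    unfolding Q_def by (rule sqrt_op[OF A])+
  have QJ: "Q o\<^sub>L J = id_blinfun" "J o\<^sub>L Q = id_blinfun" "clinear_op J" "\<And>x y. cinner (J x) y = cinner x (J y)"
    unfolding J_def Q_def by (rule inv_sqrt_op[OF A inv])+
  have T: "positive_op T"
  proof (rule positive_opI)
    show "clinear_op T"
      using QJ(3) positive_opD(1)[OF B] by (simp add: T_def)
    show "\<exists>r\<ge>0. cinner (T x) x = of_real r" for x
      using positive_opD(3,4)[OF B, of "J x"] by (auto simp: T_def QJ(4))
  qed
  interpret t: positive_operator T "norm T + 1"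
    by (rule positive_operator_norm[OF T])
  let ?h1 = "\<lambda>t::real. complex_of_real (1 + t)" and ?hv = "\<lambda>t::real. complex_of_real (1 / (1 + t))"
  have adm1: "t.admissible ?h1"
    using t.admissible_shift[of 1] by (simp add: add.commute)
  have admv: "t.admissible ?hv"
    by (rule t.admissibleI[of _ 1]) (auto simp del: of_real_add of_real_divide simp: divide_le_eq)
  define V where "V = t.fc ?hv"
  have fc1: "t.fc ?h1 = id_blinfun + T"
    using t.fc_shift[of 1] by (simp add: add.commute)
  have V_inv: "(id_blinfun + T) o\<^sub>L V = id_blinfun" "V o\<^sub>L (id_blinfun + T) = id_blinfun"
  proof -
    have "t.fc (\<lambda>t. ?h1 t * ?hv t) = t.fc (\<lambda>_. 1)" "t.fc (\<lambda>t. ?hv t * ?h1 t) = t.fc (\<lambda>_. 1)"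
      by (intro t.fc_cong; simp flip: of_real_mult del: of_real_add of_real_divide)+
    then show "(id_blinfun + T) o\<^sub>L V = id_blinfun" "V o\<^sub>L (id_blinfun + T) = id_blinfun"
      using t.fc_mult[OF adm1 admv] t.fc_mult[OF admv adm1] unfolding V_def fc1[symmetric] t.fc_one
      by simp_all
  qed
  have H_eq: "H = Q o\<^sub>L (id_blinfun + T) o\<^sub>L Q"
  proof -
    have "Q o\<^sub>L (id_blinfun + T) o\<^sub>L Q = (Q o\<^sub>L Q) + ((Q o\<^sub>L J) o\<^sub>L B o\<^sub>L (J o\<^sub>L Q))"
      by (simp add: T_def blinfun_compose_simps op_comp_assoc)
    then show ?thesis
      by (simp add: QJ Q(2) blinfun_compose_simps H_def)
  qed
  \<comment> \<open>The inverse of \<open>H = Q (1 + T) Q\<close>, factor by factor.\<close>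
  define G where "G = J o\<^sub>L V o\<^sub>L J"
  have "H o\<^sub>L G = Q o\<^sub>L ((id_blinfun + T) o\<^sub>L ((Q o\<^sub>L J) o\<^sub>L V)) o\<^sub>L J"
    by (simp add: H_eq G_def op_comp_assoc)
  then have HG: "H o\<^sub>L G = id_blinfun"
    by (simp only: QJ V_inv blinfun_compose_simps(9,10))
  have "G o\<^sub>L H = J o\<^sub>L (V o\<^sub>L ((J o\<^sub>L Q) o\<^sub>L (id_blinfun + T))) o\<^sub>L Q"
    by (simp add: H_eq G_def op_comp_assoc)
  then have GH: "G o\<^sub>L H = id_blinfun"
    by (simp only: QJ V_inv blinfun_compose_simps(9,10))
  have M_eq: "M = UNIV"
    using GH by (intro M_UNIV)
      (metis blinfun.zero_right blinfun_apply_blinfun_compose blinfun_apply_id_blinfun id_apply)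
  have V_clin: "clinear_op V"
    unfolding V_def by (rule t.fc_clinear[OF admv])
  have G: "op_on M G" "H o\<^sub>L G = P"
    using QJ(3) V_clin HG by (simp_all add: M_eq op_on_UNIV G_def P_def)
  have adm_n: "t.admissible (\<lambda>t. complex_of_real ((1 / (1 + t)) ^ n))" for n
    by (rule t.admissibleI[of _ 1])
      (auto simp del: of_real_add of_real_divide of_real_power simp: power_le_one)
  define F where "F n = t.fc (\<lambda>t. complex_of_real ((1 / (1 + t)) ^ n))" for n
  have F_Suc: "F (Suc n) = V o\<^sub>L F n" for n
    unfolding F_def V_def using t.fc_mult[OF admv adm_n[of n]] by simp
  have F_0: "F 0 = id_blinfun"
    by (simp add: F_def t.fc_one)
  \<comment> \<open>Here \<open>A o G = Q o V o J\<close>, so the inner factors \<open>J o Q\<close>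
    cancel and the product telescopes to \<open>Q V^n Q\<close>.\<close>
  have Z: "((\<lambda>Z. A o\<^sub>L G o\<^sub>L Z) ^^ n) A = Q o\<^sub>L F n o\<^sub>L Q" for n
  proof (induction n)
    case 0
    show ?case by (simp add: F_0 blinfun_compose_simps Q(2))
  next
    case (Suc n)
    have "((\<lambda>Z. A o\<^sub>L G o\<^sub>L Z) ^^ Suc n) A = A o\<^sub>L G o\<^sub>L (Q o\<^sub>L F n o\<^sub>L Q)"
      by (simp add: Suc)
    also have "\<dots> = Q o\<^sub>L ((Q o\<^sub>L J) o\<^sub>L V o\<^sub>L (J o\<^sub>L Q)) o\<^sub>L F n o\<^sub>L Q"
      by (simp add: G_def op_comp_assoc flip: Q(2))
    finally show ?case
      by (simp add: QJ blinfun_compose_simps F_Suc op_comp_assoc)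
  qed
  let ?w = "\<lambda>z. indicator t.\<sigma> z * ?h1 (Re z)" and ?\<rho> = "\<lambda>z. 1 / (1 + Re z)"
  have sb: "segment_bounded f" by (rule segment_boundedI[OF f])
  have bb: "bounded_borel (\<lambda>z. indicator t.\<sigma> z * f (1, Re z))"
  proof (rule bounded_borel_along[OF f quadrant_borel, where \<gamma> = "\<lambda>z. (1, Re z)" and K = t.L])
    show "t.\<sigma> \<in> sets borel" "t.\<sigma> \<subseteq> t.L" "compact t.L"
      by (rule t.spectrum_facts t.compact_L)+
    have "0 \<le> Re z" if z: "z \<in> t.L" for z
    proof -
      obtain s where "s \<in> {0..1}" "z = 0 + complex_of_real (norm T + 1) * complex_of_real s"
        using z unfolding t.L_def by blast
      then show ?thesis
        using t.K(1) by (simp del: of_real_add flip: of_real_mult)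
    qed
    then show "(\<lambda>z. (1, Re z)) ` t.L \<subseteq> quadrant"
      by auto
  qed (intro continuous_intros)
  have form: "cinner (pw_calc f A B x) x = (LINT z|scalar_measure t.E (Q x). ?w z * f (?\<rho> z, 1 - ?\<rho> z))" for x
  proof (rule pw_calc_form_eq[OF sb t.calc.finite t.calc.sets t.bb_admissible[OF adm1]])
    show "?\<rho> \<in> borel_measurable borel" by measurable
    show "?\<rho> z \<in> {0..1}" if "?w z \<noteq> 0" for z
      using t.spectrum_real[of z] that by (auto simp: indicator_def divide_le_eq split: if_splits)
    fix n
    \<comment> \<open>The weight \<open>1 + t\<close> gives the form of \<open>H\<close> for
      \<open>n = 0\<close> and cancels one factor \<open>1 / (1 + t)\<close> otherwise, which
      matches the index shift in \<open>moment_Suc\<close>.\<close>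
    show "(LINT z|scalar_measure t.E (Q x). ?w z * complex_of_real (?\<rho> z ^ n)) = cinner (op_power M R n (C x)) (C x)"
    proof (cases n)
      case 0
      have "(LINT z|scalar_measure t.E (Q x). ?w z * complex_of_real (?\<rho> z ^ n)) = cinner (t.fc ?h1 (Q x)) (Q x)"
        using t.fc_form[OF adm1] 0 by simp
      also have "\<dots> = cinner (H x) x"
        unfolding fc1 by (simp add: H_eq positive_opD(2)[OF Q(1)])
      finally show ?thesis by (simp add: 0 moment_0 del: op_power_0)
    next
      case (Suc k)
      have "?w z * complex_of_real (?\<rho> z ^ n) = indicator t.\<sigma> z * complex_of_real ((1 / (1 + Re z)) ^ k)" for z
        using t.spectrum_real(2)[of z]
        by (auto simp: indicator_def Suc simp del: of_real_add of_real_divide of_real_power simp flip: of_real_mult)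
      then have "(LINT z|scalar_measure t.E (Q x). ?w z * complex_of_real (?\<rho> z ^ n)) = cinner (F k (Q x)) (Q x)"
        using t.fc_form[OF adm_n[of k]] by (simp only: F_def)
      also have "\<dots> = cinner ((Q o\<^sub>L F k o\<^sub>L Q) x) x"
        by (simp add: positive_opD(2)[OF Q(1)])
      finally show ?thesis
        unfolding Suc moment_Suc(2)[OF G] Z .
    qed
  qed
  have hom1: "?w z * f (?\<rho> z, 1 - ?\<rho> z) = indicator t.\<sigma> z * f (1, Re z)" for z
  proof (cases "z \<in> t.\<sigma>")
    case True
    then have pos: "0 \<le> Re z" by (rule t.spectrum_real)
    have "f ((1 + Re z) * ?\<rho> z, (1 + Re z) * (1 - ?\<rho> z)) = complex_of_real (1 + Re z) * f (?\<rho> z, 1 - ?\<rho> z)"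
    proof (rule hom[unfolded homogeneous_on_def, rule_format])
      show "1 + Re z \<in> {0..}" "?\<rho> z \<in> {0..}" "1 - ?\<rho> z \<in> {0..}"
        using pos by (simp_all add: divide_le_eq)
    qed
    moreover have "(1 + Re z) * ?\<rho> z = 1" "(1 + Re z) * (1 - ?\<rho> z) = Re z"
      using pos by (simp_all add: field_simps)
    ultimately show ?thesis using True by simp
  qed simp
  define c where "c = borel_calc UNIV t.N (\<lambda>z. f (1, Re z))"
  have c: "clinear_op c" "cinner (c y) y = (LINT z|scalar_measure t.E y. indicator t.\<sigma> z * f (1, Re z))" for y
    unfolding c_def t.borel_calc_eq[OF bb] by (rule t.calc.\<Phi>_clinear[OF bb] t.calc.\<Phi>_form[OF bb])+
  have "pw_calc f A B = Q o\<^sub>L c o\<^sub>L Q"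
  proof (rule op_eqI[OF pw_calc_clinear[OF sb]])
    show "clinear_op (Q o\<^sub>L c o\<^sub>L Q)"
      using c(1) positive_opD(1)[OF Q(1)] by simp
    show "cinner (pw_calc f A B x) x = cinner ((Q o\<^sub>L c o\<^sub>L Q) x) x" for x
      unfolding form hom1 using c(2)[of "Q x"] positive_opD(2)[OF Q(1)] by simp
  qed
  then have "pw_calc f A B = Q o\<^sub>L borel_calc UNIV T (\<lambda>z. f (1, Re z)) o\<^sub>L Q"
    unfolding c_def t.N_eq .
  then show ?thesis
    unfolding selfadjoint_calc_def Q_def J_def T_def .
qed

end

section \<open>The second operator invertible, and both operators invertible\<close>

lemma borel_locally_bounded_swap:
  assumes f: "f \<in> borel_locally_bounded quadrant"
  shows "(\<lambda>(r, s). f (s, r)) \<in> borel_locally_bounded quadrant"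
proof (rule borel_locally_boundedI[OF _ quadrant_borel])
  have swap: "continuous_on UNIV (prod.swap :: real \<times> real \<Rightarrow> _)"
    by (rule continuous_on_swap)
  have "(\<lambda>x. indicator quadrant (prod.swap x) * f (prod.swap x)) \<in> borel_measurable borel"
    using measurable_compose[OF borel_measurable_continuous_onI[OF swap] borel_locally_boundedD(1)[OF f quadrant_borel]] .
  also have "(\<lambda>x. indicator quadrant (prod.swap x) * f (prod.swap x)) = (\<lambda>x. indicator quadrant x * (case x of (r, s) \<Rightarrow> f (s, r)))"
    by (intro ext) (auto simp: indicator_def)
  finally show "(\<lambda>x. indicator quadrant x * (case x of (r, s) \<Rightarrow> f (s, r))) \<in> borel_measurable borel" .
  fix K :: "(real \<times> real) set" assume K: "compact K" "K \<subseteq> quadrant"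
  have "bounded (f ` prod.swap ` K)"
    by (intro borel_locally_boundedD(2)[OF f quadrant_borel] compact_continuous_image
        continuous_on_subset[OF swap] K) (use K in auto)
  also have "f ` prod.swap ` K = (\<lambda>(r, s). f (s, r)) ` K"
    unfolding image_image by (intro image_cong) auto
  finally show "bounded ((\<lambda>(r, s). f (s, r)) ` K)" .
qed

lemma invertible_op_if_bounded_below:
  assumes A: "positive_op A" and k: "0 < k" and bound: "\<And>x. inner x x \<le> k * inner (A x) x"
  shows "invertible_op A"
proof -
  interpret positive_operator A "norm A + 1"
    by (rule positive_operator_norm[OF A])
  have "0 \<notin> spectrum_on UNIV A"
  proof
    assume z: "0 \<in> spectrum_on UNIV A"
    have "1 / k \<le> Re 0"
    \<comment> \<open>The upper end bounds \<open>A\<close> and is raised above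
      \<open>1 / k\<close>, since \<open>spectrum_between\<close> takes a nondegenerate
      interval.\<close>
    proof (rule spectrum_between(1)[of "1 / k" "max (1 / k) (norm A) + 1", OF _ _ _ z])
      show "1 / k * inner x x \<le> inner (A x) x" for x
        using bound[of x] k by (simp add: field_simps)
      show "inner (A x) x \<le> (max (1 / k) (norm A) + 1) * inner x x" for x
        by (rule order.trans[OF inner_le_norm mult_right_mono]) auto
    qed auto
    then show False using k by simp
  qed
  then obtain T where T: "is_inverse_on UNIV (scaleC_op 0 (proj UNIV) - A) T"
    by (auto simp: spectrum_on_def)
  have "scaleC_op 0 (proj UNIV) - A = - A"
    by (intro blinfun_eqI) (simp add: blinfun.diff_left blinfun.minus_left)
  then have "is_inverse_on UNIV A (- T)"
  proof -
    assume "scaleC_op 0 (proj UNIV) - A = - A"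
    then have T': "clinear_op T" "(- A) o\<^sub>L T = id_blinfun" "T o\<^sub>L (- A) = id_blinfun"
      using T by (simp_all add: is_inverse_on_def op_on_UNIV)
    have "A o\<^sub>L (- T) = (- A) o\<^sub>L T" "(- T) o\<^sub>L A = T o\<^sub>L (- A)"
      by (auto intro!: blinfun_eqI simp: blinfun.minus_left blinfun.minus_right)
    then show ?thesis
      using T' by (simp add: is_inverse_on_def op_on_UNIV)
  qed
  then show ?thesis
    by (auto simp: invertible_op_def)
qed

context pw_pair
begin

lemma pw_calc_right_invertible:
  assumes inv: "invertible_op B"
    and f: "f \<in> borel_locally_bounded quadrant" and hom: "homogeneous_on {0..} f"
  shows "pw_calc f A B = sqrt_op B o\<^sub>L
    selfadjoint_calc (\<lambda>t. f (t, 1)) (inv_op (sqrt_op B) o\<^sub>L A o\<^sub>L inv_op (sqrt_op B)) o\<^sub>L sqrt_op B"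
proof -
  interpret ba: pw_pair B A by unfold_locales (rule B A)+
  have "homogeneous_on {0..} (\<lambda>(r, s). f (s, r))"
    using hom by (auto simp: homogeneous_on_def)
  from ba.pw_calc_left_invertible[OF inv borel_locally_bounded_swap[OF f] this] show ?thesis
    by (simp add: pw_calc_swap[OF segment_boundedI[OF f]])
qed

text \<open>Since \<open>C\<close> is onto and the form of \<open>R\<close> at \<open>C x\<close> is
  that of \<open>A\<close> at \<open>x\<close>, the bounds \<open>a A \<le> B \<le> b A\<close>
  confine the spectrum of \<open>R\<close> to \<open>[1 / (1 + b), 1 / (1 + a)]\<close>. On the
  segment this says that \<open>s / r\<close> lies in \<open>[a, b]\<close>.\<close>

lemma pw_calc_cong:
  assumes A': "invertible_op A" and a: "0 < a" "a < b"
    and lower: "\<And>x. a * inner (A x) x \<le> inner (B x) x" and upper: "\<And>x. inner (B x) x \<le> b * inner (A x) x"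
    and eq: "\<And>r s. 0 < r \<Longrightarrow> a * r \<le> s \<Longrightarrow> s \<le> b * r \<Longrightarrow> f (r, s) = g (r, s)"
  shows "pw_calc f A B = pw_calc g A B"
proof -
  obtain k where k: "0 < k" "\<And>x. inner x x \<le> k * inner (A x) x"
    using invertible_positive_bound[OF A A'] by blast
  have "inner x x \<le> k * inner (H x) x" for x
    by (rule order.trans[OF k(2) mult_left_mono[OF le_H(1)]]) (use k in auto)
  then have inv_H: "invertible_op H"
    by (rule invertible_op_if_bounded_below[OF H k(1)])
  note CJ = inv_sqrt_op[OF H inv_H, folded C_def]
  have surj: "C (inv_op C y) = y" for y
    using CJ(1) by (metis blinfun_apply_blinfun_compose blinfun_apply_id_blinfun id_apply)
  have M_eq: "M = UNIV"
    using CJ(2) by (intro M_UNIV)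
      (metis C_0 blinfun.zero_right blinfun_apply_blinfun_compose blinfun_apply_id_blinfun id_apply)
  have RC: "inner (R (C x)) (C x) = inner (A x) x" for x
  proof -
    have "cinner (R (C x)) (C x) = cinner ((C o\<^sub>L R o\<^sub>L C) x) x"
      by (simp add: positive_opD(2)[OF C(1)])
    then show ?thesis by (metis R(4) Re_cinner)
  qed
  have CC: "inner (C x) (C x) = inner (H x) x" for x
    unfolding C_def using sqrt_op(4)[OF H, of x] by (simp add: power2_norm_eq_inner)
  have "seg.\<sigma> \<subseteq> (\<lambda>t. \<i> + (1 - \<i>) * complex_of_real t) ` {1 / (1 + b)..1 / (1 + a)}"
  proof (rule seg.spectrum_subset_segment)
    show "1 / (1 + b) < 1 / (1 + a)"
      using a by (intro divide_strict_left_mono) auto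
    fix y
    define x where "x = inv_op C y"
    have y: "y = C x" by (simp add: x_def surj)
    have HA: "inner (H x) x = inner (A x) x + inner (B x) x"
      by (simp add: H_def blinfun.add_left inner_add_left)
    show "1 / (1 + b) * inner (proj M y) y \<le> inner (R y) y"
      unfolding M_eq y using upper[of x] a by (simp add: RC CC HA field_simps)
    show "inner (R y) y \<le> 1 / (1 + a) * inner (proj M y) y"
      unfolding M_eq y using lower[of x] a by (simp add: RC CC HA field_simps)
  qed
  then have "f (Re z, Im z) = g (Re z, Im z)" if z: "z \<in> seg.\<sigma>" for z
  proof -
    obtain t where t: "t \<in> {1 / (1 + b)..1 / (1 + a)}" "z = \<i> + (1 - \<i>) * complex_of_real t"
      using z \<open>seg.\<sigma> \<subseteq> _\<close> by blast
    then have z: "Re z = t" "Im z = 1 - t" by simp_all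
    have "0 < 1 / (1 + b)" using a by simp
    then have "0 < t" using t(1) by (metis atLeastAtMost_iff less_le_trans)
    moreover have "a * t \<le> 1 - t" "1 - t \<le> b * t"
      using t(1) a by (simp_all add: field_simps)
    ultimately show ?thesis
      unfolding z by (intro eq)
  qed
  then have "borel_calc M seg.N (\<lambda>z. f (Re z, Im z)) = borel_calc M seg.N (\<lambda>z. g (Re z, Im z))"
    by (rule borel_calc_cong)
  then show ?thesis
    unfolding pw_calc_eq by simp
qed

end

text \<open>The counterpart for the other side of the formula: substituting \<open>J x\<close> into
  \<open>a A \<le> B \<le> b A\<close> bounds the form of \<open>T\<close> between \<open>a\<close>
  and \<open>b\<close> times the squared norm.\<close>

lemma conjugate_spectrum:
  fixes A B :: "'h::chilbert_space op"
  assumes A: "positive_op A" and B: "positive_op B" and inv: "invertible_op A" and ab: "a < b"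
    and lower: "\<And>x. a * inner (A x) x \<le> inner (B x) x" and upper: "\<And>x. inner (B x) x \<le> b * inner (A x) x"
    and eq: "\<And>t. a \<le> t \<Longrightarrow> t \<le> b \<Longrightarrow> g t = g' t"
  shows "selfadjoint_calc g (inv_op (sqrt_op A) o\<^sub>L B o\<^sub>L inv_op (sqrt_op A))
    = selfadjoint_calc g' (inv_op (sqrt_op A) o\<^sub>L B o\<^sub>L inv_op (sqrt_op A))"
proof -
  define Q J T where "Q = sqrt_op A" and "J = inv_op Q" and "T = J o\<^sub>L B o\<^sub>L J"
  have QJ: "Q o\<^sub>L J = id_blinfun" "clinear_op J" "\<And>x y. cinner (J x) y = cinner x (J y)"
    unfolding J_def Q_def by (rule inv_sqrt_op[OF A inv])+
  have T_form: "inner (T x) x = inner (B (J x)) (J x)" for x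
    using QJ(3)[of "B (J x)" x] by (simp add: T_def flip: Re_cinner)
  have A_form: "inner (A (J x)) (J x) = inner x x" for x
  proof -
    have "Q (J x) = x"
      using QJ(1) by (metis blinfun_apply_blinfun_compose blinfun_apply_id_blinfun id_apply)
    then show ?thesis
      using sqrt_op(4)[OF A, of "J x"] by (simp add: Q_def power2_norm_eq_inner)
  qed
  have T: "positive_op T"
  proof (rule positive_opI)
    show "clinear_op T"
      using QJ(2) positive_opD(1)[OF B] by (simp add: T_def)
    show "\<exists>r\<ge>0. cinner (T x) x = of_real r" for x
      using positive_opD(3,4)[OF B, of "J x"] by (auto simp: T_def QJ(3))
  qed
  interpret t: positive_operator T "norm T + 1"
    by (rule positive_operator_norm[OF T])
  have "a \<le> Re z" "Re z \<le> b" if "z \<in> spectrum_on UNIV T" for z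
    using t.spectrum_between[OF ab _ _ that] lower[of "J _"] upper[of "J _"] by (simp_all add: T_form A_form)
  then have "selfadjoint_calc g T = selfadjoint_calc g' T"
    unfolding selfadjoint_calc_def by (intro borel_calc_cong eq)
  then show ?thesis by (simp add: T_def J_def Q_def)
qed

text \<open>Reduces functions on the open quadrant to functions on the closed one: the spectra involved
  only see the cone on which both agree.\<close>

lemma cone_extension:
  fixes f :: "real \<times> real \<Rightarrow> complex"
  assumes f: "f \<in> borel_locally_bounded ({0<..} \<times> {0<..})" and hom: "homogeneous_on {0<..} f" and a: "0 < a" "a < b"
  defines "g \<equiv> \<lambda>(r, s). if 0 < r \<and> a * r \<le> s \<and> s \<le> b * r then f (r, s) else 0"
  shows "g \<in> borel_locally_bounded quadrant" "homogeneous_on {0..} g"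
proof -
  let ?\<Omega> = "{0<..} \<times> {0<..} :: (real \<times> real) set"
  have \<Omega>: "?\<Omega> \<in> sets borel"
    by (intro borel_open open_Times) auto
  define D where "D = {x :: real \<times> real. 0 < fst x \<and> a * fst x \<le> snd x \<and> snd x \<le> b * fst x}"
  have D: "D \<in> sets borel"
  proof -
    have "D = {x. 0 < fst x} \<inter> {x. a * fst x \<le> snd x} \<inter> {x. snd x \<le> b * fst x}"
      by (auto simp: D_def)
    also have "\<dots> \<in> sets borel"
      by (intro sets.Int borel_open borel_closed open_Collect_less closed_Collect_le continuous_intros)
    finally show ?thesis .
  qed
  have pos: "0 < s" if "0 < r" "a * r \<le> s" for r s
    using that a by (meson less_le_trans mult_pos_pos)
  show "g \<in> borel_locally_bounded quadrant"
  proof (rule borel_locally_boundedI[OF _ quadrant_borel])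
    have "(\<lambda>x. indicator D x * (indicator ?\<Omega> x * f x)) \<in> borel_measurable borel"
      by (rule borel_measurable_times[OF borel_measurable_indicator[OF D] borel_locally_boundedD(1)[OF f \<Omega>]])
    also have "(\<lambda>x. indicator D x * (indicator ?\<Omega> x * f x)) = (\<lambda>x. indicator quadrant x * g x)"
      using pos by (intro ext) (auto simp: indicator_def D_def g_def split: prod.splits dest: less_imp_le)
    finally show "(\<lambda>x. indicator quadrant x * g x) \<in> borel_measurable borel" .
    fix K :: "(real \<times> real) set" assume K: "compact K" "K \<subseteq> quadrant"
    \<comment> \<open>A bound for \<open>f\<close> on the compact set of points
      \<open>(1, t)\<close> with \<open>t\<close> in \<open>[a, b]\<close> spreads over the cone by
      homogeneity and yields at most \<open>L * B\<close> on \<open>K\<close>.\<close>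
    have "compact ((\<lambda>t. (1::real, t)) ` {a..b})"
      by (intro compact_continuous_image continuous_intros) auto
    moreover have "(\<lambda>t. (1::real, t)) ` {a..b} \<subseteq> ?\<Omega>"
      using a by auto
    ultimately have "bounded (f ` (\<lambda>t. (1::real, t)) ` {a..b})"
      by (rule borel_locally_boundedD(2)[OF f \<Omega>])
    then obtain B where "\<forall>y\<in>f ` (\<lambda>t. (1::real, t)) ` {a..b}. norm y \<le> B"
      unfolding bounded_iff by blast
    then have B: "cmod (f (1, t)) \<le> B" if "a \<le> t" "t \<le> b" for t
      using that by auto
    have "bounded K" using K(1) by (rule compact_imp_bounded)
    then obtain L where L: "\<And>x. x \<in> K \<Longrightarrow> norm x \<le> L"
      unfolding bounded_iff by blast
    have "cmod (g x) \<le> max 0 (L * B)" if x: "x \<in> K" for x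
    proof (cases "x \<in> D")
      case True
      obtain r s where rs: "x = (r, s)" by (cases x)
      then have r: "0 < r" "a * r \<le> s" "s \<le> b * r"
        using True by (auto simp: D_def)
      have "f (r * 1, r * (s / r)) = complex_of_real r * f (1, s / r)"
        by (rule hom[unfolded homogeneous_on_def, rule_format]) (use r pos[OF r(1,2)] in auto)
      then have "g x = complex_of_real r * f (1, s / r)"
        using r by (simp add: g_def rs)
      moreover have "cmod (f (1, s / r)) \<le> B"
        using r by (intro B) (auto simp: field_simps)
      moreover have "r \<le> L"
        using L[OF x] norm_fst_le[of r s] r by (simp add: rs)
      moreover have "0 \<le> B"
        using calculation(2) norm_ge_zero order.trans by blast
      ultimately have "cmod (g x) \<le> L * B"
        using r by (auto simp: norm_mult intro!: mult_mono)
      then show ?thesis by simp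
    qed (auto simp: g_def D_def split: prod.splits)
    then show "bounded (g ` K)"
      unfolding bounded_iff by blast
  qed
  show "homogeneous_on {0..} g"
    unfolding homogeneous_on_def
  proof (intro ballI)
    fix l r s :: real assume lrs: "l \<in> {0..}" "r \<in> {0..}" "s \<in> {0..}"
    show "g (l * r, l * s) = complex_of_real l * g (r, s)"
    \<comment> \<open>Homogeneity of \<open>f\<close> is available for positive \<open>l\<close>
      only; for \<open>l = 0\<close> both sides are 0 because \<open>g\<close> vanishes at the
      origin.\<close>
    proof (cases "l = 0")
      case False
      then have l: "0 < l" using lrs by simp
      have "0 < l * r \<longleftrightarrow> 0 < r" "a * (l * r) \<le> l * s \<longleftrightarrow> a * r \<le> s" "l * s \<le> b * (l * r) \<longleftrightarrow> s \<le> b * r"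
        using l by (simp_all add: zero_less_mult_iff mult.left_commute)
      then show ?thesis
        using hom l pos[of r s] by (auto simp: g_def homogeneous_on_def)
    qed (simp add: g_def)
  qed
qed

context pw_pair
begin

lemma pw_calc_both_invertible:
  assumes A': "invertible_op A" and B': "invertible_op B"
    and f: "f \<in> borel_locally_bounded ({0<..} \<times> {0<..})" and hom: "homogeneous_on {0<..} f"
  shows "pw_calc f A B = sqrt_op A o\<^sub>L
    selfadjoint_calc (\<lambda>t. f (1, t)) (inv_op (sqrt_op A) o\<^sub>L B o\<^sub>L inv_op (sqrt_op A)) o\<^sub>L sqrt_op A"
    "pw_calc f A B = sqrt_op B o\<^sub>L
    selfadjoint_calc (\<lambda>t. f (t, 1)) (inv_op (sqrt_op B) o\<^sub>L A o\<^sub>L inv_op (sqrt_op B)) o\<^sub>L sqrt_op B"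
proof -
  obtain j where j: "0 < j" "\<And>x. inner x x \<le> j * inner (A x) x"
    using invertible_positive_bound[OF A A'] by blast
  obtain k where k: "0 < k" "\<And>x. inner x x \<le> k * inner (B x) x"
    using invertible_positive_bound[OF B B'] by blast
  \<comment> \<open>\<open>B \<le> (norm B * j) A\<close> and \<open>A \<le> (norm A * k) B\<close>.
    The added 1 and 2 give \<open>0 < a \<le> 1\<close> and \<open>b \<ge> 2\<close>, hence
    \<open>a < b\<close>.\<close>
  define a where "a = 1 / (norm A * k + 1)"
  define b where "b = norm B * j + 2"
  have a: "0 < a" "a \<le> 1" and b: "2 \<le> b"
    using j k by (auto simp: a_def b_def divide_le_eq add_nonneg_pos)
  then have ab: "a < b" by simp
  have upper: "inner (B x) x \<le> b * inner (A x) x" for x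
  proof -
    have "inner (B x) x \<le> norm B * inner x x" by (rule inner_le_norm)
    also have "\<dots> \<le> norm B * (j * inner (A x) x)" by (intro mult_left_mono j) auto
    also have "\<dots> \<le> b * inner (A x) x"
      using positive_opD(4)[OF A, of x] by (simp add: b_def algebra_simps)
    finally show ?thesis .
  qed
  have lower: "a * inner (A x) x \<le> inner (B x) x" for x
  proof -
    have "inner (A x) x \<le> norm A * inner x x" by (rule inner_le_norm)
    also have "\<dots> \<le> norm A * (k * inner (B x) x)" by (intro mult_left_mono k) auto
    also have "\<dots> \<le> (norm A * k + 1) * inner (B x) x"
      using positive_opD(4)[OF B, of x] by (simp add: algebra_simps)
    finally have "a * inner (A x) x \<le> a * ((norm A * k + 1) * inner (B x) x)"
      using a by (intro mult_left_mono) auto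
    moreover have "norm A * k + 1 \<noteq> 0"
      using k by (smt (verit) mult_nonneg_nonneg norm_ge_zero)
    ultimately show ?thesis by (simp add: a_def)
  qed
  define g where "g = (\<lambda>(r, s). if 0 < r \<and> a * r \<le> s \<and> s \<le> b * r then f (r, s) else 0)"
  have g: "g \<in> borel_locally_bounded quadrant" "homogeneous_on {0..} g"
    unfolding g_def by (rule cone_extension[OF f hom a(1) ab])+
  have pw: "pw_calc f A B = pw_calc g A B"
    by (rule pw_calc_cong[OF A' a(1) ab lower upper]) (simp add: g_def)
  show "pw_calc f A B = sqrt_op A o\<^sub>L
    selfadjoint_calc (\<lambda>t. f (1, t)) (inv_op (sqrt_op A) o\<^sub>L B o\<^sub>L inv_op (sqrt_op A)) o\<^sub>L sqrt_op A"
  proof -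
    have "selfadjoint_calc (\<lambda>t. f (1, t)) (inv_op (sqrt_op A) o\<^sub>L B o\<^sub>L inv_op (sqrt_op A))
        = selfadjoint_calc (\<lambda>t. g (1, t)) (inv_op (sqrt_op A) o\<^sub>L B o\<^sub>L inv_op (sqrt_op A))"
      by (rule conjugate_spectrum[OF A B A' ab lower upper]) (simp add: g_def)
    then show ?thesis
      using pw_calc_left_invertible[OF A' g] pw by simp
  qed
  show "pw_calc f A B = sqrt_op B o\<^sub>L
    selfadjoint_calc (\<lambda>t. f (t, 1)) (inv_op (sqrt_op B) o\<^sub>L A o\<^sub>L inv_op (sqrt_op B)) o\<^sub>L sqrt_op B"
  proof -
    have "selfadjoint_calc (\<lambda>t. f (t, 1)) (inv_op (sqrt_op B) o\<^sub>L A o\<^sub>L inv_op (sqrt_op B))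
        = selfadjoint_calc (\<lambda>t. g (t, 1)) (inv_op (sqrt_op B) o\<^sub>L A o\<^sub>L inv_op (sqrt_op B))"
    proof (rule conjugate_spectrum[OF B A B', of "1 / b" "1 / a"])
      show "1 / b < 1 / a" using a ab by (intro divide_strict_left_mono) auto
      show "1 / b * inner (B x) x \<le> inner (A x) x" for x
        using upper[of x] b by (simp add: field_simps)
      show "inner (A x) x \<le> 1 / a * inner (B x) x" for x
        using lower[of x] a by (simp add: field_simps)
      fix t assume t: "1 / b \<le> t" "t \<le> 1 / a"
      have "0 < 1 / b" using b by simp
      then have "0 < t" using t(1) by (rule less_le_trans)
      moreover have "a * t \<le> 1" "1 \<le> b * t"
        using t a b by (simp_all add: field_simps)
      ultimately show "f (t, 1) = g (t, 1)"
        by (simp add: g_def)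
    qed
    then show ?thesis
      using pw_calc_right_invertible[OF B' g] pw by simp
  qed
qed

end

section \<open>Polynomial approximation\<close>

lemma complex_polynomial_approximation:
  fixes h :: "real \<Rightarrow> complex"
  assumes h: "continuous_on {0..1} h" and \<eta>: "0 < \<eta>"
  shows "\<exists>c N. \<forall>t\<in>{0..1}. cmod (h t - (\<Sum>i\<le>N. c i * of_real (t ^ i))) \<le> \<eta>"
proof -
  have poly: "\<exists>a N. \<forall>t\<in>{0..1}. \<bar>g t - (\<Sum>i\<le>N. a i * t ^ i)\<bar> < \<eta> / 2"
    if g: "continuous_on {0..1} g" for g :: "real \<Rightarrow> real"
  proof -
    obtain p where p: "real_polynomial_function p" "\<And>t. t \<in> {0..1} \<Longrightarrow> \<bar>g t - p t\<bar> < \<eta> / 2"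
      by (rule Stone_Weierstrass_real_polynomial_function[OF compact_Icc g, of "\<eta> / 2"]) (use \<eta> in auto)
    obtain a N where "p = (\<lambda>x. \<Sum>i\<le>N. a i * x ^ i)"
      using p(1) unfolding real_polynomial_function_iff_sum by blast
    with p(2) have "\<forall>t\<in>{0..1}. \<bar>g t - (\<Sum>i\<le>N. a i * t ^ i)\<bar> < \<eta> / 2"
      by simp
    then show ?thesis by blast
  qed
  obtain a N where a: "\<forall>t\<in>{0..1}. \<bar>Re (h t) - (\<Sum>i\<le>N. a i * t ^ i)\<bar> < \<eta> / 2"
    using poly[of "\<lambda>t. Re (h t)"] continuous_on_Re[OF h] by blast
  obtain b L where b: "\<forall>t\<in>{0..1}. \<bar>Im (h t) - (\<Sum>i\<le>L. b i * t ^ i)\<bar> < \<eta> / 2"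
    using poly[of "\<lambda>t. Im (h t)"] continuous_on_Im[OF h] by blast
  define c where "c i = Complex (if i \<le> N then a i else 0) (if i \<le> L then b i else 0)" for i
  have trunc: "(\<Sum>i\<le>max N L. (if i \<le> K then u i else 0) * t ^ i) = (\<Sum>i\<le>K. u i * t ^ i)"
    if "K \<le> max N L" for K t and u :: "nat \<Rightarrow> real"
    using that by (intro sum.mono_neutral_cong_right) auto
  have "cmod (h t - (\<Sum>i\<le>max N L. c i * of_real (t ^ i))) \<le> \<eta>" if t: "t \<in> {0..1}" for t
  proof -
    let ?w = "h t - (\<Sum>i\<le>max N L. c i * of_real (t ^ i))"
    have "Re ?w = Re (h t) - (\<Sum>i\<le>N. a i * t ^ i)" "Im ?w = Im (h t) - (\<Sum>i\<le>L. b i * t ^ i)"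
      using trunc[of N a t] trunc[of L b t] by (simp_all add: c_def del: of_real_power)
    then have "\<bar>Re ?w\<bar> + \<bar>Im ?w\<bar> \<le> \<eta>"
      using a[rule_format, OF t] b[rule_format, OF t] by linarith
    then show ?thesis
      using cmod_le[of ?w] by linarith
  qed
  then show ?thesis by blast
qed

context pw_pair
begin

text \<open>The operator \<open>C p(R) C\<close> for the polynomial \<open>p\<close> with
  coefficients \<open>c\<close>, written out in powers so that it can be compared with the perturbed
  pair term by term.\<close>

definition poly_part :: "(nat \<Rightarrow> complex) \<Rightarrow> nat \<Rightarrow> 'h op" where
  "poly_part c N = (\<Sum>i\<le>N. scaleC_op (c i) (C o\<^sub>L op_power M R i o\<^sub>L C))"

lemma poly_part_clinear: "clinear_op (poly_part c N)"
proof -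
  have "clinear_op (C o\<^sub>L op_power M R i o\<^sub>L C)" for i
    using op_onD(1)[OF op_power_props(1)[OF M R(1)]] positive_opD(1)[OF C(1)] by simp
  moreover have "clinear_op (\<Sum>i\<le>N. F i)" if "\<And>i. clinear_op (F i)" for F :: "nat \<Rightarrow> 'h op"
    by (induction N) (simp_all add: that)
  ultimately show ?thesis
    unfolding poly_part_def by (metis (no_types, lifting) clinear_op_simps(6))
qed

lemma poly_part_form:
  "cinner (poly_part c N x) x = (LINT z|scalar_measure seg.E (C x). indicator seg.\<sigma> z * (\<Sum>i\<le>N. c i * of_real (seg.\<tau> z ^ i)))"
proof -
  have int: "integrable (scalar_measure seg.E (C x)) (\<lambda>z. indicator seg.\<sigma> z * complex_of_real (seg.\<tau> z ^ i))" for i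
    by (rule integrable_bounded_borel[OF seg.calc.finite seg.calc.sets seg.bb_spectrum[OF seg.\<tau>_continuous]])
  have "(LINT z|scalar_measure seg.E (C x). indicator seg.\<sigma> z * (\<Sum>i\<le>N. c i * of_real (seg.\<tau> z ^ i)))
      = (LINT z|scalar_measure seg.E (C x). (\<Sum>i\<le>N. c i * (indicator seg.\<sigma> z * of_real (seg.\<tau> z ^ i))))"
    by (simp add: sum_distrib_left mult.left_commute)
  also have "\<dots> = (\<Sum>i\<le>N. c i * (LINT z|scalar_measure seg.E (C x). indicator seg.\<sigma> z * of_real (seg.\<tau> z ^ i)))"
    using int by (subst Bochner_Integration.integral_sum) auto
  also have "\<dots> = (\<Sum>i\<le>N. c i * cinner (op_power M R i (C x)) (C x))"
    by (simp only: seg.calc_moments)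
  also have "\<dots> = (\<Sum>i\<le>N. cinner (scaleC_op (c i) (C o\<^sub>L op_power M R i o\<^sub>L C) x) x)"
    by (simp add: cinner_scaleC_left positive_opD(2)[OF C(1)])
  also have "\<dots> = cinner (poly_part c N x) x"
    by (simp only: poly_part_def blinfun.sum_left cinner.sum_left)
  finally show ?thesis by simp
qed

text \<open>The total mass at \<open>C x\<close> is at most \<open>(norm (C x))\<^sup>2\<close>,
  which is the form of \<open>H\<close> at \<open>x\<close>. The error thus depends on the pair only
  through \<open>norm H\<close> and is uniform over small perturbations.\<close>

lemma pw_calc_poly_approx:
  assumes f: "segment_bounded f" and \<eta>: "0 \<le> \<eta>"
    and approx: "\<And>t. t \<in> {0..1} \<Longrightarrow> cmod (f (t, 1 - t) - (\<Sum>i\<le>N. c i * of_real (t ^ i))) \<le> \<eta>"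
  shows "norm (pw_calc f A B - poly_part c N) \<le> 2 * (\<eta> * norm H)"
proof (rule norm_op_le_form(2))
  show "clinear_op (pw_calc f A B - poly_part c N)"
    using pw_calc_clinear[OF f] poly_part_clinear by simp
  show "0 \<le> \<eta> * norm H" using \<eta> by simp
  fix x
  let ?p = "\<lambda>t. \<Sum>i\<le>N. c i * complex_of_real (t ^ i)"
  let ?g = "\<lambda>z. indicator seg.\<sigma> z * f (seg.\<tau> z, 1 - seg.\<tau> z)" and ?q = "\<lambda>z. indicator seg.\<sigma> z * ?p (seg.\<tau> z)"
  have g: "bounded_borel ?g"
    using bb_segment[OF f] unfolding spectrum_f_eq .
  have q: "bounded_borel ?q"
    unfolding seg.\<tau>_def using seg.d by (intro seg.bb_spectrum continuous_intros) auto
  have gq: "bounded_borel (\<lambda>z. ?g z - ?q z)"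
    using bounded_borel_lin[OF g q, of 1 "-1"] by simp
  have "cinner ((pw_calc f A B - poly_part c N) x) x
      = (LINT z|scalar_measure seg.E (C x). ?g z) - (LINT z|scalar_measure seg.E (C x). ?q z)"
    by (simp add: blinfun.diff_left cinner.diff_left pw_calc_form[OF f] poly_part_form)
  also have "\<dots> = (LINT z|scalar_measure seg.E (C x). ?g z - ?q z)"
    using integrable_bounded_borel[OF seg.calc.finite seg.calc.sets] g q by simp
  also have "cmod \<dots> \<le> \<eta> * (norm (C x))\<^sup>2"
  proof (rule seg.calc.cmod_LINT_le[OF gq])
    fix z show "cmod (?g z - ?q z) \<le> \<eta>"
    proof (cases "z \<in> seg.\<sigma>")
      case True
      then show ?thesis
        using approx[of "seg.\<tau> z"] seg.\<tau>_L(3)[of z] seg.spectrum_facts(3) by auto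
    qed (use \<eta> in simp)
  qed
  also have "(norm (C x))\<^sup>2 = inner (H x) x"
    unfolding C_def by (rule sqrt_op(4)[OF H])
  also have "\<eta> * inner (H x) x \<le> \<eta> * (norm H * inner x x)"
    by (rule mult_left_mono[OF inner_le_norm \<eta>])
  finally show "cmod (cinner ((pw_calc f A B - poly_part c N) x) x) \<le> \<eta> * norm H * (norm x)\<^sup>2"
    by (simp add: power2_norm_eq_inner mult.assoc)
qed

section \<open>Convergence in the presence of a spectral gap\<close>

text \<open>The spectral projection of \<open>H\<close> for the interval (0, \<delta>) is zero;
  whether 0 itself belongs to the spectrum is left open.\<close>

definition spectral_gap :: "real \<Rightarrow> bool" where
  "spectral_gap \<delta> \<longleftrightarrow> 0 < \<delta> \<and>
    positive_operator.fc H (norm H + 1) (\<lambda>t. complex_of_real (indicator {0<..<\<delta>} t)) = 0"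

text \<open>The inverse of \<open>H + e\<close> is \<open>G e + P0 / e\<close>.  The singular part only contributes
  \<open>e1 * (e1 / e) ^ n\<close> times \<open>P0\<close> to the \<open>n\<close>-th term, which tends to \<open>0\<close> because \<open>0 \<le> e1 \<le> e\<close>.\<close>

lemma convergence_of_gap:
  assumes gap: "spectral_gap \<delta>"
    and f: "continuous_on quadrant f"
  shows "((\<lambda>(e1, e2). pw_calc f (A + e1 *\<^sub>R id_blinfun) (B + e2 *\<^sub>R id_blinfun))
    \<longlongrightarrow> pw_calc f A B) (at (0, 0) within quadrant)"
proof -
  interpret h: positive_operator H "norm H + 1"
    by (rule positive_operator_norm[OF H])
  let ?K = "norm H + 1"
  have \<delta>: "0 < \<delta>" and gap0: "h.fc (\<lambda>t. complex_of_real (indicator {0<..<\<delta>} t)) = 0"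
    using gap by (auto simp: spectral_gap_def)
  let ?mid = "\<lambda>t. complex_of_real (indicator {0<..<\<delta>} t)"
  have mid: "h.admissible ?mid"
    by (rule h.admissibleI[of _ 1]) (auto simp: indicator_def)
  \<comment> \<open>Functions that agree off (0, \<delta>) give the same operator: their difference
    factors through the vanishing projection.\<close>
  have no_mid: "h.fc u = h.fc v" if u: "h.admissible u" and v: "h.admissible v"
    and eq: "\<And>t. t \<in> {0..?K} \<Longrightarrow> t \<notin> {0<..<\<delta>} \<Longrightarrow> u t = v t" for u v
  proof -
    have "h.fc u - h.fc v = h.fc (\<lambda>t. u t - v t)"
      by (rule h.fc_diff[OF u v, symmetric])
    also have "\<dots> = h.fc (\<lambda>t. (u t - v t) * ?mid t)"
      using eq by (intro h.fc_cong) (auto simp: indicator_def)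
    also have "\<dots> = 0"
      unfolding h.fc_mult[OF h.admissible_diff[OF u v] mid] gap0 by (simp add: blinfun_compose_simps)
    finally show ?thesis by simp
  qed
  \<comment> \<open>The function \<open>1 / (t + e)\<close> cut off below \<delta>, hence bounded by
    \<open>1 / \<delta>\<close> uniformly in \<open>e \<ge> 0\<close>. At \<open>e = 0\<close> it
    gives the pseudo-inverse of \<open>H\<close>.\<close>
  define g :: "real \<Rightarrow> real \<Rightarrow> complex" where "g e t = complex_of_real (if \<delta> \<le> t then 1 / (t + e) else 0)" for e t
  have g: "h.admissible (g e)" if "0 \<le> e" for e
  proof (rule h.admissibleI)
    show "g e \<in> borel_measurable borel"
      unfolding g_def by measurable
    show "cmod (g e t) \<le> 1 / \<delta>" for t
    proof (cases "\<delta> \<le> t")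
      case True
      have "1 / (t + e) \<le> 1 / \<delta>" "0 \<le> 1 / (t + e)"
        using True \<delta> that by (auto intro!: divide_left_mono mult_pos_pos)
      then show ?thesis using True by (simp add: g_def del: of_real_divide)
    qed (use \<delta> in \<open>simp add: g_def\<close>)
  qed
  let ?z = "\<lambda>t::real. complex_of_real (indicator {0} t)"
  have z: "h.admissible ?z"
    by (rule h.admissibleI[of _ 1]) (auto simp: indicator_def)
  define G where "G e = h.fc (g e)" for e
  \<comment> \<open>The projection onto the kernel of \<open>H\<close>; the gap makes
    \<open>P0\<close> and \<open>P\<close> complementary through
    \<open>H o G 0 = id_blinfun - P0\<close>.\<close>
  define P0 where "P0 = h.fc ?z"
  have HP0: "H o\<^sub>L P0 = 0"
  proof -
    have "H o\<^sub>L P0 = h.fc (\<lambda>t. complex_of_real t * ?z t)"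
      unfolding P0_def using h.fc_mult[OF h.admissible_id z] by (simp add: h.fc_id)
    also have "\<dots> = h.fc (\<lambda>_. 0)"
      by (intro h.fc_cong) (auto simp: indicator_def)
    finally show ?thesis by (simp only: h.fc_zero)
  qed
  have GP0: "G e o\<^sub>L P0 = 0" "P0 o\<^sub>L G e = 0" if "0 \<le> e" for e
  proof -
    have "h.fc (\<lambda>t. g e t * ?z t) = h.fc (\<lambda>_. 0)" "h.fc (\<lambda>t. ?z t * g e t) = h.fc (\<lambda>_. 0)"
      using \<delta> by (intro h.fc_cong; auto simp: indicator_def g_def)+
    then show "G e o\<^sub>L P0 = 0" "P0 o\<^sub>L G e = 0"
      unfolding h.fc_zero G_def P0_def using h.fc_mult[OF g[OF that] z] h.fc_mult[OF z g[OF that]] by simp_all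
  qed
  have HG: "(H + e *\<^sub>R id_blinfun) o\<^sub>L G e = id_blinfun - P0" if e: "0 \<le> e" for e
  proof -
    let ?l = "\<lambda>t. complex_of_real (t + e)"
    note l = h.admissible_shift[of e]
    have "(H + e *\<^sub>R id_blinfun) o\<^sub>L G e = h.fc (\<lambda>t. ?l t * g e t)"
      unfolding G_def h.fc_shift[symmetric] by (rule h.fc_mult[OF l g[OF e], symmetric])
    also have "\<dots> = h.fc (\<lambda>t. 1 - ?z t)"
    proof (rule no_mid[OF h.admissible_mult[OF l g[OF e]]])
      show "h.admissible (\<lambda>t. 1 - ?z t)"
        by (rule h.admissibleI[of _ 1]) (auto simp: indicator_def)
      fix t assume t: "t \<in> {0..?K}" "t \<notin> {0<..<\<delta>}"
      show "?l t * g e t = 1 - ?z t"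
      proof (cases "t = 0")
        case False
        then have "\<delta> \<le> t" "0 < t + e" using t e by auto
        moreover have "?l t * g e t = complex_of_real ((t + e) * (1 / (t + e)))"
          using \<open>\<delta> \<le> t\<close> unfolding of_real_mult by (simp add: g_def)
        ultimately show ?thesis using False by simp
      qed (use \<delta> in \<open>simp add: g_def\<close>)
    qed
    also have "\<dots> = id_blinfun - P0"
      using h.fc_diff[OF h.admissible_one z] by (simp add: h.fc_one P0_def)
    finally show ?thesis .
  qed
  have G_clin: "clinear_op (G e)" if "0 \<le> e" for e
    unfolding G_def by (rule h.fc_clinear[OF g[OF that]])
  have GH: "G 0 o\<^sub>L H = id_blinfun - P0"
  proof -
    have "G 0 o\<^sub>L H = H o\<^sub>L G 0"
      unfolding G_def using h.fc_mult[OF h.admissible_id g[of 0]] h.fc_mult[OF g[of 0] h.admissible_id]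
      by (simp add: h.fc_id mult.commute)
    then show ?thesis using HG[of 0] by simp
  qed
  have P_eq: "P = id_blinfun - P0"
  proof (rule blinfun_eqI)
    fix x
    have HP0x: "H (P0 x) = 0" for x
      using HP0 by (metis blinfun_apply_blinfun_compose zero_blinfun.rep_eq)
    have P0_sa: "cinner (P0 x) y = cinner x (P0 y)" for x y
      unfolding P0_def by (rule h.fc_selfadjoint[OF z])
    have fix0: "P0 k = k" if "H k = 0" for k
    proof -
      have "k - P0 k = (G 0 o\<^sub>L H) k" by (simp add: GH blinfun.diff_left)
      then show ?thesis using that by (simp add: blinfun.zero_right)
    qed
    show "P x = (id_blinfun - P0) x"
      unfolding P_def
    proof (rule proj_eqI[OF M])
      show "(id_blinfun - P0) x \<in> M"
        by (auto simp: M_def ocompl_def ker_op_def blinfun.diff_left cinner.diff_left P0_sa fix0)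
      have "P0 x \<in> ker_op H" by (simp add: ker_op_def HP0x)
      then have "P0 x \<in> ocompl M"
        unfolding M_def ocompl_ocompl[OF csubspace_ker[OF positive_opD(1)[OF H]]] .
      then show "x - (id_blinfun - P0) x \<in> ocompl M"
        by (simp add: blinfun.diff_left)
    qed
  qed
  have G0: "op_on M (G 0)" "H o\<^sub>L G 0 = P"
  proof -
    show "H o\<^sub>L G 0 = P" using HG[of 0] by (simp add: P_eq)
    have "proj M o\<^sub>L G 0 = G 0" "G 0 o\<^sub>L proj M = G 0"
      using GP0[of 0] by (simp_all flip: P_def add: P_eq blinfun_compose_simps)
    then show "op_on M (G 0)"
      using G_clin[of 0] by (simp add: op_on_iff[OF M])
  qed
  have AP0: "A o\<^sub>L P0 = 0" "P0 o\<^sub>L A = 0"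
  proof -
    have "P0 = id_blinfun - P" by (simp add: P_eq)
    then show "A o\<^sub>L P0 = 0" "P0 o\<^sub>L A = 0"
      using op_on(1) by (simp_all add: blinfun_compose_simps op_on_iff[OF M] P_def)
  qed
  have P0P: "P0 o\<^sub>L P = 0" "P o\<^sub>L P0 = 0" "P0 o\<^sub>L P0 = P0"
  proof -
    have "h.fc (\<lambda>t. ?z t * ?z t) = h.fc ?z"
      by (intro h.fc_cong) (auto simp: indicator_def)
    then show "P0 o\<^sub>L P0 = P0"
      using h.fc_mult[OF z z] by (simp add: P0_def)
    then show "P0 o\<^sub>L P = 0" "P o\<^sub>L P0 = 0"
      by (simp_all add: P_eq blinfun_compose_simps)
  qed
  \<comment> \<open>The part of \<open>A + e1\<close> on \<open>M\<close>. The remaining part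
    \<open>e1 *\<^sub>R P0\<close> is orthogonal to it, so powers of the sum split into a regular
    and a singular term.\<close>
  define Ah where "Ah e1 = A + e1 *\<^sub>R P" for e1 :: real
  define Y where "Y n e1 e = ((\<lambda>Z. Ah e1 o\<^sub>L G e o\<^sub>L Z) ^^ n) (Ah e1)" for n e1 e
  have P0Ah: "P0 o\<^sub>L Ah e1 = 0" "Ah e1 o\<^sub>L P0 = 0" for e1
    by (simp_all add: Ah_def blinfun_compose_simps AP0 P0P)
  have P0Y: "P0 o\<^sub>L Y n e1 e = 0" for n e1 e
    by (cases n) (simp_all add: Y_def P0Ah blinfun_compose_simps flip: op_comp_assoc)
  let ?F = "at (0::real, 0::real) within quadrant"
  have fst0: "(fst \<longlongrightarrow> 0) ?F" and snd0: "(snd \<longlongrightarrow> 0) ?F"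
    using tendsto_fst[OF tendsto_ident_at, of "(0, 0)"] tendsto_snd[OF tendsto_ident_at, of "(0, 0)"] by simp_all
  have sum0: "((\<lambda>p. fst p + snd p) \<longlongrightarrow> 0) ?F"
    using tendsto_add[OF fst0 snd0] by simp
  \<comment> \<open>The limit filter omits the origin, which makes \<open>e1 + e2\<close> strictly
    positive and the perturbed sum invertible.\<close>
  have in_quadrant: "\<forall>\<^sub>F p in ?F. 0 \<le> fst p \<and> 0 \<le> snd p \<and> 0 < fst p + snd p"
    unfolding eventually_at_filter
    by (rule always_eventually) (auto simp: prod_eq_iff add_nonneg_eq_0_iff order_less_le)
  have G_lim: "((\<lambda>p. G (fst p + snd p)) \<longlongrightarrow> G 0) ?F"
  proof (rule LIM_zero_cancel, rule Lim_null_comparison)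
    show "\<forall>\<^sub>F p in ?F. norm (G (fst p + snd p) - G 0) \<le> 2 * ((fst p + snd p) * (1 / \<delta>\<^sup>2))"
      using in_quadrant
    proof eventually_elim
      case (elim p)
      define e where "e = fst p + snd p"
      have e: "0 < e" using elim by (simp add: e_def)
      have "G e - G 0 = h.fc (\<lambda>t. g e t - g 0 t)"
        unfolding G_def using e by (intro h.fc_diff[symmetric] g) auto
      also have "norm \<dots> \<le> 2 * (e * (1 / \<delta>\<^sup>2))"
      proof -
        have bound: "cmod (g e t - g 0 t) \<le> e * (1 / \<delta>\<^sup>2)" for t
        proof (cases "\<delta> \<le> t")
          case True
          then have t: "0 < t" "0 < t + e" using \<delta> e by auto
          have "g e t - g 0 t = complex_of_real (1 / (t + e) - 1 / t)"
            using True by (simp add: g_def)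
          also have "1 / (t + e) - 1 / t = - (e / (t * (t + e)))"
            using t by (simp add: field_simps)
          finally have "cmod (g e t - g 0 t) = e / (t * (t + e))"
            using e t by (simp del: of_real_divide of_real_mult of_real_add of_real_minus)
          also have "\<dots> \<le> e / (\<delta> * \<delta>)"
            using True e \<delta> t by (intro divide_left_mono mult_mono mult_pos_pos) auto
          finally show ?thesis by (simp add: power2_eq_square)
        qed (use e in \<open>simp add: g_def\<close>)
        show ?thesis
          using e by (intro h.fc_norm_le bound h.admissible_diff g) auto
      qed
      finally show ?case by (simp add: e_def)
    qed
    show "((\<lambda>p. 2 * ((fst p + snd p) * (1 / \<delta>\<^sup>2))) \<longlongrightarrow> 0) ?F"
      using tendsto_mult[OF tendsto_const[of 2] tendsto_mult[OF sum0 tendsto_const[of "1 / \<delta>\<^sup>2"]]] by simp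
  qed
  have Ah_lim: "((\<lambda>p. Ah (fst p)) \<longlongrightarrow> A) ?F"
    unfolding Ah_def using tendsto_add[OF tendsto_const[of A] tendsto_scaleR[OF fst0 tendsto_const[of P]]] by simp
  note compose_lim = bounded_bilinear.tendsto[OF bounded_bilinear_blinfun_compose]
  have Y_lim: "((\<lambda>p. Y n (fst p) (fst p + snd p)) \<longlongrightarrow> ((\<lambda>Z. A o\<^sub>L G 0 o\<^sub>L Z) ^^ n) A) ?F" for n
    unfolding Y_def
  proof (induction n)
    case (Suc n)
    then show ?case
      using compose_lim[OF compose_lim[OF Ah_lim G_lim] Suc] by simp
  qed (simp add: Ah_lim)
  have pert: "pw_pair (A + e1 *\<^sub>R id_blinfun) (B + e2 *\<^sub>R id_blinfun)" if "0 \<le> e1" "0 \<le> e2" for e1 e2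
    using that by unfold_locales (auto intro!: positive_op_add positive_op_scaleR positive_op_id A B)
  have pert_H: "pw_pair.H (A + e1 *\<^sub>R id_blinfun) (B + e2 *\<^sub>R id_blinfun) = H + (e1 + e2) *\<^sub>R id_blinfun"
    if "0 \<le> e1" "0 \<le> e2" for e1 e2
  proof -
    interpret p: pw_pair "A + e1 *\<^sub>R id_blinfun" "B + e2 *\<^sub>R id_blinfun" using pert[OF that] .
    show ?thesis unfolding p.H_def H_def by (simp add: scaleR_add_left)
  qed
  define Z where "Z n e1 e = Y n e1 e + (e1 * (e1 / e) ^ n) *\<^sub>R P0" for n and e1 e :: real
  \<comment> \<open>The value of \<open>C o R^i o C\<close> for the perturbed pair. Index 0 is
    separate because \<open>moment_Suc\<close> starts with the first power.\<close>
  define W where "W i e1 e2 = (case i of 0 \<Rightarrow> H + (e1 + e2) *\<^sub>R id_blinfun | Suc n \<Rightarrow> Z n e1 (e1 + e2))" for i e1 e2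
  have pert_poly: "pw_pair.poly_part (A + e1 *\<^sub>R id_blinfun) (B + e2 *\<^sub>R id_blinfun) c N
      = (\<Sum>i\<le>N. scaleC_op (c i) (W i e1 e2))" if e: "0 \<le> e1" "0 \<le> e2" "0 < e1 + e2" for e1 e2 c N
  proof -
    interpret p: pw_pair "A + e1 *\<^sub>R id_blinfun" "B + e2 *\<^sub>R id_blinfun" using pert[OF e(1,2)] .
    define e where "e = e1 + e2"
    have e0: "0 < e" using e by (simp add: e_def)
    have p_H: "p.H = H + e *\<^sub>R id_blinfun"
      unfolding e_def by (rule pert_H[OF e(1,2)])
    define V where "V = G e + (1 / e) *\<^sub>R P0"
    have HV: "p.H o\<^sub>L V = id_blinfun"
    proof -
      have "p.H o\<^sub>L V = ((H + e *\<^sub>R id_blinfun) o\<^sub>L G e) + (1 / e) *\<^sub>R ((H + e *\<^sub>R id_blinfun) o\<^sub>L P0)"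
        by (simp only: p_H V_def blinfun_compose_simps(2,6))
      also have "(H + e *\<^sub>R id_blinfun) o\<^sub>L P0 = e *\<^sub>R P0"
        by (simp add: blinfun_compose_simps HP0)
      finally show ?thesis
        using e0 HG[of e] by simp
    qed
    have p_M: "p.M = UNIV"
    proof -
      have "x = 0" if "p.H x = 0" for x
      proof -
        have "inner (p.H x) x = inner (H x) x + e * inner x x"
          by (simp add: p_H blinfun.add_left blinfun.scaleR_left inner_add_left)
        then have "e * inner x x \<le> 0"
          using that positive_opD(4)[OF H, of x] by simp
        then show ?thesis
          using e0 by (metis inner_eq_zero_iff inner_ge_zero mult_le_0_iff not_less order_antisym)
      qed
      then show ?thesis by (rule p.M_UNIV)
    qed
    have V: "op_on p.M V" "p.H o\<^sub>L V = p.P"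
      using G_clin[of e] h.fc_clinear[OF z] e0 HV by (simp_all add: p_M op_on_UNIV V_def P0_def p.P_def)
    have AV: "A + e1 *\<^sub>R id_blinfun = Ah e1 + e1 *\<^sub>R P0"
      by (simp add: Ah_def P_eq scaleR_diff_right)
    have AV_prod: "(A + e1 *\<^sub>R id_blinfun) o\<^sub>L V = (Ah e1 o\<^sub>L G e) + (e1 / e) *\<^sub>R P0"
      unfolding AV V_def using GP0[of e] e0
      by (simp add: blinfun_compose_simps P0Ah P0P)
    have Zn: "((\<lambda>Z. (A + e1 *\<^sub>R id_blinfun) o\<^sub>L V o\<^sub>L Z) ^^ n) (A + e1 *\<^sub>R id_blinfun) = Z n e1 e" for n
    proof (induction n)
      case 0
      show ?case by (simp add: Z_def Y_def AV)
    next
      case (Suc n)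
      have "((\<lambda>Z. (A + e1 *\<^sub>R id_blinfun) o\<^sub>L V o\<^sub>L Z) ^^ Suc n) (A + e1 *\<^sub>R id_blinfun)
          = ((Ah e1 o\<^sub>L G e) + (e1 / e) *\<^sub>R P0) o\<^sub>L (Y n e1 e + (e1 * (e1 / e) ^ n) *\<^sub>R P0)"
        using Suc by (simp only: funpow.simps comp_apply AV_prod Z_def)
      also have "\<dots> = (Ah e1 o\<^sub>L G e o\<^sub>L Y n e1 e) + ((e1 / e) * (e1 * (e1 / e) ^ n)) *\<^sub>R P0"
      proof -
        have "Ah e1 o\<^sub>L G e o\<^sub>L P0 = 0"
          using GP0(1)[of e] e0 by (simp add: op_comp_assoc blinfun_compose_simps)
        then show ?thesis
          by (simp add: blinfun_compose_simps P0Y P0P)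
      qed
      finally show ?case
        by (simp add: Z_def Y_def mult.left_commute)
    qed
    have "p.C o\<^sub>L op_power p.M p.R i o\<^sub>L p.C = W i e1 e2" for i
    proof (cases i)
      case 0
      then show ?thesis
        by (simp add: W_def p_M blinfun_compose_simps p.C(2) p_H e_def)
    next
      case (Suc n)
      show ?thesis
        unfolding Suc p.moment_Suc(1)[OF V] Zn by (simp add: W_def e_def)
    qed
    then show ?thesis
      by (simp only: p.poly_part_def)
  qed
  have Z_lim: "((\<lambda>p. Z n (fst p) (fst p + snd p)) \<longlongrightarrow> ((\<lambda>Z. A o\<^sub>L G 0 o\<^sub>L Z) ^^ n) A) ?F" for n
  proof -
    have "((\<lambda>p. (fst p * (fst p / (fst p + snd p)) ^ n)) \<longlongrightarrow> 0) ?F"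
    proof (rule Lim_null_comparison[OF _ fst0])
      show "\<forall>\<^sub>F p in ?F. norm (fst p * (fst p / (fst p + snd p)) ^ n) \<le> fst p"
        using in_quadrant
      proof eventually_elim
        case (elim p)
        then have "0 \<le> fst p / (fst p + snd p)" "fst p / (fst p + snd p) \<le> 1"
          by (auto simp: divide_le_eq)
        then have "\<bar>(fst p / (fst p + snd p)) ^ n\<bar> \<le> 1"
          by (metis abs_of_nonneg power_le_one zero_le_power)
        then show ?case
          using elim mult_left_mono[of "\<bar>(fst p / (fst p + snd p)) ^ n\<bar>" 1 "fst p"] by (simp add: abs_mult)
      qed
    qed
    from tendsto_add[OF Y_lim[of n] tendsto_scaleR[OF this tendsto_const[of P0]]] show ?thesis
      by (simp add: Z_def)
  qed
  have W_lim: "((\<lambda>p. W i (fst p) (snd p)) \<longlongrightarrow> (C o\<^sub>L op_power M R i o\<^sub>L C)) ?F" for i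
  proof (cases i)
    case 0
    have "C o\<^sub>L op_power M R 0 o\<^sub>L C = H"
      using PC by (simp add: P_def C(2))
    moreover have "((\<lambda>p. H + (fst p + snd p) *\<^sub>R id_blinfun) \<longlongrightarrow> H) ?F"
      using tendsto_add[OF tendsto_const[of H] tendsto_scaleR[OF sum0 tendsto_const[of id_blinfun]]] by simp
    ultimately show ?thesis by (simp only: 0 W_def nat.case)
  next
    case (Suc n)
    show ?thesis
      unfolding Suc moment_Suc(1)[OF G0] using Z_lim[of n] by (simp add: W_def)
  qed
  have scaleC_op_tendsto: "((\<lambda>p. scaleC_op a (U p)) \<longlongrightarrow> scaleC_op a L) ?F" if "(U \<longlongrightarrow> L) ?F" for a and U :: "real \<times> real \<Rightarrow> 'h op" and L
  proof -
    have eq: "scaleC_op a T = scaleC_op a id_blinfun o\<^sub>L T" for T :: "'h op"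
      by (intro blinfun_eqI) simp
    show ?thesis
      unfolding eq[of "U _"] eq[of L] by (intro compose_lim tendsto_const that)
  qed
  have poly_lim: "((\<lambda>p. \<Sum>i\<le>N. scaleC_op (c i) (W i (fst p) (snd p))) \<longlongrightarrow> poly_part c N) ?F" for c N
    unfolding poly_part_def by (intro tendsto_sum scaleC_op_tendsto W_lim)
  have h_cont: "continuous_on {0..1} (\<lambda>t. f (t, 1 - t))"
    by (rule continuous_on_compose2[OF f]) (auto intro!: continuous_intros)
  have sb: "bounded_borel (\<lambda>t. indicator {0..1} t * f (t, 1 - t))"
  proof -
    have "f \<in> borel_locally_bounded quadrant"
      using f by (auto simp: borel_locally_bounded_def intro!: borel_measurable_continuous_on_restrict
          compact_imp_bounded compact_continuous_image elim: continuous_on_subset)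
    from bounded_borel_along[OF this quadrant_borel closed_quadrant_segment(1) compact_Icc closed_quadrant_segment(2)]
    show ?thesis by auto
  qed
  show ?thesis
  proof (rule tendstoI)
    fix \<epsilon> :: real assume \<epsilon>: "0 < \<epsilon>"
    \<comment> \<open>Makes the approximation error \<open>2 * (\<eta> * (norm H + 1))\<close> equal
      to \<open>\<epsilon> / 4\<close>; this also bounds the error for the perturbed pair as soon as
      \<open>e1 + e2 < 1\<close>. The convergence of the polynomial parts contributes another
      \<open>\<epsilon> / 4\<close>.\<close>
    define \<eta> where "\<eta> = \<epsilon> / (8 * (norm H + 1))"
    have nH: "0 < norm H + 1" by (simp add: add_nonneg_pos)
    have \<eta>: "0 < \<eta>" using \<epsilon> nH by (simp add: \<eta>_def)
    have \<eta>H: "2 * (\<eta> * (norm H + 1)) = \<epsilon> / 4"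
      using nH by (simp add: \<eta>_def field_simps)
    obtain c N where cN: "\<And>t. t \<in> {0..1} \<Longrightarrow> cmod (f (t, 1 - t) - (\<Sum>i\<le>N. c i * of_real (t ^ i))) \<le> \<eta>"
      using complex_polynomial_approximation[OF h_cont \<eta>] by blast
    have "2 * (\<eta> * norm H) \<le> 2 * (\<eta> * (norm H + 1))"
      using \<eta> by simp
    then have base: "norm (pw_calc f A B - poly_part c N) \<le> \<epsilon> / 4"
      using pw_calc_poly_approx[of f \<eta> c N] sb \<eta> cN unfolding \<eta>H segment_bounded_def by fastforce
    have "\<forall>\<^sub>F p in ?F. dist (\<Sum>i\<le>N. scaleC_op (c i) (W i (fst p) (snd p))) (poly_part c N) < \<epsilon> / 4"
      using \<epsilon> by (intro tendstoD[OF poly_lim]) auto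
    moreover have "\<forall>\<^sub>F p in ?F. fst p + snd p < 1"
      by (rule order_tendstoD(2)[OF sum0]) simp
    ultimately show "\<forall>\<^sub>F p in ?F. dist (case p of (e1, e2) \<Rightarrow>
        pw_calc f (A + e1 *\<^sub>R id_blinfun) (B + e2 *\<^sub>R id_blinfun)) (pw_calc f A B) < \<epsilon>"
      using in_quadrant
    proof eventually_elim
      case (elim p)
      obtain e1 e2 where p: "p = (e1, e2)" by (cases p)
      have e: "0 \<le> e1" "0 \<le> e2" "0 < e1 + e2" "e1 + e2 < 1" using elim by (auto simp: p)
      interpret q: pw_pair "A + e1 *\<^sub>R id_blinfun" "B + e2 *\<^sub>R id_blinfun" using pert[OF e(1,2)] .
      let ?pol = "\<Sum>i\<le>N. scaleC_op (c i) (W i e1 e2)"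
      have "norm q.H \<le> norm H + norm ((e1 + e2) *\<^sub>R (id_blinfun :: 'h op))"
        unfolding pert_H[OF e(1,2)] by (rule norm_triangle_ineq)
      also have "\<dots> \<le> norm H + 1"
      proof -
        have "norm (id_blinfun :: 'h op) \<le> 1"
          by (rule norm_blinfun_id_le)
        then have "(e1 + e2) * norm (id_blinfun :: 'h op) \<le> 1 * 1"
          using e by (intro mult_mono) auto
        then show ?thesis using e by simp
      qed
      finally have "2 * (\<eta> * norm q.H) \<le> \<epsilon> / 4"
        unfolding \<eta>H[symmetric] using \<eta> by simp
      then have "norm (pw_calc f (A + e1 *\<^sub>R id_blinfun) (B + e2 *\<^sub>R id_blinfun) - ?pol) \<le> \<epsilon> / 4"
        using q.pw_calc_poly_approx[of f \<eta> c N] sb \<eta> cN pert_poly[OF e(1,2,3), of c N]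
        unfolding q.segment_bounded_def by fastforce
      moreover have "norm (?pol - poly_part c N) < \<epsilon> / 4"
        using elim(1) by (simp add: p dist_norm)
      ultimately have "norm ((pw_calc f (A + e1 *\<^sub>R id_blinfun) (B + e2 *\<^sub>R id_blinfun) - ?pol)
          + (?pol - poly_part c N) + (poly_part c N - pw_calc f A B)) < \<epsilon>"
        using base \<epsilon> norm_minus_commute[of "poly_part c N" "pw_calc f A B"]
        by (intro order.strict_trans1[OF norm_triangle_ineq] order.strict_trans1[OF add_right_mono[OF norm_triangle_ineq]]) linarith
      then show ?case by (simp add: p dist_norm)
    qed
  qed
qed

end

section \<open>Two sources of a spectral gap: an isolated spectral point and finite
  dimension\<close>

context pw_pair
begin

lemma spectral_gap_if_isolated:
  assumes iso: "0 isolated_in spectrum_on UNIV H"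
  shows "\<exists>\<delta>. spectral_gap \<delta>"
proof -
  interpret h: positive_operator H "norm H + 1"
    by (rule positive_operator_norm[OF H])
  obtain U where U: "open U" "U \<inter> spectrum_on UNIV H = {0}"
    using iso unfolding isolated_in_def by blast
  then obtain \<delta> where \<delta>: "0 < \<delta>" "ball 0 \<delta> \<subseteq> U"
    by (metis IntD1 insertI1 openE)
  have no: "Re z \<notin> {0<..<\<delta>}" if z: "z \<in> spectrum_on UNIV H" for z
  proof
    assume *: "Re z \<in> {0<..<\<delta>}"
    have "complex_of_real (Re z) = z"
      using z by (intro h.spectrum_real(1)) (simp only: h.N_eq)
    then have "cmod z = \<bar>Re z\<bar>"
      by (metis norm_of_real)
    then have "z \<in> ball 0 \<delta>" using * by simp
    then have "z = 0" using \<delta> U z by blast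
    then show False using * by simp
  qed
  have "(\<lambda>z. indicator (spectrum_on UNIV H) z * complex_of_real (indicator {0<..<\<delta>} (Re z))) = (\<lambda>_. 0)"
    using no by (intro ext) (auto simp: indicator_def)
  then have "h.fc (\<lambda>t. complex_of_real (indicator {0<..<\<delta>} t)) = h.fc (\<lambda>_. 0)"
    unfolding h.fc_def h.N_eq by simp
  then have "h.fc (\<lambda>t. complex_of_real (indicator {0<..<\<delta>} t)) = 0"
    by (simp only: h.fc_zero)
  then show ?thesis
    using \<delta> by (auto simp: spectral_gap_def)
qed

text \<open>Without a gap every interval (0, b) contains some \<open>[a, b)\<close> with
  \<open>a > 0\<close> and nonzero spectral projection. Repeating this with \<open>a\<close> in
  place of \<open>b\<close> produces infinitely many nonzero orthogonal vectors, which are linearly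
  independent.\<close>

lemma spectral_gap_if_finite_dim:
  assumes fin: "cfinite_dim TYPE('h)"
  shows "\<exists>\<delta>. spectral_gap \<delta>"
proof (rule ccontr)
  assume no_gap: "\<nexists>\<delta>. spectral_gap \<delta>"
  interpret h: positive_operator H "norm H + 1"
    by (rule positive_operator_norm[OF H])
  define Q where "Q a b = h.fc (\<lambda>t. complex_of_real (if a \<le> t \<and> t < b then 1 else 0))" for a b
  have adm: "h.admissible (\<lambda>t. complex_of_real (if a \<le> t \<and> t < b then 1 else 0))" for a b
    by (rule h.admissibleI[of _ 1]) auto
  have adm0: "h.admissible (\<lambda>t. complex_of_real (indicator {0<..<b} t))" for b
    by (rule h.admissibleI[of _ 1]) (auto simp: indicator_def)
  have step: "\<exists>a>0. a < b \<and> Q a b \<noteq> 0" if b: "0 < b" for b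
  proof (rule ccontr)
    assume "\<not> ?thesis"
    then have Q0: "Q a b = 0" if "0 < a" "a < b" for a
      using that by blast
    have "h.fc (\<lambda>t. complex_of_real (indicator {0<..<b} t)) = 0"
    proof (rule op_eqI)
      fix x
      \<comment> \<open>The intervals from \<open>b / (n + 2)\<close> exhaust (0, b); the 2 keeps
        the left end strictly below \<open>b\<close> already for \<open>n = 0\<close>.\<close>
      let ?F = "\<lambda>n z. indicator h.\<sigma> z * complex_of_real (if b / (real n + 2) \<le> Re z \<and> Re z < b then 1 else 0)"
      have "(\<lambda>n. LINT z|scalar_measure h.E x. ?F n z)
          \<longlonglongrightarrow> (LINT z|scalar_measure h.E x. indicator h.\<sigma> z * complex_of_real (indicator {0<..<b} (Re z)))"
      proof (rule LINT_bounded_lim[OF h.calc.finite h.calc.sets h.bb_admissible[OF adm], where C = 1])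
        show "cmod (?F n z) \<le> 1" for n z by (auto simp: indicator_def)
        fix z
        have "\<forall>\<^sub>F n in sequentially. (if b / (real n + 2) \<le> Re z \<and> Re z < b then 1 else 0) = (indicator {0<..<b} (Re z) :: real)"
        proof (cases "0 < Re z")
          case True
          obtain m :: nat where m: "b / Re z < m" using reals_Archimedean2 by blast
          have "b / (real n + 2) \<le> Re z" if "m \<le> n" for n
          proof -
            have "real m \<le> real n" using that by simp
            with m have "b / Re z < real n + 2" by linarith
            then show ?thesis using True by (simp add: field_simps)
          qed
          then show ?thesis
            using True by (auto simp: eventually_sequentially indicator_def)
        next
          case False
          then have "\<not> b / (real n + 2) \<le> Re z" for n
            using b by (smt (verit) divide_pos_pos of_nat_0_le_iff)
          then show ?thesis using False by simp
        qed
        then have "\<forall>\<^sub>F n in sequentially. ?F n z = indicator h.\<sigma> z * complex_of_real (indicator {0<..<b} (Re z))"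
          by eventually_elim simp
        then show "(\<lambda>n. ?F n z) \<longlonglongrightarrow> indicator h.\<sigma> z * complex_of_real (indicator {0<..<b} (Re z))"
          by (rule tendsto_eventually)
      qed
      moreover have "(LINT z|scalar_measure h.E x. ?F n z) = 0" for n
      proof -
        have "0 < b / (real n + 2)" "b / (real n + 2) < b"
          using b by (auto simp: field_simps add_pos_nonneg)
        then have "Q (b / (real n + 2)) b = 0" by (rule Q0)
        then show ?thesis
          using h.fc_form[OF adm, of "b / (real n + 2)" b x] unfolding Q_def by simp
      qed
      ultimately have "(LINT z|scalar_measure h.E x. indicator h.\<sigma> z * complex_of_real (indicator {0<..<b} (Re z))) = 0"
        using LIMSEQ_unique[OF tendsto_const] by fastforce
      then show "cinner (h.fc (\<lambda>t. complex_of_real (indicator {0<..<b} t)) x) x = cinner (blinfun_apply 0 x) x"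
        unfolding h.fc_form[OF adm0] by simp
    qed (simp_all only: h.fc_clinear[OF adm0] clinear_op_simps)
    then show False
      using no_gap b by (auto simp: spectral_gap_def)
  qed
  have "\<exists>b. \<forall>n. 0 < b n \<and> (b (Suc n) < b n \<and> Q (b (Suc n)) (b n) \<noteq> 0)"
  proof (rule dependent_nat_choice[of "\<lambda>_ b. 0 < b" "\<lambda>_ b a. a < b \<and> Q a b \<noteq> 0"])
    show "\<exists>b::real. 0 < b" by (rule exI[of _ 1]) simp
    show "\<exists>a>0. a < b \<and> Q a b \<noteq> 0" if "0 < b" for b and n :: nat
      using step[OF that] .
  qed
  then obtain b :: "nat \<Rightarrow> real"
    where b': "\<forall>n. 0 < b n \<and> (b (Suc n) < b n \<and> Q (b (Suc n)) (b n) \<noteq> 0)"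
    by (rule exE)
  have b: "0 < b n" "b (Suc n) < b n" "Q (b (Suc n)) (b n) \<noteq> 0" for n
    using b'[rule_format, of n] by simp_all
  have dec: "b n \<le> b m" if "m \<le> n" for m n
    by (rule lift_Suc_antimono_le[of b, OF less_imp_le[OF b(2)] that])
  have "\<exists>x. Q (b (Suc n)) (b n) x \<noteq> 0" for n
    using b(3)[of n] by (metis blinfun_eqI zero_blinfun.rep_eq)
  then obtain y where y: "\<And>n. Q (b (Suc n)) (b n) (y n) \<noteq> 0" by metis
  define x where "x n = Q (b (Suc n)) (b n) (y n)" for n
  have less: "cinner (x m) (x n) = 0" if "m < n" for m n
  proof -
    have "b n \<le> b (Suc m)" using dec[of "Suc m" n] that by simp
    then have "h.fc (\<lambda>t. complex_of_real (if b (Suc m) \<le> t \<and> t < b m then 1 else 0)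
        * complex_of_real (if b (Suc n) \<le> t \<and> t < b n then 1 else 0)) = h.fc (\<lambda>_. 0)"
      by (intro h.fc_cong) auto
    then have "Q (b (Suc m)) (b m) o\<^sub>L Q (b (Suc n)) (b n) = 0"
      unfolding Q_def h.fc_mult[OF adm adm] h.fc_zero .
    then have "Q (b (Suc m)) (b m) (x n) = 0"
      by (metis blinfun_apply_blinfun_compose x_def zero_blinfun.rep_eq)
    moreover have "cinner (x m) (x n) = cinner (y m) (Q (b (Suc m)) (b m) (x n))"
      unfolding x_def[of m] Q_def by (rule h.fc_selfadjoint[OF adm])
    ultimately show ?thesis by simp
  qed
  have ortho: "cinner (x m) (x n) = 0" if "m \<noteq> n" for m n
    using less[of m n] less[of n m] that cinner_commute[of "x m" "x n"] by (cases "m < n") auto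
  have x0: "x n \<noteq> 0" for n using y by (simp add: x_def)
  have inj: "inj x"
  proof (rule injI)
    fix m n assume "x m = x n"
    then show "m = n"
      using ortho[of m n] x0[of n] by (cases "m = n") (auto simp: cinner_eq_norm)
  qed
  interpret vs: vector_space "scaleC :: complex \<Rightarrow> 'h \<Rightarrow> 'h"
    by (rule vector_space_scaleC)
  obtain F where F: "finite F" "vs.span F = (UNIV :: 'h set)"
    using fin by (auto simp: cfinite_dim_def)
  \<comment> \<open>Pairing a vanishing linear combination with one of its vectors isolates the
    coefficient of that vector.\<close>
  have "vs.independent (range x)"
    unfolding vs.dependent_explicit
  proof clarify
    fix t u v assume t: "finite t" "t \<subseteq> range x" "(\<Sum>v\<in>t. u v *\<^sub>C v) = 0" and v: "v \<in> t" "u v \<noteq> 0"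
    have "0 = cinner (\<Sum>w\<in>t. u w *\<^sub>C w) v"
      using t by simp
    also have "\<dots> = (\<Sum>w\<in>t. u w * cinner w v)"
      by (simp add: cinner.sum_left cinner_scaleC_left)
    also have "\<dots> = (\<Sum>w\<in>t. if w = v then u v * cinner v v else 0)"
    proof (rule sum.cong[OF refl])
      fix w assume "w \<in> t"
      then obtain m n where "w = x m" "v = x n" using t v by blast
      then show "u w * cinner w v = (if w = v then u v * cinner v v else 0)"
        using ortho[of m n] by (cases "m = n") (auto simp: inj_eq[OF inj])
    qed
    also have "\<dots> = u v * cinner v v"
      using t v by simp
    finally have "cinner v v = 0" using v by simp
    then have "v = 0" by (simp add: cinner_eq_norm)
    moreover obtain n where "v = x n" using t(2) v(1) by blast
    ultimately show False using x0[of n] by simp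
  qed
  then have "finite (range x)"
    using vs.independent_span_bound[OF F(1), of "range x"] F(2) by simp
  then show False
    using finite_imageD[OF _ inj] by simp
qed

end

theorem theorem4:
  fixes A B :: "'h::chilbert_space \<Rightarrow>\<^sub>L 'h"
  assumes "positive_op A" and "positive_op B"
  shows
    "(\<forall>f. f \<in> borel_locally_bounded ({0..} \<times> {0..}) \<longrightarrow> homogeneous_on {0..} f \<longrightarrow>
        (invertible_op A \<longrightarrow>
           pw_calc f A B =
             sqrt_op A
             o\<^sub>L selfadjoint_calc (\<lambda>t. f (1, t)) (inv_op (sqrt_op A) o\<^sub>L B o\<^sub>L inv_op (sqrt_op A))
             o\<^sub>L sqrt_op A) \<and>
        (invertible_op B \<longrightarrow>
           pw_calc f A B =
             sqrt_op B
             o\<^sub>L selfadjoint_calc (\<lambda>t. f (t, 1)) (inv_op (sqrt_op B) o\<^sub>L A o\<^sub>L inv_op (sqrt_op B))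
             o\<^sub>L sqrt_op B)) \<and>
     (invertible_op A \<longrightarrow> invertible_op B \<longrightarrow>
        (\<forall>f. f \<in> borel_locally_bounded ({0<..} \<times> {0<..}) \<longrightarrow> homogeneous_on {0<..} f \<longrightarrow>
           pw_calc f A B =
             sqrt_op A
             o\<^sub>L selfadjoint_calc (\<lambda>t. f (1, t)) (inv_op (sqrt_op A) o\<^sub>L B o\<^sub>L inv_op (sqrt_op A))
             o\<^sub>L sqrt_op A \<and>
           pw_calc f A B =
             sqrt_op B
             o\<^sub>L selfadjoint_calc (\<lambda>t. f (t, 1)) (inv_op (sqrt_op B) o\<^sub>L A o\<^sub>L inv_op (sqrt_op B))
             o\<^sub>L sqrt_op B)) \<and>
     (0 isolated_in spectrum_on UNIV (A + B) \<longrightarrow>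
        (\<forall>f. continuous_on ({0..} \<times> {0..}) f \<longrightarrow> homogeneous_on {0..} f \<longrightarrow>
           ((\<lambda>(e1, e2). pw_calc f (A + e1 *\<^sub>R id_blinfun) (B + e2 *\<^sub>R id_blinfun))
              \<longlongrightarrow> pw_calc f A B) (at (0, 0) within {0..} \<times> {0..}))) \<and>
     (cfinite_dim TYPE('h) \<longrightarrow>
        (\<forall>f. continuous_on ({0..} \<times> {0..}) f \<longrightarrow> homogeneous_on {0..} f \<longrightarrow>
           ((\<lambda>(e1, e2). pw_calc f (A + e1 *\<^sub>R id_blinfun) (B + e2 *\<^sub>R id_blinfun))
              \<longlongrightarrow> pw_calc f A B) (at (0, 0) within {0..} \<times> {0..})))"
proof -
  interpret pw_pair A B by unfold_locales (rule assms)+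
  show ?thesis
  proof (intro conjI allI impI)
    assume "0 isolated_in spectrum_on UNIV (A + B)"
    then have "\<exists>\<delta>. spectral_gap \<delta>"
      by (intro spectral_gap_if_isolated) (simp add: H_def)
    then show "((\<lambda>(e1, e2). pw_calc f (A + e1 *\<^sub>R id_blinfun) (B + e2 *\<^sub>R id_blinfun))
        \<longlongrightarrow> pw_calc f A B) (at (0, 0) within quadrant)" if "continuous_on quadrant f" for f
      using convergence_of_gap that by blast
  next
    assume "cfinite_dim TYPE('h)"
    then have "\<exists>\<delta>. spectral_gap \<delta>"
      by (rule spectral_gap_if_finite_dim)
    then show "((\<lambda>(e1, e2). pw_calc f (A + e1 *\<^sub>R id_blinfun) (B + e2 *\<^sub>R id_blinfun))
        \<longlongrightarrow> pw_calc f A B) (at (0, 0) within quadrant)" if "continuous_on quadrant f" for f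
      using convergence_of_gap that by blast
  qed (rule pw_calc_left_invertible pw_calc_right_invertible
      pw_calc_both_invertible(1) pw_calc_both_invertible(2); assumption)+
qed

end
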